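(* In the setting and under the standing hypotheses described in the context, let $u:[0,\infty)\to U$, $\beta:[0,\infty)\to[0,1]^M$ and $\tilde\beta:[0,\infty)\to[0,1]^M$ be piecewise smooth controls such that $u(t)\in\mathcal{U}$, $\sum_{j=1}^M\beta_j(t)=1$ and $\sum_{j=1}^M\tilde\beta_j(t)=1$ for almost every $t$. Then there exist constants $T_0>0$ and $\bar C=\bar C(u,\beta)>0$, depending on $u$ and $\beta$ (and on the data of the problem) but not on $\tilde\beta$, such that the following holds. If $0<T\le T_0$, $\varepsilon>0$ and $$\max_{j=1,\ldots,M}\ \sup_{t\in[0,T]}\left|\int_0^t \beta_j(s)-\tilde\beta_j(s)\,ds\right|\le\varepsilon,$$ then $$\|y(u,\beta)-y(u,\tilde\beta)\|_{C([0,T];L^1(0,L;\mathbb{R}^n))}\le \bar C\,\varepsilon,$$ where $y(u,\beta)$ and $y(u,\tilde\beta)$ denote the $L^1$-solutions on $[0,T]$ of the relaxed initial boundary value problem with controls $(u,\beta)$ and $(u,\tilde\beta)$, respectively.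
   Context: **Setting.** Let $L>0$, $n,M\in\mathbb{N}$, $r\in\{1,\ldots,n\}$. Let $\Lambda=\mathrm{diag}(\lambda_1,\ldots,\lambda_n)$ with $\lambda_i:[0,L]\to\mathbb{R}$, $\lambda_i<0$ for $i\le r$ and $\lambda_i>0$ for $i\ge r+1$. Let $U,V$ be normed vector spaces, $\mathcal{U}\subset U$ closed, $v^1,\ldots,v^M\in V$ given values, and $f:\mathbb{R}^n\times U\times V\to\mathbb{R}^n$. For $y=(y_1,\ldots,y_n)^\top$ write $y^-=(y_1,\ldots,y_r)^\top$, $y^+=(y_{r+1},\ldots,y_n)^\top$. Let $G=\begin{pmatrix} G_{--} & G_{-+} \\ G_{+-} & G_{++} \end{pmatrix}\in\mathbb{R}^{n\times n}$ be a constant matrix with blocks of sizes $r\times r$, $r\times(n-r)$, $(n-r)\times r$, $(n-r)\times(n-r)$. Let $d^-:[0,\infty)\to\mathbb{R}^r$, $d^+:[0,\infty)\to\mathbb{R}^{n-r}$ and $\bar y:[0,L]\to\mathbb{R}^n$. **Relaxed problem.** For controls $u$ and $\beta=(\beta_1,\ldots,\beta_M)$: $$y_t+\Lambda(x)y_x=\sum_{j=1}^M\beta_j(t)f(y,u(t),v^j)\ \text{ on }(0,T)\times(0,L),$$ $$\begin{pmatrix} y^-(t,L) \\ y^+(t,0) \end{pmatrix}=G\begin{pmatrix} y^-(t,0) \\ y^+(t,L) \end{pmatrix}+\begin{pmatrix} d^-(t) \\ d^+(t) \end{pmatrix}\ \text{ on }(0,T),\qquad y(0,x)=\bar y(x)\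 \text{ on }[0,L].$$ **Standing hypotheses.** Each $\lambda_i$ is Lipschitz-continuous on $[0,L]$. For all $j$ and all $u\in U$, the map $y\mapsto f(y,u,v^j)$ is smooth and $f(0,u,v^j)=0$. For all $j$ and all $y\in\mathbb{R}^n$, the map $u\mapsto f(y,u,v^j)$ is locally Lipschitz-continuous on $U$. For every $T>0$ there are finitely many points $0=\tau_0<\tau_1<\dots<\tau_K=T$ and $0=x_0<x_1<\dots<x_\nu=L$ such that the restriction of $\bar y$ to each $(x_i,x_{i+1})$, $0\le i\le\nu-1$, is in $W^{1,1}(x_i,x_{i+1};\mathbb{R}^n)$, and the restrictions of $d^-$ and $d^+$ to each $(\tau_i,\tau_{i+1})$, $0\le i\le K-1$, are in $W^{1,1}(\tau_i,\tau_{i+1};\mathbb{R}^r)$ and $W^{1,1}(\tau_i,\tau_{i+1};\mathbb{R}^{n-r})$, respectively. **Piecewise smooth** on an interval has the usual meaning: every bounded subinterval splits into finitely many pieces, on each of which the function is smooth up to the endpoints. **$L^1$-solution.** For $(\tau,\sigma)\in\Omega_T=[0,T]\times[0,L]$ let $s_i(\cdot;\tau,\sigma)$ solve $\frac{d}{dt}s_i=\lambda_i(s_i)$, $s_i(\tau;\tau,\sigma)=\sigma$, and let $t_i^*=t_i^*(\tau,\sigma)\in[0,\tau]$ be the time at which this curve, followed backward in time, meets the boundary of $\Omega_T$. For $y:\Omega_T\to\mathbb{R}^n$ define $\psi(y)=(\psi_1(y),\ldots,\psi_n(y))$ recursively by $$\psi_i(y)(\tau,\sigma)=Y_i(\psi;\tau,\sigma)+\sum_{j=1}^M\int_{t_i^*}^\tau\beta_j(t)f\big(y(t,s_i(t;\tau,\sigma)),u(t),v^j\big)\,dt,$$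 where $Y_i(\psi;\tau,\sigma)$ is the $i$-th component of $$G\begin{pmatrix} \psi^-(y)(t_i^*,0) \\ \psi^+(y)(t_i^*,L) \end{pmatrix}+\begin{pmatrix} d^-(t_i^* ) \\ d^+(t_i^* ) \end{pmatrix}\ \text{ if }t_i^*>0,\qquad \bar y(s_i(t_i^*;\tau,\sigma))\ \text{ if }t_i^*=0,$$ with $\psi^-=(\psi_1,\ldots,\psi_r)^\top$, $\psi^+=(\psi_{r+1},\ldots,\psi_n)^\top$. The $L^1$-solution $y(u,\beta)$ on $[0,T]$ is the unique essentially bounded fixed point $y=\psi(y)$ in $C([0,T];L^1(0,L;\mathbb{R}^n))$. Under the standing hypotheses, for given piecewise smooth $u$, it exists for all sufficiently small $T$, uniformly over all piecewise smooth $\beta$ with values in $[0,1]^M$. The norm is $\|y\|_{C([0,T];L^1(0,L;\mathbb{R}^n))}=\sup_{t\in[0,T]}\sum_{i=1}^n\int_0^L|y_i(t,x)|\,dx$ (or any equivalent choice).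
   Formalization: Local Lipschitz continuity of f(y,u,v^j) in u, and in y, is assumed with constants locally uniform in the other variable; under the purely pointwise conditions L^1-solutions need not be unique and the estimate can fail. *)

theory Defs
  imports "HOL-Analysis.Analysis"
begin

text \<open>
  The index set of the components of $y$ is a finite linearly ordered type \<open>'n\<close>, so that the \<open>n\<close> of
  the text is \<^term>\<open>CARD('n)\<close>; the index set of the controls is a finite type \<open>'m\<close>, with
  \<open>M = CARD('m)\<close>. The vectors $(d^-,d^+)$ are stacked into a single function \<open>d\<close> with values in
  \<^typ>\<open>real ^ 'n\<close>, and the four blocks of $G$ into a single matrix. Functions on $[0,L]$ or
  $[0,\infty)$ are total functions whose values elsewhere are never used.
\<close>

definition first_indices :: "nat \<Rightarrow> 'n::{finite,linorder} set" where
  "first_indices r = {i. card {k. k \<le> i} \<le> r}"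


text \<open>The notation \<open>real ^ 'n\<close> for these types would impose the bare sort \<open>finite\<close> on \<open>'n\<close>.\<close>

type_synonym 'n rvec = "(real, 'n) vec"
type_synonym 'n rmat = "((real, 'n) vec, 'n) vec"


subsection \<open>Regularity notions\<close>

primrec Ck_map :: "nat \<Rightarrow> ('a::real_normed_vector \<Rightarrow> 'b::real_normed_vector) \<Rightarrow> bool" where
  "Ck_map 0 g \<longleftrightarrow> continuous_on UNIV g"
| "Ck_map (Suc k) g \<longleftrightarrow>
     (\<forall>x. g differentiable (at x)) \<and> (\<forall>h. Ck_map k (\<lambda>x. frechet_derivative g (at x) h))"

text \<open>Directional derivatives determine the full derivatives because it is only used for a
  finite-dimensional domain.\<close>

definition smooth_map :: "('a::euclidean_space \<Rightarrow> 'b::real_normed_vector) \<Rightarrow> bool" where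
  "smooth_map g \<longleftrightarrow> (\<forall>k. Ck_map k g)"

text \<open>The restriction of \<open>g\<close> to the open interval is smooth, and all its derivatives extend
  continuously to the closed one; the values of \<open>g\<close> at the two endpoints are irrelevant, so that
  jumps are allowed at the break points below.\<close>

definition smooth_upto_endpoints :: "real \<Rightarrow> real \<Rightarrow> (real \<Rightarrow> 'a::real_normed_vector) \<Rightarrow> bool" where
  "smooth_upto_endpoints a b g \<longleftrightarrow>
     (\<exists>D :: nat \<Rightarrow> real \<Rightarrow> 'a.
        (\<forall>t\<in>{a<..<b}. D 0 t = g t) \<and>
        (\<forall>k. \<forall>t\<in>{a..b}. (D k has_vector_derivative D (Suc k) t) (at t within {a..b})))"

definition piecewise_on ::
  "(real \<Rightarrow> real \<Rightarrow> (real \<Rightarrow> 'a) \<Rightarrow> bool) \<Rightarrow> real \<Rightarrow> real \<Rightarrow> (real \<Rightarrow> 'a) \<Rightarrow> bool" where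
  "piecewise_on P a b g \<longleftrightarrow>
     (\<exists>(K::nat) p. p 0 = a \<and> p K = b \<and> (\<forall>i<K. p i < p (Suc i) \<and> P (p i) (p (Suc i)) g))"

definition piecewise_smooth :: "(real \<Rightarrow> 'a::real_normed_vector) \<Rightarrow> bool" where
  "piecewise_smooth g \<longleftrightarrow> (\<forall>a b. 0 \<le> a \<longrightarrow> a < b \<longrightarrow> piecewise_on smooth_upto_endpoints a b g)"

text \<open>$\phi\in C^1_c(a,b)$ with derivative $\phi'$.\<close>

definition test_function :: "real \<Rightarrow> real \<Rightarrow> (real \<Rightarrow> real) \<Rightarrow> (real \<Rightarrow> real) \<Rightarrow> bool" where
  "test_function a b \<phi> \<phi>' \<longleftrightarrow>
     (\<forall>x. (\<phi> has_real_derivative \<phi>' x) (at x)) \<and> continuous_on UNIV \<phi>' \<and>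
     (\<exists>c e. a < c \<and> e < b \<and> (\<forall>x. x \<notin> {c..e} \<longrightarrow> \<phi> x = 0))"

text \<open>The Sobolev space $W^{1,1}(a,b)$: \<open>g\<close> and its weak derivative \<open>h\<close> are integrable. As in
  Brezis' book, the test functions in dimension one are taken from $C^1_c(a,b)$.\<close>

definition W11 :: "real \<Rightarrow> real \<Rightarrow> (real \<Rightarrow> 'a::euclidean_space) \<Rightarrow> bool" where
  "W11 a b g \<longleftrightarrow>
     set_integrable lebesgue {a<..<b} g \<and>
     (\<exists>h. set_integrable lebesgue {a<..<b} h \<and>
        (\<forall>\<phi> \<phi>'. test_function a b \<phi> \<phi>' \<longrightarrow>
           (LINT x:{a<..<b}|lebesgue. \<phi>' x *\<^sub>R g x) = - (LINT x:{a<..<b}|lebesgue. \<phi> x *\<^sub>R h x)))"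


subsection \<open>Characteristics\<close>

text \<open>\<open>s\<close> solves $ds/dt=\lambda(s)$, $s(\tau)=\sigma$ on $[t_0,\tau]$ without leaving $[0,L]$.\<close>

definition backward_curve ::
  "(real \<Rightarrow> real) \<Rightarrow> real \<Rightarrow> real \<Rightarrow> real \<Rightarrow> real \<Rightarrow> (real \<Rightarrow> real) \<Rightarrow> bool" where
  "backward_curve lam L \<tau> \<sigma> t0 s \<longleftrightarrow>
     s \<tau> = \<sigma> \<and>
     (\<forall>t\<in>{t0..\<tau>}. s t \<in> {0..L} \<and> (s has_real_derivative lam (s t)) (at t within {t0..\<tau>}))"

text \<open>The time $t^*$ at which the curve, followed backward from $(\tau,\sigma)$, reaches the boundary of
  $[0,T]\times[0,L]$. It is the time of exit: a point with $\tau=T$, or with $\sigma$ on the side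
  from which the backward curve enters the domain, is not stopped immediately.\<close>

definition exit_time :: "(real \<Rightarrow> real) \<Rightarrow> real \<Rightarrow> real \<Rightarrow> real \<Rightarrow> real" where
  "exit_time lam L \<tau> \<sigma> = Inf {t0 \<in> {0..\<tau>}. \<exists>s. backward_curve lam L \<tau> \<sigma> t0 s}"

text \<open>The curve $s(\cdot;\tau,\sigma)$; it is unique on $[t^*,\tau]$ for Lipschitz-continuous $\lambda$, and
  its values at other times are never used.\<close>

definition char_curve :: "(real \<Rightarrow> real) \<Rightarrow> real \<Rightarrow> real \<Rightarrow> real \<Rightarrow> real \<Rightarrow> real" where
  "char_curve lam L \<tau> \<sigma> = (SOME s. backward_curve lam L \<tau> \<sigma> (exit_time lam L \<tau> \<sigma>) s)"


subsection \<open>The space $C([0,T];L^1(0,L;\mathbb{R}^n))$\<close>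

definition L1_norm :: "real \<Rightarrow> (real \<Rightarrow> real ^ 'n::finite) \<Rightarrow> real" where
  "L1_norm L g = (\<Sum>i\<in>UNIV. LINT x:{0..L}|lebesgue. \<bar>g x $ i\<bar>)"

definition CL1_norm :: "real \<Rightarrow> real \<Rightarrow> (real \<Rightarrow> real \<Rightarrow> real ^ 'n::finite) \<Rightarrow> real" where
  "CL1_norm T L y = (SUP t\<in>{0..T}. L1_norm L (y t))"

text \<open>An element of the space is represented by a jointly measurable function on $[0,T]\times[0,L]$.\<close>

definition in_CL1 :: "real \<Rightarrow> real \<Rightarrow> (real \<Rightarrow> real \<Rightarrow> real ^ 'n::finite) \<Rightarrow> bool" where
  "in_CL1 T L y \<longleftrightarrow>
     (\<lambda>(t, x). y t x) \<in> borel_measurable (lebesgue_on ({0..T} \<times> {0..L})) \<and>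
     (\<forall>t\<in>{0..T}. set_integrable lebesgue {0..L} (y t)) \<and>
     (\<forall>t\<in>{0..T}. ((\<lambda>t'. L1_norm L (\<lambda>x. y t' x - y t x)) \<longlongrightarrow> 0) (at t within {0..T}))"

definition CL1_eq :: "real \<Rightarrow> real \<Rightarrow> (real \<Rightarrow> real \<Rightarrow> real ^ 'n::finite) \<Rightarrow> (real \<Rightarrow> real \<Rightarrow> real ^ 'n) \<Rightarrow> bool"
  where
  "CL1_eq T L y z \<longleftrightarrow> (\<forall>t\<in>{0..T}. AE x in lebesgue_on {0..L}. y t x = z t x)"

definition ess_bounded :: "real \<Rightarrow> real \<Rightarrow> (real \<Rightarrow> real \<Rightarrow> real ^ 'n::finite) \<Rightarrow> bool" where
  "ess_bounded T L y \<longleftrightarrow>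
     (\<exists>B. AE (t, x) in lebesgue_on ({0..T} \<times> {0..L}). norm (y t x) \<le> B)"


subsection \<open>$L^1$-solutions\<close>

text \<open>\<open>psi\<close> satisfies the recursion that defines $\psi(y)$. The recursion is well-founded: from a
  boundary point $(t^*,0)$ or $(t^*,L)$, each component of $\psi$ that is called goes back in time
  by at least the time needed to cross $[0,L]$. Hence \<open>psi\<close> is uniquely determined on
  $[0,T]\times[0,L]$.\<close>

definition is_psi ::
  "real \<Rightarrow> nat \<Rightarrow> ('n::{finite,linorder} \<Rightarrow> real \<Rightarrow> real) \<Rightarrow> 'n rmat \<Rightarrow> (real \<Rightarrow> 'n rvec) \<Rightarrow>
   (real \<Rightarrow> 'n rvec) \<Rightarrow> ('n rvec \<Rightarrow> 'u \<Rightarrow> 'v \<Rightarrow> 'n rvec) \<Rightarrow> ('m::finite \<Rightarrow> 'v) \<Rightarrow>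
   (real \<Rightarrow> 'u) \<Rightarrow> (real \<Rightarrow> real ^ 'm) \<Rightarrow> real \<Rightarrow>
   (real \<Rightarrow> real \<Rightarrow> 'n rvec) \<Rightarrow> (real \<Rightarrow> real \<Rightarrow> 'n rvec) \<Rightarrow> bool" where
  "is_psi L r lam G d ybar f v u \<beta> T y psi \<longleftrightarrow>
     (\<forall>\<tau>\<in>{0..T}. \<forall>\<sigma>\<in>{0..L}. \<forall>i.
        let ts = exit_time (lam i) L \<tau> \<sigma>;
            s = char_curve (lam i) L \<tau> \<sigma>;
            Y = (if ts > 0
                 then G *v (\<chi> k. if k \<in> first_indices r then psi ts 0 $ k else psi ts L $ k) + d ts
                 else ybar (s ts))
        in psi \<tau> \<sigma> $ i =
             Y $ i + (\<Sum>j\<in>UNIV. LINT t:{ts..\<tau>}|lebesgue. \<beta> t $ j * f (y t (s t)) (u t) (v j) $ i))"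

definition is_fixed_point ::
  "real \<Rightarrow> nat \<Rightarrow> ('n::{finite,linorder} \<Rightarrow> real \<Rightarrow> real) \<Rightarrow> 'n rmat \<Rightarrow> (real \<Rightarrow> 'n rvec) \<Rightarrow>
   (real \<Rightarrow> 'n rvec) \<Rightarrow> ('n rvec \<Rightarrow> 'u \<Rightarrow> 'v \<Rightarrow> 'n rvec) \<Rightarrow> ('m::finite \<Rightarrow> 'v) \<Rightarrow>
   (real \<Rightarrow> 'u) \<Rightarrow> (real \<Rightarrow> real ^ 'm) \<Rightarrow> real \<Rightarrow> (real \<Rightarrow> real \<Rightarrow> 'n rvec) \<Rightarrow> bool" where
  "is_fixed_point L r lam G d ybar f v u \<beta> T y \<longleftrightarrow>
     in_CL1 T L y \<and> ess_bounded T L y \<and>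
     (\<exists>psi. is_psi L r lam G d ybar f v u \<beta> T y psi \<and> CL1_eq T L y psi)"

text \<open>\<open>y\<close> is the unique essentially bounded fixed point.\<close>

definition is_L1_solution ::
  "real \<Rightarrow> nat \<Rightarrow> ('n::{finite,linorder} \<Rightarrow> real \<Rightarrow> real) \<Rightarrow> 'n rmat \<Rightarrow> (real \<Rightarrow> 'n rvec) \<Rightarrow>
   (real \<Rightarrow> 'n rvec) \<Rightarrow> ('n rvec \<Rightarrow> 'u \<Rightarrow> 'v \<Rightarrow> 'n rvec) \<Rightarrow> ('m::finite \<Rightarrow> 'v) \<Rightarrow>
   (real \<Rightarrow> 'u) \<Rightarrow> (real \<Rightarrow> real ^ 'm) \<Rightarrow> real \<Rightarrow> (real \<Rightarrow> real \<Rightarrow> 'n rvec) \<Rightarrow> bool" where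
  "is_L1_solution L r lam G d ybar f v u \<beta> T y \<longleftrightarrow>
     is_fixed_point L r lam G d ybar f v u \<beta> T y \<and>
     (\<forall>z. is_fixed_point L r lam G d ybar f v u \<beta> T z \<longrightarrow> CL1_eq T L z y)"


subsection \<open>Controls\<close>

definition admissible_beta :: "(real \<Rightarrow> real ^ 'm::finite) \<Rightarrow> bool" where
  "admissible_beta \<beta> \<longleftrightarrow>
     piecewise_smooth \<beta> \<and> (\<forall>t\<ge>0. \<forall>j. \<beta> t $ j \<in> {0..1}) \<and>
     (AE t in lebesgue_on {0..}. (\<Sum>j\<in>UNIV. \<beta> t $ j) = 1)"

end

theory Submission
  imports Defs
begin

text \<open>
  Let \<open>\<theta>\<^sub>i\<close> be the primitive of \<open>1/\<lambda>\<^sub>i\<close> that vanishes at the end of \<open>[0,L]\<close> where component \<open>i\<close> enters.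
  Along a characteristic of component \<open>i\<close> the quantity \<open>z = \<theta>\<^sub>i(x) - t\<close> is constant; \<open>z \<ge> 0\<close> means that
  the backward characteristic reaches the initial line, \<open>z < 0\<close> that it leaves through the inlet at time
  \<open>-z\<close>. As long as no characteristic has had the time \<open>\<Theta>\<^sub>k = \<theta>\<^sub>k(outlet)\<close> to cross \<open>[0,L]\<close>, the outlet
  values that enter the boundary condition come directly from the initial data, so the recursion that
  defines \<open>\<psi>\<close> stops after one reflection. Because \<open>f(0,u,v) = 0\<close>, states and sources may be extended by
  \<open>0\<close> outside \<open>[0,L]\<close>, and \<open>\<psi>\<close> becomes one explicit operator \<open>Psi\<close>: a datum depending on \<open>z\<close> alone, plus
  the integral of the source along the incoming leg, plus \<open>G\<close> applied to the integrals along the legs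
  that were reflected.

  For the difference \<open>y - y'\<close> of the two solutions the source splits into
  \<open>\<Sum>\<^sub>j \<beta>'\<^sub>j (f\<^sub>j(y) - f\<^sub>j(y'))\<close> and \<open>\<Sum>\<^sub>j (\<beta>\<^sub>j - \<beta>'\<^sub>j) f\<^sub>j(y)\<close>. The first part contributes, for short times, at
  most one half of the supremum in time of the \<open>L\<^sup>1\<close> distance (\<open>Psi_diff_L1\<close>). The second is an integral of
  a coefficient with primitive of size \<open>\<epsilon>\<close> against \<open>q(t) = f\<^sub>j(y)\<close> sampled on the characteristics through
  time \<open>t\<close>. An integration by parts on a single characteristic is not available, since it can meet a jump of another
  component infinitely often when the difference of the two speeds keeps changing sign; but \<open>t \<mapsto> q(t)\<close> is Lipschitz into \<open>L\<^sup>1\<close>,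
  and Abel summation over a fine partition of the time interval then gives a bound \<open>C \<epsilon>\<close> in \<open>L\<^sup>1\<close>
  (\<open>oscillation_L1_bound\<close>). The theorem \<open>stability\<close> puts both parts together.

  The \<open>L\<^sup>1\<close> Lipschitz continuity of \<open>q\<close> rests on \<open>\<integral>|g(x+h) - g(x)| dx \<le> |h| Var g\<close>
  (\<open>nn_integral_translation_le_variation\<close>) and on a bound for the total variation in space of \<open>y(t)\<close>,
  uniform in time, which the Picard iteration for \<open>Psi\<close> preserves (\<open>Psi_variation\<close>). The data enter
  through representatives that are Borel, bounded and of bounded variation, supplied by the
  du Bois-Reymond lemma on each piece. All bounds use only \<open>0 \<le> \<beta>\<^sub>j \<le> 1\<close>, so that \<open>T\<^sub>0\<close> and the constant
  do not depend on \<open>\<beta>'\<close>.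

  A solution is unique among all essentially bounded fixed points, whose
  representatives are merely Lebesgue measurable. Each of them agrees, at every time and almost everywhere in
  space, with a bounded Borel function that is a fixed point of \<open>Psi\<close>
  (\<open>fixed_point_Borel_version\<close>); for these a Gronwall argument gives uniqueness
  (\<open>fixed_point_unique\<close>).
\<close>


section \<open>Functions of bounded variation on the line\<close>

text \<open>
  Total variation at most \<open>V\<close>, expressed by finite sums so that the bound passes to
  pointwise limits and to integrals over a parameter with no measurability condition on the
  variation itself.
\<close>

definition variation_le :: "(real \<Rightarrow> 'a::real_normed_vector) \<Rightarrow> real \<Rightarrow> bool" where
  "variation_le g V \<longleftrightarrow>
     (\<forall>x N. mono (x :: nat \<Rightarrow> real) \<longrightarrow> (\<Sum>l<N. norm (g (x (Suc l)) - g (x l))) \<le> V)"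

lemma variation_leD:
  "variation_le g V \<Longrightarrow> mono (x :: nat \<Rightarrow> real) \<Longrightarrow> (\<Sum>l<N. norm (g (x (Suc l)) - g (x l))) \<le> V"
  unfolding variation_le_def by blast

lemma variation_le_nonneg: "variation_le g V \<Longrightarrow> 0 \<le> V"
  using variation_leD[of g V "\<lambda>_. 0" 0] by (simp add: mono_def)

lemma variation_le_weaken: "variation_le g V \<Longrightarrow> V \<le> W \<Longrightarrow> variation_le g W"
  unfolding variation_le_def by (meson order_trans)

lemma variation_le_two_points:
  assumes "variation_le g V" shows "norm (g x - g y) \<le> V"
proof -
  have *: "norm (g b - g a) \<le> V" if "a \<le> b" for a b :: real
    using variation_leD[OF assms, of "\<lambda>n. if n = 0 then a else b" 1] that
    by (simp add: mono_def)
  show ?thesis using *[of x y] *[of y x] by (cases "x \<le> y") (auto simp: norm_minus_commute)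
qed

lemma variation_le_compose_mono:
  assumes "variation_le g V" "mono \<phi>" shows "variation_le (\<lambda>x. g (\<phi> x)) V"
  unfolding variation_le_def
proof (intro allI impI)
  fix x :: "nat \<Rightarrow> real" and N assume "mono x"
  then have "mono (\<lambda>n. \<phi> (x n))" using assms(2) by (simp add: mono_def)
  from variation_leD[OF assms(1) this] show "(\<Sum>l<N. norm (g (\<phi> (x (Suc l))) - g (\<phi> (x l)))) \<le> V" .
qed

text \<open>
  An antitone change of variables reverses each partition, and the sum over the reversed partition
  is the same.
\<close>

lemma variation_le_compose_antimono:
  assumes "variation_le g V" "antimono \<phi>" shows "variation_le (\<lambda>x. g (\<phi> x)) V"
  unfolding variation_le_def
proof (intro allI impI)
  fix x :: "nat \<Rightarrow> real" and N assume x: "mono x"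
  define x' where "x' l = \<phi> (x (N - l))" for l
  have "mono x'"
    unfolding x'_def using x assms(2) by (auto simp: mono_def antimono_def)
  from variation_leD[OF assms(1) this, of N]
  have "(\<Sum>l<N. norm (g (x' (Suc l)) - g (x' l))) \<le> V" .
  also have "(\<Sum>l<N. norm (g (x' (Suc l)) - g (x' l))) =
      (\<Sum>l<N. norm (g (x' (Suc (N - Suc l))) - g (x' (N - Suc l))))"
    by (rule sum.nat_diff_reindex[symmetric])
  also have "\<dots> = (\<Sum>l<N. norm (g (\<phi> (x (Suc l))) - g (\<phi> (x l))))"
    by (intro sum.cong refl) (auto simp: x'_def Suc_diff_Suc norm_minus_commute)
  finally show "(\<Sum>l<N. norm (g (\<phi> (x (Suc l))) - g (\<phi> (x l)))) \<le> V" .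
qed

text \<open>
  The sums telescope for the monotone majorant \<open>v\<close>. This is how absolutely continuous
  functions are treated, with \<open>v\<close> the integral of the absolute value of the density.
\<close>

lemma variation_le_dominated:
  fixes v :: "real \<Rightarrow> real"
  assumes "\<And>x y. x \<le> y \<Longrightarrow> norm (g y - g x) \<le> v y - v x"
    and "\<And>x. v x \<in> {a..b}"
  shows "variation_le g (b - a)"
  unfolding variation_le_def
proof (intro allI impI)
  fix x :: "nat \<Rightarrow> real" and N assume x: "mono x"
  have "(\<Sum>l<N. norm (g (x (Suc l)) - g (x l))) \<le> (\<Sum>l<N. v (x (Suc l)) - v (x l))"
    using x by (intro sum_mono assms) (auto simp: mono_def)
  also have "\<dots> = v (x N) - v (x 0)" by (rule sum_lessThan_telescope)
  also have "\<dots> \<le> b - a" using assms(2)[of "x N"] assms(2)[of "x 0"] by auto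
  finally show "(\<Sum>l<N. norm (g (x (Suc l)) - g (x l))) \<le> b - a" .
qed

lemma variation_le_mono_fun:
  fixes v :: "real \<Rightarrow> real"
  assumes "mono v" "\<And>x. v x \<in> {a..b}"
  shows "variation_le v (b - a)"
  using assms by (intro variation_le_dominated[where v = v]) (auto simp: mono_def)

lemma variation_le_Lipschitz:
  assumes "variation_le g V" "\<And>x y. norm (h x - h y) \<le> K * norm (g x - g y)" "0 \<le> K"
  shows "variation_le h (K * V)"
  unfolding variation_le_def
proof (intro allI impI)
  fix x :: "nat \<Rightarrow> real" and N assume x: "mono x"
  have "(\<Sum>l<N. norm (h (x (Suc l)) - h (x l))) \<le> K * (\<Sum>l<N. norm (g (x (Suc l)) - g (x l)))"
    by (simp add: sum_distrib_left sum_mono assms)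
  also have "\<dots> \<le> K * V" using variation_leD[OF assms(1) x] assms(3) by (rule mult_left_mono)
  finally show "(\<Sum>l<N. norm (h (x (Suc l)) - h (x l))) \<le> K * V" .
qed

lemma variation_le_add:
  assumes "variation_le g V" "variation_le h W" shows "variation_le (\<lambda>x. g x + h x) (V + W)"
  unfolding variation_le_def
proof (intro allI impI)
  fix x :: "nat \<Rightarrow> real" and N assume x: "mono x"
  have "(\<Sum>l<N. norm (g (x (Suc l)) + h (x (Suc l)) - (g (x l) + h (x l))))
     \<le> (\<Sum>l<N. norm (g (x (Suc l)) - g (x l)) + norm (h (x (Suc l)) - h (x l)))"
    by (intro sum_mono) (metis add_diff_add norm_triangle_ineq)
  also have "\<dots> \<le> V + W"
    unfolding sum.distrib using variation_leD[OF assms(1) x, of N] variation_leD[OF assms(2) x, of N] by linarith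
  finally show "(\<Sum>l<N. norm (g (x (Suc l)) + h (x (Suc l)) - (g (x l) + h (x l)))) \<le> V + W" .
qed

lemma variation_le_const: "variation_le (\<lambda>x. c) 0"
  unfolding variation_le_def by simp

lemma variation_le_sum:
  assumes "finite I" "\<And>i. i \<in> I \<Longrightarrow> variation_le (g i) (V i)"
  shows "variation_le (\<lambda>x. \<Sum>i\<in>I. g i x) (\<Sum>i\<in>I. V i)"
  using assms
proof (induction I)
  case empty then show ?case by (simp add: variation_le_const)
next
  case (insert i I)
  then show ?case by (simp add: variation_le_add)
qed

text \<open>
  The product rule. It is used for cut-offs: restricting a function to an interval adds its
  supremum once for each jump of the indicator.
\<close>

lemma variation_le_scaleR:
  fixes \<eta> :: "real \<Rightarrow> real"
  assumes g: "variation_le g V" and \<eta>: "variation_le \<eta> W"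
    and "\<And>x. \<bar>\<eta> x\<bar> \<le> A" "\<And>x. norm (g x) \<le> R"
  shows "variation_le (\<lambda>x. \<eta> x *\<^sub>R g x) (A * V + W * R)"
  unfolding variation_le_def
proof (intro allI impI)
  have A0: "0 \<le> A" using assms(3)[of 0] by linarith
  have R0: "0 \<le> R" using assms(4)[of 0] norm_ge_zero order_trans by blast
  fix x :: "nat \<Rightarrow> real" and N assume x: "mono x"
  have *: "norm (\<eta> b *\<^sub>R g b - \<eta> a *\<^sub>R g a) \<le> A * norm (g b - g a) + norm (\<eta> b - \<eta> a) * R" for a b
  proof -
    have "\<eta> b *\<^sub>R g b - \<eta> a *\<^sub>R g a = \<eta> b *\<^sub>R (g b - g a) + (\<eta> b - \<eta> a) *\<^sub>R g a"
      by (simp add: algebra_simps)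
    then have "norm (\<eta> b *\<^sub>R g b - \<eta> a *\<^sub>R g a) \<le> \<bar>\<eta> b\<bar> * norm (g b - g a) + \<bar>\<eta> b - \<eta> a\<bar> * norm (g a)"
      by (metis norm_scaleR norm_triangle_ineq)
    also have "\<dots> \<le> A * norm (g b - g a) + norm (\<eta> b - \<eta> a) * R"
      by (intro add_mono mult_mono) (auto simp: assms A0)
    finally show ?thesis .
  qed
  have "(\<Sum>l<N. norm (\<eta> (x (Suc l)) *\<^sub>R g (x (Suc l)) - \<eta> (x l) *\<^sub>R g (x l)))
     \<le> (\<Sum>l<N. A * norm (g (x (Suc l)) - g (x l)) + norm (\<eta> (x (Suc l)) - \<eta> (x l)) * R)"
    by (intro sum_mono *)
  also have "\<dots> = A * (\<Sum>l<N. norm (g (x (Suc l)) - g (x l))) + (\<Sum>l<N. norm (\<eta> (x (Suc l)) - \<eta> (x l))) * R"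
    by (simp add: sum.distrib sum_distrib_left sum_distrib_right)
  also have "\<dots> \<le> A * V + W * R"
    using variation_leD[OF g x, of N] variation_leD[OF \<eta> x, of N] A0 R0
    by (intro add_mono mult_left_mono mult_right_mono) auto
  finally show "(\<Sum>l<N. norm (\<eta> (x (Suc l)) *\<^sub>R g (x (Suc l)) - \<eta> (x l) *\<^sub>R g (x l))) \<le> A * V + W * R" .
qed

lemma variation_le_indicator_atLeast: "variation_le (indicat_real {a..}) 1"
proof -
  have "variation_le (indicat_real {a..}) (1 - 0)"
    by (intro variation_le_mono_fun) (auto simp: mono_def indicator_def)
  then show ?thesis by simp
qed

lemma variation_le_indicator_greaterThan: "variation_le (indicat_real {a<..}) 1"
proof -
  have "variation_le (indicat_real {a<..}) (1 - 0)"
    by (intro variation_le_mono_fun) (auto simp: mono_def indicator_def)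
  then show ?thesis by simp
qed

lemma variation_le_minus: "variation_le g V \<Longrightarrow> variation_le (\<lambda>x. - g x) V"
  using variation_le_Lipschitz[of g V "\<lambda>x. - g x" 1] by (simp add: norm_minus_commute)

lemma variation_le_indicator_interval:
  "variation_le (indicat_real {a..b}) 2" "variation_le (indicat_real {a<..<b}) 2"
proof -
  consider "a \<le> b" | "b < a" by linarith
  then show "variation_le (indicat_real {a..b}) 2"
  proof cases
    case 1
    have "indicat_real {a..b} = (\<lambda>x. indicat_real {a..} x + - indicat_real {b<..} x)"
      using 1 by (auto simp: indicator_def fun_eq_iff)
    then show ?thesis
      using variation_le_add[OF variation_le_indicator_atLeast variation_le_minus[OF variation_le_indicator_greaterThan]]
      by (metis one_add_one)
  next
    case 2
    then have "indicat_real {a..b} = (\<lambda>x. 0)" by (auto simp: indicator_def)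
    then show ?thesis by (simp add: variation_le_def)
  qed
  consider "a < b" | "b \<le> a" by linarith
  then show "variation_le (indicat_real {a<..<b}) 2"
  proof cases
    case 1
    have "indicat_real {a<..<b} = (\<lambda>x. indicat_real {a<..} x + - indicat_real {b..} x)"
      using 1 by (auto simp: indicator_def fun_eq_iff)
    then show ?thesis
      using variation_le_add[OF variation_le_indicator_greaterThan variation_le_minus[OF variation_le_indicator_atLeast]]
      by (metis one_add_one)
  next
    case 2
    then have "indicat_real {a<..<b} = (\<lambda>x. 0)" by (auto simp: indicator_def)
    then show ?thesis by (simp add: variation_le_def)
  qed
qed

lemma variation_le_limit:
  assumes "\<And>n. variation_le (g n) V" "\<And>x. (\<lambda>n. g n x) \<longlonglongrightarrow> h x"
  shows "variation_le h V"
  unfolding variation_le_def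
proof (intro allI impI)
  fix x :: "nat \<Rightarrow> real" and N assume x: "mono x"
  have "(\<lambda>n. \<Sum>l<N. norm (g n (x (Suc l)) - g n (x l))) \<longlonglongrightarrow> (\<Sum>l<N. norm (h (x (Suc l)) - h (x l)))"
    by (intro tendsto_intros assms)
  then show "(\<Sum>l<N. norm (h (x (Suc l)) - h (x l))) \<le> V"
    by (rule LIMSEQ_le_const2) (use variation_leD[OF assms(1) x] in blast)
qed

lemma variation_le_integral:
  fixes g :: "real \<Rightarrow> real \<Rightarrow> real"
  assumes "0 \<le> \<tau>" "\<And>t. t \<in> {0..\<tau>} \<Longrightarrow> variation_le (g t) V"
    and int: "\<And>x. set_integrable lborel {0..\<tau>} (\<lambda>t. g t x)"
  shows "variation_le (\<lambda>x. LINT t:{0..\<tau>}|lborel. g t x) (\<tau> * V)"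
  unfolding variation_le_def
proof (intro allI impI)
  fix x :: "nat \<Rightarrow> real" and N assume x: "mono x"
  have i1: "set_integrable lborel {0..\<tau>} (\<lambda>t. norm (g t a - g t b))" for a b
    using set_integral_diff(1)[OF int[of a] int[of b]] by (rule set_integrable_norm)
  have "norm ((LINT t:{0..\<tau>}|lborel. g t a) - (LINT t:{0..\<tau>}|lborel. g t b))
      \<le> (LINT t:{0..\<tau>}|lborel. norm (g t a - g t b))" for a b
    unfolding set_integral_diff(2)[OF int int, symmetric]
    using set_integral_norm_bound[OF set_integral_diff(1)[OF int[of a] int[of b]]] by simp
  then have "(\<Sum>l<N. norm ((LINT t:{0..\<tau>}|lborel. g t (x (Suc l))) - (LINT t:{0..\<tau>}|lborel. g t (x l))))
     \<le> (\<Sum>l<N. LINT t:{0..\<tau>}|lborel. norm (g t (x (Suc l)) - g t (x l)))"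
    by (intro sum_mono)
  also have "\<dots> = (LINT t:{0..\<tau>}|lborel. (\<Sum>l<N. norm (g t (x (Suc l)) - g t (x l))))"
    using i1 unfolding set_lebesgue_integral_def set_integrable_def scaleR_sum_right
    by (intro Bochner_Integration.integral_sum[symmetric]) auto
  also have "\<dots> \<le> (LINT t:{0..\<tau>}|lborel. V)"
  proof (rule set_integral_mono)
    show "set_integrable lborel {0..\<tau>} (\<lambda>t. \<Sum>l<N. norm (g t (x (Suc l)) - g t (x l)))"
      using i1 unfolding set_integrable_def scaleR_sum_right
      by (intro Bochner_Integration.integrable_sum) auto
    show "set_integrable lborel {0..\<tau>} (\<lambda>t. V)"
      using integrable_real_indicator[of "{0..\<tau>}" lborel] assms(1) by (simp add: set_integrable_def)
  qed (use variation_leD[OF assms(2) x] in auto)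
  also have "\<dots> = \<tau> * V" using assms(1) by (simp add: set_lebesgue_integral_def)
  finally show "(\<Sum>l<N. norm ((LINT t:{0..\<tau>}|lborel. g t (x (Suc l))) - (LINT t:{0..\<tau>}|lborel. g t (x l)))) \<le> \<tau> * V" .
qed

lemma nn_integral_translate:
  fixes f :: "real \<Rightarrow> ennreal"
  assumes [measurable]: "f \<in> borel_measurable borel"
  shows "(\<integral>\<^sup>+x. f (c + x) \<partial>lborel) = (\<integral>\<^sup>+x. f x \<partial>lborel)"
proof -
  have "(\<integral>\<^sup>+x. f x \<partial>lborel) = (\<integral>\<^sup>+x. f x \<partial>(distr lborel borel ((+) c)))"
    by (simp add: lborel_distr_plus)
  also have "\<dots> = (\<integral>\<^sup>+x. f (c + x) \<partial>lborel)"
    by (subst nn_integral_distr) auto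
  finally show ?thesis ..
qed

text \<open>
  Cut the line into cells of length \<open>h = |a - b|\<close> and move them all onto
  \<open>[0,h)\<close>. For each \<open>x\<close> in this cell, the increments at \<open>x + l
  h\<close> form one of the sums that define the variation.
\<close>

lemma nn_integral_translation_le_variation:
  fixes g :: "real \<Rightarrow> 'a::{real_normed_vector,second_countable_topology}"
  assumes V: "variation_le g V" and [measurable]: "g \<in> borel_measurable borel"
  shows "(\<integral>\<^sup>+x. ennreal (norm (g (x + a) - g (x + b))) \<partial>lborel) \<le> ennreal (\<bar>a - b\<bar> * V)"
proof -
  have pos: "(\<integral>\<^sup>+x. ennreal (norm (g (x + h) - g x)) \<partial>lborel) \<le> ennreal (h * V)" if h: "h > 0" for h
  proof -
    let ?f = "\<lambda>x. ennreal (norm (g (x + h) - g x))"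
    let ?S = "\<lambda>N::nat. {- (real N * h)..<real N * h}"
    have fin: "(\<integral>\<^sup>+x. ?f x * indicator (?S N) x \<partial>lborel) \<le> ennreal (h * V)" for N
    proof -
      let ?c = "\<lambda>l. (real l - real N) * h"
      have "indicator (?S N) x = (\<Sum>l<2*N. indicator {?c l..<?c (Suc l)} x :: ennreal)" for x
      proof -
        have "(\<Sum>l<n. indicator {?c l..<?c (Suc l)} x) = (indicator {?c 0..<?c n} x :: ennreal)" for n
        proof (induction n)
          case (Suc n)
          have "?c 0 \<le> ?c n" "?c n \<le> ?c (Suc n)" using h by (intro mult_right_mono; simp)+
          then show ?case unfolding sum.lessThan_Suc Suc.IH by (simp add: indicator_def)
        qed auto
        from this[of "2*N"] show ?thesis by simp
      qed
      then have "(\<integral>\<^sup>+x. ?f x * indicator (?S N) x \<partial>lborel)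
          = (\<integral>\<^sup>+x. (\<Sum>l<2*N. ?f x * indicator {?c l..<?c (Suc l)} x) \<partial>lborel)"
        by (simp add: sum_distrib_left)
      also have "\<dots> = (\<Sum>l<2*N. \<integral>\<^sup>+x. ?f x * indicator {?c l..<?c (Suc l)} x \<partial>lborel)"
        by (rule nn_integral_sum) auto
      also have "\<dots> = (\<Sum>l<2*N. \<integral>\<^sup>+x. ?f (?c l + x) * indicator {0..<h} x \<partial>lborel)"
      proof (rule sum.cong[OF refl])
        fix l
        have "(\<integral>\<^sup>+x. ?f x * indicator {?c l..<?c (Suc l)} x \<partial>lborel)
            = (\<integral>\<^sup>+x. ?f (?c l + x) * indicator {?c l..<?c (Suc l)} (?c l + x) \<partial>lborel)"
          by (subst nn_integral_translate[symmetric, of _ "?c l"]) (auto)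
        also have "\<dots> = (\<integral>\<^sup>+x. ?f (?c l + x) * indicator {0..<h} x \<partial>lborel)"
          by (intro nn_integral_cong) (auto simp: indicator_def algebra_simps)
        finally show "(\<integral>\<^sup>+x. ?f x * indicator {?c l..<?c (Suc l)} x \<partial>lborel)
           = (\<integral>\<^sup>+x. ?f (?c l + x) * indicator {0..<h} x \<partial>lborel)" .
      qed
      also have "\<dots> = (\<integral>\<^sup>+x. (\<Sum>l<2*N. ?f (?c l + x)) * indicator {0..<h} x \<partial>lborel)"
        unfolding sum_distrib_right by (rule nn_integral_sum[symmetric]) auto
      also have "\<dots> \<le> (\<integral>\<^sup>+x. ennreal V * indicator {0..<h} x \<partial>lborel)"
      proof (intro nn_integral_mono mult_right_mono)
        fix x
        have "mono (\<lambda>l. ?c l + x)" using h by (auto simp: mono_def intro!: mult_right_mono)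
        from variation_leD[OF V this, of "2*N"]
        have "(\<Sum>l<2*N. norm (g (?c l + x + h) - g (?c l + x))) \<le> V"
          by (simp add: algebra_simps)
        then show "(\<Sum>l<2*N. ?f (?c l + x)) \<le> ennreal V" by (simp add: ennreal_leI)
      qed auto
      also have "\<dots> = ennreal (h * V)"
        using h variation_le_nonneg[OF V]
        by (simp add: nn_integral_cmult ennreal_mult' mult.commute)
      finally show ?thesis .
    qed
    have inc: "x \<in> ?S n" if "x \<in> ?S m" "m \<le> n" for x m n
    proof -
      have "real m * h \<le> real n * h" using that(2) h by (intro mult_right_mono) auto
      then show ?thesis using that(1) by auto
    qed
    have "(\<Union>N. ?S N) = UNIV"
    proof (intro set_eqI iffI UNIV_I)
      fix x :: real
      obtain N where "\<bar>x\<bar> / h < real N" using reals_Archimedean2 by blast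
      then have "\<bar>x\<bar> < real N * h" using h by (simp add: field_simps)
      then show "x \<in> (\<Union>N. ?S N)" by (intro UN_I[of N]) auto
    qed
    then have "?f x = (SUP N. ?f x * indicator (?S N) x)" for x
    proof -
      from \<open>(\<Union>N. ?S N) = UNIV\<close> obtain N where "x \<in> ?S N" by blast
      then have "?f x \<le> (SUP N. ?f x * indicator (?S N) x)" by (intro SUP_upper2[of N]) auto
      moreover have "(SUP N. ?f x * indicator (?S N) x) \<le> ?f x"
        by (intro SUP_least) (auto simp: indicator_def)
      ultimately show ?thesis by (rule antisym)
    qed
    then have "(\<integral>\<^sup>+x. ?f x \<partial>lborel) = (\<integral>\<^sup>+x. (SUP N. ?f x * indicator (?S N) x) \<partial>lborel)"
      by simp
    also have "\<dots> = (SUP N. \<integral>\<^sup>+x. ?f x * indicator (?S N) x \<partial>lborel)"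
    proof (intro nn_integral_monotone_convergence_SUP)
      show "incseq (\<lambda>N x. ?f x * indicator (?S N) x)"
        unfolding incseq_def le_fun_def
      proof (intro allI impI mult_left_mono)
        fix m n :: nat and x assume "m \<le> n"
        then show "(indicator (?S m) x :: ennreal) \<le> indicator (?S n) x"
          using inc[of x m n] unfolding indicator_def by (cases "x \<in> ?S m") auto
      qed auto
    qed auto
    also have "\<dots> \<le> ennreal (h * V)" by (intro SUP_least fin)
    finally show ?thesis .
  qed
  have gen: "(\<integral>\<^sup>+x. ennreal (norm (g (x + a) - g (x + b))) \<partial>lborel) \<le> ennreal ((a - b) * V)" if "b < a" for a b
  proof -
    have "(\<integral>\<^sup>+x. ennreal (norm (g (x + a) - g (x + b))) \<partial>lborel)
        = (\<integral>\<^sup>+x. ennreal (norm (g ((b + x) + (a - b)) - g (b + x))) \<partial>lborel)"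
      by (simp add: algebra_simps)
    also have "\<dots> = (\<integral>\<^sup>+x. ennreal (norm (g (x + (a - b)) - g x)) \<partial>lborel)"
      by (rule nn_integral_translate[where f = "\<lambda>x. ennreal (norm (g (x + (a - b)) - g x))"]) simp
    also have "\<dots> \<le> ennreal ((a - b) * V)" using pos[of "a - b"] that by simp
    finally show ?thesis .
  qed
  consider "a = b" | "b < a" | "a < b" by linarith
  then show ?thesis
    using gen[of b a] gen[of a b] by cases (auto simp: norm_minus_commute)
qed


section \<open>Oscillating coefficients and changes of variables\<close>

lemma set_integrable_bounded_interval:
  fixes f :: "real \<Rightarrow> 'a::{banach,second_countable_topology}"
  assumes "f \<in> borel_measurable borel" "\<And>x. x \<in> {a..b} \<Longrightarrow> norm (f x) \<le> B"
  shows "set_integrable lborel {a..b} f"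
  unfolding set_integrable_def
  by (rule integrableI_bounded_set_indicator[where B = B]) (use assms in \<open>auto simp: emeasure_lborel_Icc_eq\<close>)

lemma set_integral_combine_Icc:
  fixes f :: "real \<Rightarrow> real"
  assumes "a \<le> b" "b \<le> c" "set_integrable lborel {a..c} f"
  shows "(LINT x:{a..c}|lborel. f x) = (LINT x:{a..b}|lborel. f x) + (LINT x:{b..c}|lborel. f x)"
proof -
  have "{a..c} = {a..b} \<union> {b..c}" using assms by auto
  moreover have "(LINT x:{a..b} \<union> {b..c}|lborel. f x) = (LINT x:{a..b}|lborel. f x) + (LINT x:{b..c}|lborel. f x)"
  proof (rule set_integral_Un_AE)
    show "AE x in lborel. \<not> (x \<in> {a..b} \<and> x \<in> {b..c})"
      using AE_lborel_singleton[of b] by eventually_elim auto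
  qed (use assms(1,2) in \<open>auto intro!: set_integrable_subset[OF assms(3)]\<close>)
  ultimately show ?thesis by simp
qed

text \<open>
  On a partition of \<open>[0,\<tau>]\<close> with \<open>N\<close> cells of length
  \<open>\<delta>\<close>, freeze \<open>q\<close> at the left end of each cell. The error is at
  most \<open>C \<delta>\<close> times the length of the cell in \<open>L\<^sup>1\<close>, which
  sums up to something that vanishes as \<open>N\<close> grows. For the frozen integrand only the
  primitive of \<open>b\<close> appears, and Abel summation moves the differences from the
  primitive to \<open>q\<close>, where the \<open>L\<^sup>1\<close> Lipschitz bound sums to
  \<open>C \<tau>\<close> whatever \<open>N\<close> is.
\<close>

lemma oscillation_L1_bound:
  fixes q :: "real \<Rightarrow> real \<Rightarrow> real" and b :: "real \<Rightarrow> real"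
  assumes q[measurable]: "(\<lambda>(t, z). q t z) \<in> borel_measurable borel"
    and b[measurable]: "b \<in> borel_measurable borel"
    and b_le: "\<And>t. \<bar>b t\<bar> \<le> 1" and q_le: "\<And>t z. \<bar>q t z\<bar> \<le> Q"
    and \<tau>: "0 \<le> \<tau>" and \<epsilon>: "0 \<le> \<epsilon>" and C: "0 \<le> C" "0 \<le> C'"
    and prim: "\<And>t. t \<in> {0..\<tau>} \<Longrightarrow> \<bar>LINT s:{0..t}|lborel. b s\<bar> \<le> \<epsilon>"
    and lip: "\<And>t t'. t \<in> {0..\<tau>} \<Longrightarrow> t' \<in> {0..\<tau>} \<Longrightarrow>
        (\<integral>\<^sup>+z. ennreal \<bar>q t z - q t' z\<bar> \<partial>lborel) \<le> ennreal (C * \<bar>t - t'\<bar>)"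
    and L1: "\<And>t. t \<in> {0..\<tau>} \<Longrightarrow> (\<integral>\<^sup>+z. ennreal \<bar>q t z\<bar> \<partial>lborel) \<le> ennreal C'"
  shows "(\<integral>\<^sup>+z. ennreal \<bar>LINT t:{0..\<tau>}|lborel. b t * q t z\<bar> \<partial>lborel) \<le> ennreal (\<epsilon> * (C' + C * \<tau>))"
proof (rule ennreal_le_epsilon)
  fix e :: real assume e: "0 < e"
  \<comment> \<open>the freezing error \<open>N C \<delta>\<^sup>2 = C \<tau>\<^sup>2 /
    N\<close> is below \<open>e\<close>\<close>
  obtain N0 :: nat where N0: "C * \<tau> * \<tau> / e < real N0" using reals_Archimedean2 by blast
  define N where "N = Suc N0"
  have N: "0 < real N" "C * \<tau> * \<tau> / e < real N" using N0 by (auto simp: N_def)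
  define \<delta> where "\<delta> = \<tau> / real N"
  have \<delta>: "0 \<le> \<delta>" "real N * \<delta> = \<tau>" "real N * (C * \<delta> * \<delta>) \<le> e"
  proof -
    show "0 \<le> \<delta>" "real N * \<delta> = \<tau>" using \<tau> N by (auto simp: \<delta>_def)
    have "real N * (C * \<delta> * \<delta>) = C * \<tau> * \<tau> / real N" using N by (simp add: \<delta>_def field_simps)
    also have "\<dots> \<le> e" using N e by (simp add: field_simps)
    finally show "real N * (C * \<delta> * \<delta>) \<le> e" .
  qed
  let ?t = "\<lambda>k::nat. real k * \<delta>"
  have t_in: "?t k \<in> {0..\<tau>}" if "k \<le> N" for k
    using that \<delta>(1) mult_right_mono[of "real k" "real N" \<delta>] unfolding \<delta>(2) by auto
  have t_mono: "?t l \<le> ?t (Suc l)" for l using \<delta>(1) by (intro mult_right_mono) auto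
  let ?B = "\<lambda>t. LINT s:{0..t}|lborel. b s"
  have [measurable]: "(\<lambda>t. q t z) \<in> borel_measurable borel" for z
  proof -
    have "(\<lambda>t. (\<lambda>(t, z). q t z) (t, z)) \<in> borel_measurable borel"
      by (rule measurable_compose[OF _ q[unfolded borel_prod[symmetric]]]) simp
    then show ?thesis by simp
  qed
  have [measurable]: "(\<lambda>z. q t z) \<in> borel_measurable borel" for t
  proof -
    have "(\<lambda>z. (\<lambda>(t, z). q t z) (t, z)) \<in> borel_measurable borel"
      by (rule measurable_compose[OF _ q[unfolded borel_prod[symmetric]]]) simp
    then show ?thesis by simp
  qed
  have bq_int: "set_integrable lborel {x..y} (\<lambda>t. b t * q t z)" for x y z
  proof (rule set_integrable_bounded_interval)
    fix t
    have "\<bar>b t\<bar> * \<bar>q t z\<bar> \<le> 1 * Q" using b_le q_le by (intro mult_mono) auto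
    then show "norm (b t * q t z) \<le> Q" by (simp add: abs_mult)
  qed simp
  have b_int: "set_integrable lborel {x..y} b" for x y
    by (rule set_integrable_bounded_interval[where B = 1]) (use b_le in auto)
  let ?E = "\<lambda>l z. LINT t:{?t l..?t (Suc l)}|lborel. b t * (q t z - q (?t l) z)"
  \<comment> \<open>Abel summation: \<open>E l\<close> is the freezing error on cell
    \<open>l\<close>\<close>
  have ident: "(LINT t:{0..?t k}|lborel. b t * q t z) =
      (\<Sum>l<k. ?E l z) + q (?t k) z * ?B (?t k) - (\<Sum>l<k. ?B (?t (Suc l)) * (q (?t (Suc l)) z - q (?t l) z))"
    for k z
  proof (induction k)
    case 0
    have *: "indicat_real {0..0::real} x = indicat_real {0} x" for x by simp
    have "(LINT t:{0..0}|lborel. f t) = 0" for f :: "real \<Rightarrow> real"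
      unfolding set_lebesgue_integral_def
      by (rule integral_eq_zero_AE) (use AE_lborel_singleton[of 0] in \<open>eventually_elim, auto\<close>)
    then show ?case by simp
  next
    case (Suc k)
    have k0: "0 \<le> ?t k" using \<delta>(1) by simp
    have 1: "(LINT t:{0..?t (Suc k)}|lborel. b t * q t z)
        = (LINT t:{0..?t k}|lborel. b t * q t z) + (LINT t:{?t k..?t (Suc k)}|lborel. b t * q t z)"
      by (rule set_integral_combine_Icc[OF k0 t_mono bq_int])
    have 2: "?B (?t (Suc k)) = ?B (?t k) + (LINT t:{?t k..?t (Suc k)}|lborel. b t)"
      by (rule set_integral_combine_Icc[OF k0 t_mono b_int])
    have "?E k z = (LINT t:{?t k..?t (Suc k)}|lborel. b t * q t z - q (?t k) z * b t)"
      by (simp add: algebra_simps)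
    also have "\<dots> = (LINT t:{?t k..?t (Suc k)}|lborel. b t * q t z) - (LINT t:{?t k..?t (Suc k)}|lborel. q (?t k) z * b t)"
      by (rule set_integral_diff(2)[OF bq_int]) (use b_int in auto)
    also have "(LINT t:{?t k..?t (Suc k)}|lborel. q (?t k) z * b t) = q (?t k) z * (LINT t:{?t k..?t (Suc k)}|lborel. b t)"
      by simp
    finally have 3: "(LINT t:{?t k..?t (Suc k)}|lborel. b t * q t z)
        = ?E k z + q (?t k) z * (LINT t:{?t k..?t (Suc k)}|lborel. b t)" by simp
    show ?case unfolding 1 Suc.IH 3 sum.lessThan_Suc 2 by (simp add: algebra_simps)
  qed
  have E_le: "(\<integral>\<^sup>+z. ennreal \<bar>?E l z\<bar> \<partial>lborel) \<le> ennreal (C * \<delta> * \<delta>)" if l: "l < N" for l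
  proof -
    let ?I = "{?t l..?t (Suc l)}"
    have sub: "?I \<subseteq> {0..\<tau>}" using t_in[of l] t_in[of "Suc l"] l by auto
    have "ennreal \<bar>?E l z\<bar> \<le> (\<integral>\<^sup>+t. ennreal \<bar>q t z - q (?t l) z\<bar> * indicator ?I t \<partial>lborel)" for z
    proof -
      have "ennreal \<bar>?E l z\<bar> \<le> (\<integral>\<^sup>+t. ennreal (norm (indicat_real ?I t *\<^sub>R (b t * (q t z - q (?t l) z)))) \<partial>lborel)"
      proof -
        have "set_integrable lborel ?I (\<lambda>t. b t * (q t z - q (?t l) z))"
        proof (rule set_integrable_bounded_interval)
          fix t
          have "\<bar>q t z - q (?t l) z\<bar> \<le> 2 * Q" using q_le[of t z] q_le[of "?t l" z] by linarith
          then have "\<bar>b t\<bar> * \<bar>q t z - q (?t l) z\<bar> \<le> 1 * (2 * Q)" using b_le by (intro mult_mono) auto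
          then show "norm (b t * (q t z - q (?t l) z)) \<le> 2 * Q" by (simp add: abs_mult)
        qed simp
        from integral_norm_bound_ennreal[OF this[unfolded set_integrable_def]]
        show ?thesis by (simp add: set_lebesgue_integral_def)
      qed
      also have "\<dots> \<le> (\<integral>\<^sup>+t. ennreal \<bar>q t z - q (?t l) z\<bar> * indicator ?I t \<partial>lborel)"
      proof (rule nn_integral_mono)
        fix t
        have "\<bar>b t\<bar> * \<bar>q t z - q (?t l) z\<bar> \<le> 1 * \<bar>q t z - q (?t l) z\<bar>"
          using b_le by (intro mult_right_mono) auto
        then show "ennreal (norm (indicat_real ?I t *\<^sub>R (b t * (q t z - q (?t l) z)))) \<le> ennreal \<bar>q t z - q (?t l) z\<bar> * indicator ?I t"
          by (auto simp: abs_mult indicator_def intro!: ennreal_leI)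
      qed
      finally show ?thesis .
    qed
    then have "(\<integral>\<^sup>+z. ennreal \<bar>?E l z\<bar> \<partial>lborel)
        \<le> (\<integral>\<^sup>+z. (\<integral>\<^sup>+t. ennreal \<bar>q t z - q (?t l) z\<bar> * indicator ?I t \<partial>lborel) \<partial>lborel)"
      by (intro nn_integral_mono) 
    also have "\<dots> = (\<integral>\<^sup>+t. (\<integral>\<^sup>+z. ennreal \<bar>q t z - q (?t l) z\<bar> * indicator ?I t \<partial>lborel) \<partial>lborel)"
    proof (rule lborel_pair.Fubini')
      have [measurable]: "(\<lambda>p. q (fst p) (snd p)) \<in> borel_measurable (lborel \<Otimes>\<^sub>M lborel)"
        using q by (simp add: split_beta' borel_prod lborel_prod)
      show "(\<lambda>(t, z). ennreal \<bar>q t z - q (?t l) z\<bar> * indicator ?I t) \<in> borel_measurable (lborel \<Otimes>\<^sub>M lborel)"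
        by (simp add: split_beta')
    qed
    also have "\<dots> \<le> (\<integral>\<^sup>+t. ennreal (C * \<delta>) * indicator ?I t \<partial>lborel)"
    proof (rule nn_integral_mono)
      fix t
      show "(\<integral>\<^sup>+z. ennreal \<bar>q t z - q (?t l) z\<bar> * indicator ?I t \<partial>lborel) \<le> ennreal (C * \<delta>) * indicator ?I t"
      proof (cases "t \<in> ?I")
        case True
        then have "(\<integral>\<^sup>+z. ennreal \<bar>q t z - q (?t l) z\<bar> \<partial>lborel) \<le> ennreal (C * \<bar>t - ?t l\<bar>)"
          using lip[of t "?t l"] sub t_in[of l] l by auto
        also have "\<dots> \<le> ennreal (C * \<delta>)"
          using True C by (intro ennreal_leI mult_left_mono) (auto simp: algebra_simps)
        finally show ?thesis using True by simp
      qed simp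
    qed
    also have "\<dots> = ennreal (C * \<delta> * \<delta>)"
      using \<delta>(1) C by (simp add: nn_integral_cmult ennreal_mult' algebra_simps)
    finally show ?thesis .
  qed
  have B_le: "\<bar>?B (?t k)\<bar> \<le> \<epsilon>" if "k \<le> N" for k using prim t_in[OF that] by simp
  have point: "ennreal \<bar>LINT t:{0..\<tau>}|lborel. b t * q t z\<bar> \<le>
      (\<Sum>l<N. ennreal \<bar>?E l z\<bar>) + ennreal \<epsilon> * ennreal \<bar>q \<tau> z\<bar>
        + (\<Sum>l<N. ennreal \<epsilon> * ennreal \<bar>q (?t (Suc l)) z - q (?t l) z\<bar>)" for z
  proof -
    have "\<bar>LINT t:{0..\<tau>}|lborel. b t * q t z\<bar> \<le>
        \<bar>\<Sum>l<N. ?E l z\<bar> + \<bar>q \<tau> z * ?B \<tau>\<bar> + \<bar>\<Sum>l<N. ?B (?t (Suc l)) * (q (?t (Suc l)) z - q (?t l) z)\<bar>"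
      using ident[of N z] unfolding \<delta>(2) by linarith
    also have "\<dots> \<le> (\<Sum>l<N. \<bar>?E l z\<bar>) + \<epsilon> * \<bar>q \<tau> z\<bar> + (\<Sum>l<N. \<epsilon> * \<bar>q (?t (Suc l)) z - q (?t l) z\<bar>)"
    proof (intro add_mono sum_abs)
      show "\<bar>q \<tau> z * ?B \<tau>\<bar> \<le> \<epsilon> * \<bar>q \<tau> z\<bar>"
        using B_le[of N] mult_left_mono[of "\<bar>?B \<tau>\<bar>" \<epsilon> "\<bar>q \<tau> z\<bar>"] unfolding \<delta>(2)
        by (simp add: abs_mult mult.commute)
      show "\<bar>\<Sum>l<N. ?B (?t (Suc l)) * (q (?t (Suc l)) z - q (?t l) z)\<bar> \<le> (\<Sum>l<N. \<epsilon> * \<bar>q (?t (Suc l)) z - q (?t l) z\<bar>)"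
        by (rule order_trans[OF sum_abs]) (auto simp: abs_mult intro!: sum_mono mult_right_mono B_le[of "Suc _", simplified])
    qed
    finally show ?thesis
      using \<epsilon> by (simp add: ennreal_mult'[symmetric] ennreal_plus[symmetric] sum_nonneg del: ennreal_plus)
  qed
  have Em[measurable]: "(\<lambda>z. ?E l z) \<in> borel_measurable borel" for l
  proof -
    have [measurable]: "(\<lambda>p. q (fst p) (snd p)) \<in> borel_measurable (borel \<Otimes>\<^sub>M borel)"
      using q by (simp add: split_beta' borel_prod)
    have [measurable]: "(\<lambda>p. q (snd p) (fst p)) \<in> borel_measurable (borel \<Otimes>\<^sub>M borel)"
      using measurable_compose[OF measurable_Pair[OF measurable_snd measurable_fst] \<open>(\<lambda>p. q (fst p) (snd p)) \<in> borel_measurable (borel \<Otimes>\<^sub>M borel)\<close>]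
      by simp
    have "(\<lambda>p. q (?t l) (fst p)) \<in> borel_measurable (borel \<Otimes>\<^sub>M lborel)"
      by measurable
    then show ?thesis
      unfolding set_lebesgue_integral_def
      by (intro sigma_finite_measure.borel_measurable_lebesgue_integral[OF sigma_finite_lborel])
        (simp add: split_beta')
  qed
  have "(\<integral>\<^sup>+z. ennreal \<bar>LINT t:{0..\<tau>}|lborel. b t * q t z\<bar> \<partial>lborel) \<le>
     (\<integral>\<^sup>+z. (\<Sum>l<N. ennreal \<bar>?E l z\<bar>) + ennreal \<epsilon> * ennreal \<bar>q \<tau> z\<bar>
        + (\<Sum>l<N. ennreal \<epsilon> * ennreal \<bar>q (?t (Suc l)) z - q (?t l) z\<bar>) \<partial>lborel)"
    by (intro nn_integral_mono point)
  also have "\<dots> = (\<Sum>l<N. \<integral>\<^sup>+z. ennreal \<bar>?E l z\<bar> \<partial>lborel) + ennreal \<epsilon> * (\<integral>\<^sup>+z. ennreal \<bar>q \<tau> z\<bar> \<partial>lborel)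
        + (\<Sum>l<N. ennreal \<epsilon> * (\<integral>\<^sup>+z. ennreal \<bar>q (?t (Suc l)) z - q (?t l) z\<bar> \<partial>lborel))"
    by (simp add: nn_integral_add nn_integral_sum nn_integral_cmult del: sum_ennreal of_nat_Suc)
  also have "\<dots> \<le> (\<Sum>l<N. ennreal (C * \<delta> * \<delta>)) + ennreal \<epsilon> * ennreal C' + (\<Sum>l<N. ennreal \<epsilon> * ennreal (C * \<delta>))"
  proof (intro add_mono sum_mono mult_left_mono)
    show "(\<integral>\<^sup>+z. ennreal \<bar>q \<tau> z\<bar> \<partial>lborel) \<le> ennreal C'" using L1 \<tau> by simp
    fix l assume "l \<in> {..<N}"
    then show "(\<integral>\<^sup>+z. ennreal \<bar>?E l z\<bar> \<partial>lborel) \<le> ennreal (C * \<delta> * \<delta>)" using E_le by simp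
    have "(\<integral>\<^sup>+z. ennreal \<bar>q (?t (Suc l)) z - q (?t l) z\<bar> \<partial>lborel) \<le> ennreal (C * \<bar>?t (Suc l) - ?t l\<bar>)"
      using \<open>l \<in> {..<N}\<close> by (intro lip t_in) auto
    also have "\<bar>?t (Suc l) - ?t l\<bar> = \<delta>" using \<delta>(1) by (simp add: algebra_simps)
    finally show "(\<integral>\<^sup>+z. ennreal \<bar>q (?t (Suc l)) z - q (?t l) z\<bar> \<partial>lborel) \<le> ennreal (C * \<delta>)" .
  qed auto
  also have "\<dots> = ennreal (real N * (C * \<delta> * \<delta>) + \<epsilon> * C' + real N * (\<epsilon> * (C * \<delta>)))"
    using \<epsilon> C \<delta>(1) by (simp add: ennreal_of_nat_eq_real_of_nat ennreal_mult'[symmetric] ennreal_plus[symmetric] del: ennreal_plus)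
  also have "\<dots> \<le> ennreal (\<epsilon> * (C' + C * \<tau>) + e)"
  proof (rule ennreal_leI)
    have "real N * (\<epsilon> * (C * \<delta>)) = \<epsilon> * C * (real N * \<delta>)" by simp
    then have "real N * (\<epsilon> * (C * \<delta>)) = \<epsilon> * C * \<tau>" unfolding \<delta>(2) .
    moreover have "\<epsilon> * (C' + C * \<tau>) = \<epsilon> * C' + \<epsilon> * C * \<tau>" by (simp add: algebra_simps)
    ultimately show "real N * (C * \<delta> * \<delta>) + \<epsilon> * C' + real N * (\<epsilon> * (C * \<delta>)) \<le> \<epsilon> * (C' + C * \<tau>) + e"
      using \<delta>(3) by linarith
  qed
  also have "\<dots> = ennreal (\<epsilon> * (C' + C * \<tau>)) + ennreal e"
    using \<epsilon> C \<tau> e by (intro ennreal_plus) auto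
  finally show "(\<integral>\<^sup>+z. ennreal \<bar>LINT t:{0..\<tau>}|lborel. b t * q t z\<bar> \<partial>lborel) \<le> ennreal (\<epsilon> * (C' + C * \<tau>)) + ennreal e" .
qed

lemma nn_integral_change_of_variables_le_mono:
  fixes \<phi> \<phi>' :: "real \<Rightarrow> real" and f :: "real \<Rightarrow> ennreal"
  assumes der: "\<And>x. (\<phi> has_real_derivative \<phi>' x) (at x)" and cont: "continuous_on UNIV \<phi>'"
    and c: "0 < c" "\<And>x. c \<le> \<phi>' x" and [measurable]: "f \<in> borel_measurable borel"
  shows "(\<integral>\<^sup>+x. f (\<phi> x) \<partial>lborel) \<le> ennreal (1 / c) * (\<integral>\<^sup>+x. f x \<partial>lborel)"
proof -
  have [measurable]: "\<phi> \<in> borel_measurable borel" "\<phi>' \<in> borel_measurable borel"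
    using cont der by (auto intro!: borel_measurable_continuous_onI continuous_at_imp_continuous_on DERIV_isCont)
  have part: "(\<integral>\<^sup>+x. f (\<phi> x) * indicator {-real n..real n} x \<partial>lborel) \<le> ennreal (1 / c) * (\<integral>\<^sup>+x. f x \<partial>lborel)" for n
  proof (cases "n = 0")
    case True
    have "(\<integral>\<^sup>+x. f (\<phi> x) * indicator {0} x \<partial>lborel) = 0"
      by (subst nn_integral_0_iff_AE) (use AE_lborel_singleton[of 0] in \<open>auto elim: eventually_mono\<close>)
    then show ?thesis using True by simp
  next
    case False
    let ?a = "- real n" and ?b = "real n"
    have "(\<integral>\<^sup>+x. f (\<phi> x) * indicator {?a..?b} x \<partial>lborel)
        \<le> (\<integral>\<^sup>+x. ennreal (1 / c) * (f (\<phi> x) * ennreal (\<phi>' x) * indicator {?a..?b} x) \<partial>lborel)"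
    proof (rule nn_integral_mono)
      fix x
      have "1 \<le> 1 / c * \<phi>' x" using c by (simp add: field_simps)
      then have "1 \<le> ennreal (1 / c) * ennreal (\<phi>' x)"
        using c(1) by (simp add: ennreal_mult'[symmetric] ennreal_1[symmetric] ennreal_leI del: ennreal_1)
      then have "f (\<phi> x) * indicator {?a..?b} x * 1 \<le> f (\<phi> x) * indicator {?a..?b} x * (ennreal (1 / c) * ennreal (\<phi>' x))"
        by (intro mult_left_mono) auto
      then show "f (\<phi> x) * indicator {?a..?b} x \<le> ennreal (1 / c) * (f (\<phi> x) * ennreal (\<phi>' x) * indicator {?a..?b} x)"
        by (simp add: mult_ac)
    qed
    also have "\<dots> = ennreal (1 / c) * (\<integral>\<^sup>+x. f (\<phi> x) * ennreal (\<phi>' x) * indicator {?a..?b} x \<partial>lborel)"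
      by (rule nn_integral_cmult) simp
    also have "(\<integral>\<^sup>+x. f (\<phi> x) * ennreal (\<phi>' x) * indicator {?a..?b} x \<partial>lborel)
        = (\<integral>\<^sup>+x. f x * indicator {\<phi> ?a..\<phi> ?b} x \<partial>lborel)"
      by (rule nn_integral_substitution_aux[symmetric])
        (use False der cont order_trans[OF less_imp_le[OF c(1)] c(2)] in \<open>auto intro: continuous_on_subset\<close>)
    also have "\<dots> \<le> (\<integral>\<^sup>+x. f x \<partial>lborel)" by (intro nn_integral_mono) (auto simp: indicator_def)
    finally show ?thesis by (simp add: mult_left_mono)
  qed
  have "f (\<phi> x) = (SUP n. f (\<phi> x) * indicator {-real n..real n} x)" for x
  proof -
    obtain n :: nat where "\<bar>x\<bar> < real n" using reals_Archimedean2 by blast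
    then have "indicator {-real n..real n} x = (1 :: ennreal)" by (auto simp: indicator_def)
    then have "f (\<phi> x) \<le> (SUP n. f (\<phi> x) * indicator {-real n..real n} x)" by (intro SUP_upper2[of n]) auto
    moreover have "(SUP n. f (\<phi> x) * indicator {-real n..real n} x) \<le> f (\<phi> x)"
      by (intro SUP_least) (auto simp: indicator_def)
    ultimately show ?thesis by (rule antisym)
  qed
  then have "(\<integral>\<^sup>+x. f (\<phi> x) \<partial>lborel) = (\<integral>\<^sup>+x. (SUP n. f (\<phi> x) * indicator {-real n..real n} x) \<partial>lborel)"
    by simp
  also have "\<dots> = (SUP n. \<integral>\<^sup>+x. f (\<phi> x) * indicator {-real n..real n} x \<partial>lborel)"
    by (intro nn_integral_monotone_convergence_SUP)
      (auto simp: incseq_def le_fun_def indicator_def split: if_splits)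
  also have "\<dots> \<le> ennreal (1 / c) * (\<integral>\<^sup>+x. f x \<partial>lborel)" by (intro SUP_least part)
  finally show ?thesis .
qed

text \<open>
  Decreasing substitutions are reduced to increasing ones by a reflection: the characteristics of
  the components with negative speed are traversed from right to left.
\<close>

lemma nn_integral_change_of_variables_le:
  fixes \<phi> \<phi>' :: "real \<Rightarrow> real" and f :: "real \<Rightarrow> ennreal"
  assumes der: "\<And>x. (\<phi> has_real_derivative \<phi>' x) (at x)" and cont: "continuous_on UNIV \<phi>'"
    and c: "0 < c" "(\<forall>x. c \<le> \<phi>' x) \<or> (\<forall>x. \<phi>' x \<le> - c)" and f[measurable]: "f \<in> borel_measurable borel"
  shows "(\<integral>\<^sup>+x. f (\<phi> x) \<partial>lborel) \<le> ennreal (1 / c) * (\<integral>\<^sup>+x. f x \<partial>lborel)"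
  using c(2)
proof
  assume "\<forall>x. c \<le> \<phi>' x"
  then show ?thesis using nn_integral_change_of_variables_le_mono[OF der cont c(1) _ f] by simp
next
  assume "\<forall>x. \<phi>' x \<le> - c"
  then have neg: "c \<le> - \<phi>' x" for x by (simp add: le_minus_iff)
  have [measurable]: "\<phi> \<in> borel_measurable borel"
    using der by (auto intro!: borel_measurable_continuous_onI continuous_at_imp_continuous_on DERIV_isCont)
  have "(\<integral>\<^sup>+x. f (\<phi> x) \<partial>lborel) = (\<integral>\<^sup>+x. f (- (- \<phi> x)) \<partial>lborel)" by simp
  also have "\<dots> \<le> ennreal (1 / c) * (\<integral>\<^sup>+x. f (- x) \<partial>lborel)"
  proof (rule nn_integral_change_of_variables_le_mono[where f = "\<lambda>x. f (- x)" and \<phi> = "\<lambda>x. - \<phi> x" and \<phi>' = "\<lambda>x. - \<phi>' x"])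
    show "((\<lambda>x. - \<phi> x) has_real_derivative - \<phi>' x) (at x)" for x using der by (rule DERIV_minus)
    show "continuous_on UNIV (\<lambda>x. - \<phi>' x)" using cont by (rule continuous_on_minus)
  qed (use neg c in auto)
  also have "(\<integral>\<^sup>+x. f (- x) \<partial>lborel) = (\<integral>\<^sup>+x. f x \<partial>distr lborel borel uminus)"
    by (subst nn_integral_distr) auto
  also have "distr lborel borel uminus = (lborel :: real measure)"
    by (rule lborel_distr_uminus)
  finally show ?thesis .
qed


section \<open>Propagation of sources along characteristics\<close>

lemma mult_indicator_le: "0 \<le> S \<Longrightarrow> S * indicat_real A t \<le> S"
  by (simp add: indicator_def)

lemma borel_measurable_vec_nth [measurable (raw)]:
  fixes f :: "'a \<Rightarrow> (real, 'n::finite) vec"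
  assumes "f \<in> borel_measurable M" shows "(\<lambda>x. f x $ k) \<in> borel_measurable M"
  by (rule borel_measurable_continuous_on[OF _ assms]) (intro continuous_intros)

lemma borel_measurable_vec_lambda [measurable (raw)]:
  fixes f :: "'n::finite \<Rightarrow> 'a \<Rightarrow> real"
  assumes "\<And>k. f k \<in> borel_measurable M" shows "(\<lambda>x. \<chi> k. f k x) \<in> borel_measurable M"
proof (rule iffD2[OF borel_measurable_euclidean_space], rule ballI)
  fix i :: "(real, 'n) vec" assume "i \<in> Basis"
  then obtain k where "i = axis k 1" by (auto simp: Basis_vec_def)
  then show "(\<lambda>x. (\<chi> k. f k x) \<bullet> i) \<in> borel_measurable M"
    using assms by (simp add: inner_axis)
qed

text \<open>
  Functions of time and space are curried, so that their measurability as functions of a pair has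
  to be stated separately.
\<close>

definition jointly_borel :: "(real \<Rightarrow> real \<Rightarrow> 'a::topological_space) \<Rightarrow> bool" where
  "jointly_borel F \<longleftrightarrow> (\<lambda>p. F (fst p) (snd p)) \<in> borel_measurable (borel \<Otimes>\<^sub>M borel)"

lemma jointly_borel_compose:
  assumes "jointly_borel F" "f \<in> borel_measurable M" "g \<in> borel_measurable M"
  shows "(\<lambda>x. F (f x) (g x)) \<in> borel_measurable M"
proof -
  have "(\<lambda>x. (f x, g x)) \<in> M \<rightarrow>\<^sub>M borel \<Otimes>\<^sub>M borel" using assms by simp
  from measurable_compose[OF this assms(1)[unfolded jointly_borel_def]] show ?thesis by simp
qed

lemma jointly_borelI:
  "(\<lambda>p. F (fst p) (snd p)) \<in> borel_measurable (borel \<Otimes>\<^sub>M borel) \<Longrightarrow> jointly_borel F"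
  unfolding jointly_borel_def .

lemma jointly_borel_space:
  assumes "jointly_borel F" shows "F t \<in> borel_measurable borel"
  by (rule jointly_borel_compose[OF assms, of "\<lambda>_. t" borel "\<lambda>x. x"]) simp_all

lemma variation_le_sum_bound:
  assumes "finite I" "\<And>i. i \<in> I \<Longrightarrow> variation_le (g i) (V i)" "\<And>i. i \<in> I \<Longrightarrow> 0 \<le> c i"
    and le: "\<And>x y. norm (h x - h y) \<le> (\<Sum>i\<in>I. c i * norm (g i x - g i y))"
  shows "variation_le h (\<Sum>i\<in>I. c i * V i)"
  unfolding variation_le_def
proof (intro allI impI)
  fix x :: "nat \<Rightarrow> real" and N assume x: "mono x"
  have "(\<Sum>l<N. norm (h (x (Suc l)) - h (x l))) \<le> (\<Sum>l<N. \<Sum>i\<in>I. c i * norm (g i (x (Suc l)) - g i (x l)))"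
    by (intro sum_mono le)
  also have "\<dots> = (\<Sum>i\<in>I. c i * (\<Sum>l<N. norm (g i (x (Suc l)) - g i (x l))))"
    unfolding sum_distrib_left by (rule sum.swap)
  also have "\<dots> \<le> (\<Sum>i\<in>I. c i * V i)"
    by (intro sum_mono mult_left_mono variation_leD[OF assms(2) x] assms(3))
  finally show "(\<Sum>l<N. norm (h (x (Suc l)) - h (x l))) \<le> (\<Sum>i\<in>I. c i * V i)" .
qed

text \<open>
  The only facts about the characteristics that the \<open>L\<^sup>1\<close> theory uses.
  \<open>\<theta> i\<close> is the travel time from the inlet of component \<open>i\<close>,
  \<open>X i\<close> its inverse, both defined on the whole line, and \<open>\<Theta> i\<close>
  the time needed to cross the domain. The bound \<open>\<kappa>\<close> on the Jacobians is
  expressed by integrals; \<open>\<theta> i\<close> and \<open>X i\<close> may be decreasing.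
\<close>

locale transport =
  fixes L \<kappa> :: real and \<theta> X :: "'n::finite \<Rightarrow> real \<Rightarrow> real" and \<Theta> :: "'n \<Rightarrow> real"
    and G :: "((real, 'n) vec, 'n) vec"
  assumes L_nonneg: "0 \<le> L" and \<kappa>_ge_1: "1 \<le> \<kappa>"
    and \<theta>_borel [measurable]: "\<And>i. \<theta> i \<in> borel_measurable borel"
    and X_borel [measurable]: "\<And>i. X i \<in> borel_measurable borel"
    and \<theta>_monotone: "\<And>i. mono (\<theta> i) \<or> antimono (\<theta> i)"
    and X_monotone: "\<And>i. mono (X i) \<or> antimono (X i)"
    and \<theta>_transport: "\<And>i f. f \<in> borel_measurable borel \<Longrightarrow>
          (\<integral>\<^sup>+x. f (\<theta> i x) \<partial>lborel) \<le> ennreal \<kappa> * (\<integral>\<^sup>+x. f x \<partial>lborel)"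
    and X_transport: "\<And>i f. f \<in> borel_measurable borel \<Longrightarrow>
          (\<integral>\<^sup>+x. f (X i x) \<partial>lborel) \<le> ennreal \<kappa> * (\<integral>\<^sup>+x. f x \<partial>lborel)"
begin

lemma \<theta>_transport_shift:
  fixes f :: "real \<Rightarrow> ennreal"
  assumes [measurable]: "f \<in> borel_measurable borel"
  shows "(\<integral>\<^sup>+x. f (c + \<theta> i x) \<partial>lborel) \<le> ennreal \<kappa> * (\<integral>\<^sup>+x. f x \<partial>lborel)"
  using \<theta>_transport[of "\<lambda>x. f (c + x)" i] nn_integral_translate[of f c] by simp

lemma X_transport_shift:
  fixes f :: "real \<Rightarrow> ennreal"
  assumes [measurable]: "f \<in> borel_measurable borel"
  shows "(\<integral>\<^sup>+x. f (X i (c + x)) \<partial>lborel) \<le> ennreal \<kappa> * (\<integral>\<^sup>+x. f x \<partial>lborel)"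
  using X_transport[of f i] nn_integral_translate[of "\<lambda>x. f (X i x)" c] by simp

lemma X_\<theta>_transport:
  fixes f :: "real \<Rightarrow> ennreal"
  assumes [measurable]: "f \<in> borel_measurable borel"
  shows "(\<integral>\<^sup>+x. f (X k (c + \<theta> i x)) \<partial>lborel) \<le> ennreal (\<kappa>\<^sup>2) * (\<integral>\<^sup>+x. f x \<partial>lborel)"
proof -
  have "(\<integral>\<^sup>+x. f (X k (c + \<theta> i x)) \<partial>lborel) \<le> ennreal \<kappa> * (\<integral>\<^sup>+x. f (X k x) \<partial>lborel)"
    using \<theta>_transport_shift[of "\<lambda>z. f (X k z)" c i] by simp
  also have "\<dots> \<le> ennreal \<kappa> * (ennreal \<kappa> * (\<integral>\<^sup>+x. f x \<partial>lborel))"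
    by (intro mult_left_mono X_transport) auto
  also have "\<dots> = ennreal (\<kappa>\<^sup>2) * (\<integral>\<^sup>+x. f x \<partial>lborel)"
    using \<kappa>_ge_1 by (simp add: power2_eq_square ennreal_mult' mult.assoc)
  finally show ?thesis .
qed

lemma variation_le_X: "variation_le g V \<Longrightarrow> variation_le (\<lambda>z. g (X i z)) V"
  using X_monotone[of i] variation_le_compose_mono variation_le_compose_antimono by blast

lemma variation_le_shift: "variation_le g V \<Longrightarrow> variation_le (\<lambda>z. g (c + z)) V"
  by (rule variation_le_compose_mono[where \<phi> = "(+) c"]) (auto simp: mono_def)

lemma variation_le_\<theta>: "variation_le g V \<Longrightarrow> variation_le (\<lambda>z. g (c + \<theta> i z)) V"
  using \<theta>_monotone[of i] variation_le_compose_mono[of "\<lambda>z. g (c + z)" V "\<theta> i"]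
    variation_le_compose_antimono[of "\<lambda>z. g (c + z)" V "\<theta> i"] variation_le_shift by blast

text \<open>
  The integral of the source up to time \<open>\<tau>\<close> along the
  \<open>k\<close>-characteristic with label \<open>\<zeta>\<close>, which is at \<open>X k
  (\<zeta> + t)\<close> at time \<open>t\<close>. The characteristic is followed beyond the
  domain, where the sources of interest vanish.
\<close>

definition leg :: "(real \<Rightarrow> real \<Rightarrow> (real, 'n) vec) \<Rightarrow> 'n \<Rightarrow> real \<Rightarrow> real \<Rightarrow> real" where
  "leg F k \<tau> \<zeta> = (LINT t:{0..\<tau>}|lborel. F t (X k (\<zeta> + t)) $ k)"

text \<open>
  Component \<open>i\<close> at \<open>(\<tau>,x)\<close> lies on the leg with label
  \<open>\<theta> i x - \<tau>\<close>. If this leg started at the inlet at time \<open>\<tau> -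
  \<theta> i x\<close>, component \<open>k\<close> was then at its outlet, hence on the leg with
  label \<open>\<Theta> k - \<tau> + \<theta> i x\<close>; if it started on the initial line, that
  label exceeds \<open>\<Theta> k\<close> and the second integral only sees points outside the
  domain. One formula thus serves both cases.
\<close>

definition propagate :: "(real \<Rightarrow> real \<Rightarrow> (real, 'n) vec) \<Rightarrow> real \<Rightarrow> real \<Rightarrow> (real, 'n) vec" where
  "propagate F \<tau> x =
     (\<chi> i. leg F i \<tau> (- \<tau> + \<theta> i x) + (\<Sum>k\<in>UNIV. G $ i $ k * leg F k \<tau> (\<Theta> k - \<tau> + \<theta> i x)))"

text \<open>
  The sum of the weights of all legs that enter a vector \<open>propagate F \<tau> x\<close>;
  every bound on a single leg is inherited by \<open>propagate\<close> with this factor.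
\<close>

definition \<Gamma> :: real where
  "\<Gamma> = (\<Sum>i\<in>(UNIV::'n set). 1 + (\<Sum>k\<in>UNIV. \<bar>G $ i $ k\<bar>))"

lemma \<Gamma>_nonneg: "0 \<le> \<Gamma>" unfolding \<Gamma>_def by (intro sum_nonneg add_nonneg_nonneg) auto

lemma norm_mix_le:
  fixes a :: "'n \<Rightarrow> real" and b :: "'n \<Rightarrow> 'n \<Rightarrow> real"
  shows "norm (\<chi> i. a i + (\<Sum>k\<in>UNIV. G $ i $ k * b i k)) \<le> (\<Sum>i\<in>UNIV. \<bar>a i\<bar> + (\<Sum>k\<in>UNIV. \<bar>G $ i $ k\<bar> * \<bar>b i k\<bar>))"
proof (rule order_trans[OF norm_le_l1_cart], rule sum_mono)
  fix i :: 'n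
  have "\<bar>\<Sum>k\<in>UNIV. G $ i $ k * b i k\<bar> \<le> (\<Sum>k\<in>UNIV. \<bar>G $ i $ k\<bar> * \<bar>b i k\<bar>)"
    by (rule order_trans[OF sum_abs]) (simp add: abs_mult)
  then show "\<bar>(\<chi> i. a i + (\<Sum>k\<in>UNIV. G $ i $ k * b i k)) $ i\<bar> \<le> \<bar>a i\<bar> + (\<Sum>k\<in>UNIV. \<bar>G $ i $ k\<bar> * \<bar>b i k\<bar>)"
    by simp
qed

lemma norm_mix_bound:
  fixes a :: "'n \<Rightarrow> real" and b :: "'n \<Rightarrow> 'n \<Rightarrow> real"
  assumes "\<And>i. \<bar>a i\<bar> \<le> A" "\<And>i k. \<bar>b i k\<bar> \<le> A"
  shows "norm (\<chi> i. a i + (\<Sum>k\<in>UNIV. G $ i $ k * b i k)) \<le> \<Gamma> * A"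
proof -
  have "(\<Sum>i\<in>UNIV. \<bar>a i\<bar> + (\<Sum>k\<in>UNIV. \<bar>G $ i $ k\<bar> * \<bar>b i k\<bar>)) \<le> (\<Sum>i\<in>UNIV. A + (\<Sum>k\<in>UNIV. \<bar>G $ i $ k\<bar> * A))"
    by (intro sum_mono add_mono mult_left_mono assms) auto
  also have "\<dots> = \<Gamma> * A"
    by (simp add: \<Gamma>_def sum_distrib_right distrib_right)
  finally show ?thesis using norm_mix_le[of a b] by linarith
qed

lemma nn_integral_norm_mix_bound:
  fixes a :: "'n \<Rightarrow> real \<Rightarrow> real" and b :: "'n \<Rightarrow> 'n \<Rightarrow> real \<Rightarrow> real"
  assumes [measurable]: "\<And>i. a i \<in> borel_measurable borel" "\<And>i k. b i k \<in> borel_measurable borel" "S \<in> sets borel"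
    and "\<And>i. (\<integral>\<^sup>+x\<in>S. ennreal \<bar>a i x\<bar> \<partial>lborel) \<le> A" "\<And>i k. (\<integral>\<^sup>+x\<in>S. ennreal \<bar>b i k x\<bar> \<partial>lborel) \<le> A"
  shows "(\<integral>\<^sup>+x\<in>S. ennreal (norm (\<chi> i. a i x + (\<Sum>k\<in>UNIV. G $ i $ k * b i k x))) \<partial>lborel) \<le> ennreal \<Gamma> * A"
proof -
  have "(\<integral>\<^sup>+x\<in>S. ennreal (norm (\<chi> i. a i x + (\<Sum>k\<in>UNIV. G $ i $ k * b i k x))) \<partial>lborel)
     \<le> (\<integral>\<^sup>+x. (\<Sum>i\<in>UNIV. ennreal \<bar>a i x\<bar> * indicator S x + (\<Sum>k\<in>UNIV. ennreal \<bar>G $ i $ k\<bar> * (ennreal \<bar>b i k x\<bar> * indicator S x))) \<partial>lborel)"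
  proof (rule nn_integral_mono)
    fix x
    have "ennreal (norm (\<chi> i. a i x + (\<Sum>k\<in>UNIV. G $ i $ k * b i k x)))
       \<le> ennreal (\<Sum>i\<in>UNIV. \<bar>a i x\<bar> + (\<Sum>k\<in>UNIV. \<bar>G $ i $ k\<bar> * \<bar>b i k x\<bar>))"
      by (intro ennreal_leI norm_mix_le)
    also have "\<dots> = (\<Sum>i\<in>UNIV. ennreal \<bar>a i x\<bar> + (\<Sum>k\<in>UNIV. ennreal \<bar>G $ i $ k\<bar> * ennreal \<bar>b i k x\<bar>))"
      by (simp add: sum_nonneg ennreal_mult'[symmetric] ennreal_plus[symmetric] del: ennreal_plus)
    finally show "ennreal (norm (\<chi> i. a i x + (\<Sum>k\<in>UNIV. G $ i $ k * b i k x))) * indicator S x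
       \<le> (\<Sum>i\<in>UNIV. ennreal \<bar>a i x\<bar> * indicator S x + (\<Sum>k\<in>UNIV. ennreal \<bar>G $ i $ k\<bar> * (ennreal \<bar>b i k x\<bar> * indicator S x)))"
      by (cases "x \<in> S") (auto simp del: sum_ennreal)
  qed
  also have "\<dots> = (\<Sum>i\<in>UNIV. (\<integral>\<^sup>+x\<in>S. ennreal \<bar>a i x\<bar> \<partial>lborel) + (\<Sum>k\<in>UNIV. ennreal \<bar>G $ i $ k\<bar> * (\<integral>\<^sup>+x\<in>S. ennreal \<bar>b i k x\<bar> \<partial>lborel)))"
    by (simp add: nn_integral_sum nn_integral_add nn_integral_cmult del: sum_ennreal)
  also have "\<dots> \<le> (\<Sum>i\<in>UNIV. A + (\<Sum>k\<in>UNIV. ennreal \<bar>G $ i $ k\<bar> * A))"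
    by (intro sum_mono add_mono mult_left_mono assms) auto
  also have "\<dots> = ennreal \<Gamma> * A"
    by (simp add: \<Gamma>_def sum_nonneg sum_distrib_right[symmetric] distrib_right sum_ennreal[symmetric] sum.distrib
        ennreal_of_nat_eq_real_of_nat del: sum_ennreal)
  finally show ?thesis .
qed

lemma variation_le_mix:
  fixes a :: "'n \<Rightarrow> real \<Rightarrow> real" and b :: "'n \<Rightarrow> 'n \<Rightarrow> real \<Rightarrow> real"
  assumes a: "\<And>i. variation_le (a i) A" and b: "\<And>i k. variation_le (b i k) A"
  shows "variation_le (\<lambda>x. \<chi> i. a i x + (\<Sum>k\<in>UNIV. G $ i $ k * b i k x)) (\<Gamma> * A)"
proof -
  have "variation_le (\<lambda>x. a i x + (\<Sum>k\<in>UNIV. G $ i $ k * b i k x)) (A + (\<Sum>k\<in>UNIV. \<bar>G $ i $ k\<bar> * A))" for i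
    by (intro variation_le_add a variation_le_sum variation_le_Lipschitz[OF b])
      (auto simp: abs_mult right_diff_distrib[symmetric])
  then have "variation_le (\<lambda>x. \<chi> i. a i x + (\<Sum>k\<in>UNIV. G $ i $ k * b i k x)) (\<Sum>i\<in>(UNIV::'n set). 1 * (A + (\<Sum>k\<in>UNIV. \<bar>G $ i $ k\<bar> * A)))"
    by (rule variation_le_sum_bound[rotated]) (auto intro!: order_trans[OF norm_le_l1_cart])
  also have "(\<Sum>i\<in>(UNIV::'n set). 1 * (A + (\<Sum>k\<in>UNIV. \<bar>G $ i $ k\<bar> * A))) = \<Gamma> * A"
    by (simp add: \<Gamma>_def sum_distrib_right distrib_right)
  finally show ?thesis .
qed

lemma leg_integrand_measurable:
  fixes F :: "real \<Rightarrow> real \<Rightarrow> (real, 'n) vec"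
  assumes "jointly_borel F"
  shows "(\<lambda>t. F t (X k (\<zeta> + t)) $ k) \<in> borel_measurable borel"
  using jointly_borel_compose[OF assms, of "\<lambda>t. t" borel "\<lambda>t. X k (\<zeta> + t)"] by simp

lemma jointly_borel_leg:
  assumes F: "jointly_borel F" shows "jointly_borel (leg F k)"
proof (rule jointly_borelI)
  have [measurable]: "(\<lambda>q. F (snd q) (X k (snd (fst q) + snd q))) \<in> borel_measurable ((borel \<Otimes>\<^sub>M borel) \<Otimes>\<^sub>M lborel)"
    by (rule jointly_borel_compose[OF F]) auto
  have "(\<lambda>(p, t). if 0 \<le> t \<and> t \<le> fst p then F t (X k (snd p + t)) $ k else 0)
      \<in> borel_measurable ((borel \<Otimes>\<^sub>M borel) \<Otimes>\<^sub>M lborel)"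
    by (simp add: split_beta')
  from sigma_finite_measure.borel_measurable_lebesgue_integral[OF sigma_finite_lborel this]
  have "(\<lambda>p. LINT t|lborel. (if 0 \<le> t \<and> t \<le> fst p then F t (X k (snd p + t)) $ k else 0)) \<in> borel_measurable (borel \<Otimes>\<^sub>M borel)" .
  also have "(\<lambda>p. LINT t|lborel. (if 0 \<le> t \<and> t \<le> fst p then F t (X k (snd p + t)) $ k else 0)) = (\<lambda>p. leg F k (fst p) (snd p))"
    unfolding leg_def set_lebesgue_integral_def
    by (intro ext Bochner_Integration.integral_cong) (auto simp: indicator_def)
  finally show "(\<lambda>p. leg F k (fst p) (snd p)) \<in> borel_measurable (borel \<Otimes>\<^sub>M borel)" .
qed

lemma jointly_borel_propagate:
  assumes F: "jointly_borel F" shows "jointly_borel (propagate F)"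
  unfolding propagate_def
proof (rule jointly_borelI)
  have [measurable]: "(\<lambda>p. leg F k (fst p) (c - fst p + \<theta> i (snd p))) \<in> borel_measurable (borel \<Otimes>\<^sub>M borel)" for k c i
    by (rule jointly_borel_compose[OF jointly_borel_leg[OF F]]) auto
  have [measurable]: "(\<lambda>p. leg F k (fst p) (- fst p + \<theta> i (snd p))) \<in> borel_measurable (borel \<Otimes>\<^sub>M borel)" for k c i
    by (rule jointly_borel_compose[OF jointly_borel_leg[OF F]]) auto
  show "(\<lambda>p. \<chi> i. leg F i (fst p) (- fst p + \<theta> i (snd p)) + (\<Sum>k\<in>UNIV. G $ i $ k * leg F k (fst p) (\<Theta> k - fst p + \<theta> i (snd p))))
      \<in> borel_measurable (borel \<Otimes>\<^sub>M borel)"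
    by measurable
qed

lemma leg_integrable:
  fixes F :: "real \<Rightarrow> real \<Rightarrow> (real, 'n) vec"
  assumes F: "jointly_borel F" "\<And>t x. norm (F t x) \<le> S"
  shows "set_integrable lborel {a..b} (\<lambda>t. F t (X k (\<zeta> + t)) $ k)"
  by (rule set_integrable_bounded_interval[OF leg_integrand_measurable[OF F(1)], where B = S])
    (simp add: norm_bound_component_le_cart[OF F(2)])

lemma leg_diff:
  assumes "jointly_borel F" "\<And>t x. norm (F t x) \<le> S" "jointly_borel F'" "\<And>t x. norm (F' t x) \<le> S'"
  shows "leg F k \<tau> \<zeta> - leg F' k \<tau> \<zeta> = leg (\<lambda>t x. F t x - F' t x) k \<tau> \<zeta>"
  unfolding leg_def vector_minus_component
  by (rule set_integral_diff(2)[symmetric]) (rule leg_integrable assms)+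

lemma propagate_diff:
  assumes "jointly_borel F" "\<And>t x. norm (F t x) \<le> S" "jointly_borel F'" "\<And>t x. norm (F' t x) \<le> S'"
  shows "propagate F \<tau> x - propagate F' \<tau> x = propagate (\<lambda>t x. F t x - F' t x) \<tau> x"
  unfolding propagate_def leg_diff[OF assms, symmetric]
  by (simp add: vec_eq_iff algebra_simps sum_subtractf)

lemma leg_sum:
  assumes "finite J" "\<And>j. j \<in> J \<Longrightarrow> jointly_borel (F j)" "\<And>j t x. j \<in> J \<Longrightarrow> norm (F j t x) \<le> S j"
  shows "leg (\<lambda>t x. \<Sum>j\<in>J. F j t x) k \<tau> \<zeta> = (\<Sum>j\<in>J. leg (F j) k \<tau> \<zeta>)"
  unfolding leg_def set_lebesgue_integral_def sum_component scaleR_sum_right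
  by (rule Bochner_Integration.integral_sum)
    (use leg_integrable[OF assms(2,3)] in \<open>auto simp: set_integrable_def\<close>)

lemma leg_norm_le:
  assumes F: "jointly_borel F" "\<And>t x. norm (F t x) \<le> S"
  shows "ennreal \<bar>leg F k \<tau> \<zeta>\<bar> \<le> (\<integral>\<^sup>+t\<in>{0..\<tau>}. ennreal (norm (F t (X k (\<zeta> + t)))) \<partial>lborel)"
proof -
  have "ennreal \<bar>leg F k \<tau> \<zeta>\<bar> \<le> (\<integral>\<^sup>+t. ennreal (norm (indicat_real {0..\<tau>} t *\<^sub>R (F t (X k (\<zeta> + t)) $ k))) \<partial>lborel)"
    using integral_norm_bound_ennreal[OF leg_integrable[OF F, unfolded set_integrable_def]]
    by (simp add: leg_def set_lebesgue_integral_def)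
  also have "\<dots> \<le> (\<integral>\<^sup>+t\<in>{0..\<tau>}. ennreal (norm (F t (X k (\<zeta> + t)))) \<partial>lborel)"
    by (intro nn_integral_mono) (auto simp: indicator_def component_le_norm_cart intro!: ennreal_leI)
  finally show ?thesis .
qed

lemma leg_sup_le:
  assumes F: "jointly_borel F" "\<And>t x. norm (F t x) \<le> S * indicat_real {0..T} t" and T: "0 \<le> T"
  shows "\<bar>leg F k \<tau> \<zeta>\<bar> \<le> T * S"
proof -
  have S: "0 \<le> S" using F(2)[of 0 0] T by (auto intro: order_trans[OF norm_ge_zero])
  then have F': "norm (F t x) \<le> S" for t x by (rule order_trans[OF F(2) mult_indicator_le])
  have "ennreal \<bar>leg F k \<tau> \<zeta>\<bar> \<le> (\<integral>\<^sup>+t. ennreal S * indicator {0..T} t \<partial>lborel)"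
  proof (rule order_trans[OF leg_norm_le[OF F(1) F']], rule nn_integral_mono)
    fix t show "ennreal (norm (F t (X k (\<zeta> + t)))) * indicator {0..\<tau>} t \<le> ennreal S * indicator {0..T} t"
      using F(2)[of t "X k (\<zeta> + t)"] by (auto simp: indicator_def intro!: ennreal_leI split: if_splits)
  qed
  also have "\<dots> = ennreal (T * S)"
    using T S by (simp add: nn_integral_cmult ennreal_mult' mult.commute)
  finally show ?thesis using T S by (simp add: ennreal_le_iff)
qed

lemma propagate_sup_le:
  assumes F: "jointly_borel F" "\<And>t x. norm (F t x) \<le> S * indicat_real {0..T} t" and T: "0 \<le> T"
  shows "norm (propagate F \<tau> x) \<le> \<Gamma> * (T * S)"
  unfolding propagate_def by (intro norm_mix_bound leg_sup_le[OF assms])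

text \<open>
  After exchanging the integrals, the position at time \<open>t\<close> on the leg is, as a
  function of the end point \<open>x\<close>, a composition of two changes of variables, each with
  Jacobian bound \<open>\<kappa>\<close>.
\<close>

lemma leg_transport_L1:
  assumes F: "jointly_borel F" "\<And>t x. norm (F t x) \<le> S"
  shows "(\<integral>\<^sup>+x. ennreal \<bar>leg F k \<tau> (c + \<theta> i x)\<bar> \<partial>lborel)
     \<le> ennreal (\<kappa>\<^sup>2) * (\<integral>\<^sup>+t\<in>{0..\<tau>}. (\<integral>\<^sup>+x. ennreal (norm (F t x)) \<partial>lborel) \<partial>lborel)"
proof -
  have Fm[measurable]: "(\<lambda>q. F (snd q) (X k (c + \<theta> i (fst q) + snd q))) \<in> borel_measurable (lborel \<Otimes>\<^sub>M lborel)"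
    by (rule jointly_borel_compose[OF F(1)]) auto
  have [measurable]: "F t \<in> borel_measurable borel" for t by (rule jointly_borel_space[OF F(1)])
  have [measurable]: "(\<lambda>q. F (fst q) (snd q)) \<in> borel_measurable (lborel \<Otimes>\<^sub>M lborel)"
    by (rule jointly_borel_compose[OF F(1)]) auto
  have "(\<integral>\<^sup>+x. ennreal \<bar>leg F k \<tau> (c + \<theta> i x)\<bar> \<partial>lborel)
     \<le> (\<integral>\<^sup>+x. (\<integral>\<^sup>+t\<in>{0..\<tau>}. ennreal (norm (F t (X k (c + \<theta> i x + t)))) \<partial>lborel) \<partial>lborel)"
    by (intro nn_integral_mono leg_norm_le[OF F])
  also have "\<dots> = (\<integral>\<^sup>+t. (\<integral>\<^sup>+x. ennreal (norm (F t (X k (c + \<theta> i x + t)))) * indicator {0..\<tau>} t \<partial>lborel) \<partial>lborel)"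
    by (rule lborel_pair.Fubini'[symmetric]) (use measurable_compose[OF measurable_pair_swap' Fm] in \<open>simp add: split_beta'\<close>)
  also have "\<dots> \<le> (\<integral>\<^sup>+t. ennreal (\<kappa>\<^sup>2) * ((\<integral>\<^sup>+x. ennreal (norm (F t x)) \<partial>lborel) * indicator {0..\<tau>} t) \<partial>lborel)"
  proof (rule nn_integral_mono)
    fix t
    have "(\<integral>\<^sup>+x. ennreal (norm (F t (X k ((c + t) + \<theta> i x)))) \<partial>lborel) \<le> ennreal (\<kappa>\<^sup>2) * (\<integral>\<^sup>+x. ennreal (norm (F t x)) \<partial>lborel)"
      by (rule X_\<theta>_transport) auto
    then show "(\<integral>\<^sup>+x. ennreal (norm (F t (X k (c + \<theta> i x + t)))) * indicator {0..\<tau>} t \<partial>lborel)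
       \<le> ennreal (\<kappa>\<^sup>2) * ((\<integral>\<^sup>+x. ennreal (norm (F t x)) \<partial>lborel) * indicator {0..\<tau>} t)"
      by (auto simp: indicator_def algebra_simps)
  qed
  also have "\<dots> = ennreal (\<kappa>\<^sup>2) * (\<integral>\<^sup>+t\<in>{0..\<tau>}. (\<integral>\<^sup>+x. ennreal (norm (F t x)) \<partial>lborel) \<partial>lborel)"
    by (intro nn_integral_cmult) (auto simp: split_beta' intro!: borel_measurable_times_ennreal lborel.borel_measurable_nn_integral)
  finally show ?thesis .
qed

lemma propagate_L1:
  assumes F: "jointly_borel F" "\<And>t x. norm (F t x) \<le> S"
  shows "(\<integral>\<^sup>+x. ennreal (norm (propagate F \<tau> x)) \<partial>lborel)
     \<le> ennreal (\<Gamma> * \<kappa>\<^sup>2) * (\<integral>\<^sup>+t\<in>{0..\<tau>}. (\<integral>\<^sup>+x. ennreal (norm (F t x)) \<partial>lborel) \<partial>lborel)"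
proof -
  have [measurable]: "leg F k \<tau> \<in> borel_measurable borel" for k
    by (rule jointly_borel_space[OF jointly_borel_leg[OF F(1)]])
  have "(\<integral>\<^sup>+x\<in>UNIV. ennreal (norm (propagate F \<tau> x)) \<partial>lborel)
     \<le> ennreal \<Gamma> * (ennreal (\<kappa>\<^sup>2) * (\<integral>\<^sup>+t\<in>{0..\<tau>}. (\<integral>\<^sup>+x. ennreal (norm (F t x)) \<partial>lborel) \<partial>lborel))"
    unfolding propagate_def
    by (rule nn_integral_norm_mix_bound) (use leg_transport_L1[OF F] leg_transport_L1[OF F, of _ \<tau> "- \<tau>"] in simp_all)
  then show ?thesis using \<Gamma>_nonneg by (simp add: ennreal_mult' mult.assoc)
qed

lemma leg_variation:
  assumes F: "jointly_borel F" "\<And>t x. norm (F t x) \<le> S" and V: "\<And>t. variation_le (F t) V" and "0 \<le> \<tau>"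
  shows "variation_le (leg F k \<tau>) (\<tau> * V)"
  unfolding leg_def
proof (rule variation_le_integral)
  fix t
  have "variation_le (\<lambda>x. F t x $ k) (1 * V)"
    by (rule variation_le_Lipschitz[OF V[of t]]) (auto simp: vector_minus_component[symmetric] component_le_norm_cart simp del: vector_minus_component)
  then have "variation_le (\<lambda>\<zeta>. F t (X k (t + \<zeta>)) $ k) V"
    using variation_le_shift[OF variation_le_X[of "\<lambda>x. F t x $ k" V k], of t] by simp
  then show "variation_le (\<lambda>\<zeta>. F t (X k (\<zeta> + t)) $ k) V" by (simp add: add.commute)
qed (use assms leg_integrable[OF F] in auto)

text \<open>
  A leg is an average over \<open>t\<close> of the functions \<open>F t\<close> composed with
  monotone maps, which do not increase the variation.
\<close>

lemma propagate_variation: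
  assumes F: "jointly_borel F" "\<And>t x. norm (F t x) \<le> S * indicat_real {0..T} t" and V: "\<And>t. variation_le (F t) V"
    and T: "0 \<le> T"
  shows "variation_le (propagate F \<tau>) (\<Gamma> * (T * V))"
proof -
  have V0: "0 \<le> V" using variation_le_nonneg[OF V] .
  have S: "0 \<le> S" using F(2)[of 0 0] T by (auto intro: order_trans[OF norm_ge_zero])
  then have F': "norm (F t x) \<le> S" for t x by (rule order_trans[OF F(2) mult_indicator_le])
  have F0: "F t x = 0" if "t \<notin> {0..T}" for t x using F(2)[of t x] that by simp
  have cut: "leg F k \<tau> = leg F k (min \<tau> T)" for k
    unfolding leg_def set_lebesgue_integral_def
    by (intro ext Bochner_Integration.integral_cong) (auto simp: indicator_def F0)
  have "variation_le (leg F k \<tau>) (T * V)" for k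
  proof (cases "0 \<le> min \<tau> T")
    case True
    have "variation_le (leg F k (min \<tau> T)) (min \<tau> T * V)" by (rule leg_variation[OF F(1) F' V True])
    then show ?thesis unfolding cut[of k] by (rule variation_le_weaken) (simp add: V0 mult_right_mono)
  next
    case False
    then have "leg F k \<tau> = (\<lambda>_. 0)" using T by (auto simp: leg_def set_lebesgue_integral_def fun_eq_iff)
    then show ?thesis using T V0 by (simp add: variation_le_def)
  qed
  then have "variation_le (\<lambda>x. leg F k \<tau> (c + \<theta> i x)) (T * V)" for k c i by (rule variation_le_\<theta>)
  then show ?thesis unfolding propagate_def by (intro variation_le_mix)
qed

end


section \<open>The semilinear solution operator\<close>

text \<open>
  In the norm weighted by \<open>exp (- a t)\<close> with \<open>a > 2 C\<close>, the integral
  inequality makes the supremum at most one half of itself.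
\<close>

lemma gronwall_zero:
  fixes w :: "real \<Rightarrow> ennreal"
  assumes [measurable]: "w \<in> borel_measurable borel" and bd: "\<And>t. t \<in> {0..T} \<Longrightarrow> w t \<le> ennreal B"
    and C: "0 \<le> C"
    and le: "\<And>\<tau>. \<tau> \<in> {0..T} \<Longrightarrow> w \<tau> \<le> ennreal C * (\<integral>\<^sup>+t\<in>{0..\<tau>}. w t \<partial>lborel)"
    and \<tau>: "\<tau> \<in> {0..T}"
  shows "w \<tau> = 0"
proof -
  define a where "a = 2 * C + 1"
  have a: "0 < a" "C / a \<le> 1 / 2" using C by (auto simp: a_def field_simps)
  define S where "S = (SUP t\<in>{0..T}. w t * ennreal (exp (- a * t)))"
  have up: "w t \<le> S * ennreal (exp (a * t))" if "t \<in> {0..T}" for t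
  proof -
    have "w t = (w t * ennreal (exp (- a * t))) * ennreal (exp (a * t))"
      by (simp add: mult.assoc ennreal_mult'[symmetric] exp_minus)
    also have "\<dots> \<le> S * ennreal (exp (a * t))"
      unfolding S_def by (intro mult_right_mono SUP_upper that) auto
    finally show ?thesis .
  qed
  have "S \<le> ennreal B"
    unfolding S_def
  proof (rule SUP_least)
    fix t assume t: "t \<in> {0..T}"
    have "ennreal (exp (- a * t)) \<le> 1" using t a by simp
    then have "w t * ennreal (exp (- a * t)) \<le> ennreal B * 1" using bd[OF t] by (intro mult_mono) auto
    then show "w t * ennreal (exp (- a * t)) \<le> ennreal B" by simp
  qed
  then have fin: "S < top" using ennreal_less_top le_less_trans by blast
  have "S \<le> ennreal (1/2) * S"
    unfolding S_def
  proof (rule SUP_least, fold S_def)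
    fix t assume t: "t \<in> {0..T}"
    have "(\<integral>\<^sup>+s\<in>{0..t}. w s \<partial>lborel) \<le> (\<integral>\<^sup>+s. S * (ennreal (exp (a * s)) * indicator {0..t} s) \<partial>lborel)"
      using up t by (intro nn_integral_mono) (auto simp: indicator_def)
    also have "\<dots> = S * (\<integral>\<^sup>+s. ennreal (exp (a * s)) * indicator {0..t} s \<partial>lborel)"
      by (rule nn_integral_cmult) auto
    also have "\<dots> \<le> S * ennreal (exp (a * t) / a)"
    proof (rule mult_left_mono)
      have "(\<integral>\<^sup>+s. ennreal (exp (a * s)) * indicator {0..t} s \<partial>lborel) = ennreal (exp (a * t) / a - exp (a * 0) / a)"
        using t a by (intro nn_integral_FTC_Icc) (auto intro!: derivative_eq_intros)
      also have "\<dots> \<le> ennreal (exp (a * t) / a)" using a by (intro ennreal_leI) auto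
      finally show "(\<integral>\<^sup>+s. ennreal (exp (a * s)) * indicator {0..t} s \<partial>lborel) \<le> ennreal (exp (a * t) / a)" .
    qed simp
    finally have "ennreal C * (\<integral>\<^sup>+s\<in>{0..t}. w s \<partial>lborel) \<le> ennreal C * (S * ennreal (exp (a * t) / a))"
      by (rule mult_left_mono) simp
    then have "w t \<le> ennreal C * (S * ennreal (exp (a * t) / a))"
      by (rule order_trans[OF le[OF t]])
    then have "w t * ennreal (exp (- a * t)) \<le> ennreal C * (S * ennreal (exp (a * t) / a)) * ennreal (exp (- a * t))"
      by (rule mult_right_mono) simp
    also have "\<dots> = S * ennreal (C * (exp (a * t) / a) * exp (- a * t))"
      using C a by (subst ennreal_mult, simp, simp)+ (simp only: mult_ac)
    also have "C * (exp (a * t) / a) * exp (- a * t) = C / a" by (simp add: exp_minus field_simps)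
    finally have "w t * ennreal (exp (- a * t)) \<le> S * ennreal (C / a)" .
    also have "S * ennreal (C / a) \<le> S * ennreal (1 / 2)" using a by (intro mult_left_mono ennreal_leI) auto
    finally show "w t * ennreal (exp (- a * t)) \<le> ennreal (1/2) * S" by (simp only: mult.commute)
  qed
  moreover obtain s where s: "0 \<le> s" "S = ennreal s" using fin by (cases S) auto
  ultimately have "s \<le> 1/2 * s" by (simp add: ennreal_mult'[symmetric] s(1) del: ennreal_half)
  then have "S = 0" using s by simp
  then show ?thesis using up[OF \<tau>] by simp
qed

text \<open>
  \<open>h j t p\<close> stands for \<open>f(p, u(t), v\<^sup>j)\<close> and \<open>D i\<close>
  for the initial and boundary data of component \<open>i\<close>, as a function of the label of
  the characteristic.
\<close>

locale semilinear_transport = transport L \<kappa> \<theta> X \<Theta> G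
  for L \<kappa> :: real and \<theta> X :: "'n::finite \<Rightarrow> real \<Rightarrow> real" and \<Theta> :: "'n \<Rightarrow> real"
    and G :: "((real, 'n) vec, 'n) vec" +
  fixes h :: "'m::finite \<Rightarrow> real \<Rightarrow> (real, 'n) vec \<Rightarrow> (real, 'n) vec" and D :: "'n \<Rightarrow> real \<Rightarrow> real"
  assumes h_borel: "\<And>j. (\<lambda>q. h j (fst q) (snd q)) \<in> borel_measurable (borel \<Otimes>\<^sub>M borel)"
    and h_zero: "\<And>j t. h j t 0 = 0"
    and D_borel [measurable]: "\<And>i. D i \<in> borel_measurable borel"
begin

definition source_term :: "(real \<Rightarrow> real ^ 'm) \<Rightarrow> (real \<Rightarrow> real \<Rightarrow> (real, 'n) vec) \<Rightarrow> real \<Rightarrow> real \<Rightarrow> (real, 'n) vec" where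
  "source_term b y t x = (\<Sum>j\<in>UNIV. b t $ j *\<^sub>R h j t (y t x))"

definition base :: "real \<Rightarrow> real \<Rightarrow> (real, 'n) vec" where
  "base \<tau> x = (\<chi> i. D i (- \<tau> + \<theta> i x))"

definition Psi :: "(real \<Rightarrow> real ^ 'm) \<Rightarrow> (real \<Rightarrow> real \<Rightarrow> (real, 'n) vec) \<Rightarrow> real \<Rightarrow> real \<Rightarrow> (real, 'n) vec" where
  "Psi b y \<tau> x = indicat_real {0..L} x *\<^sub>R (base \<tau> x + propagate (source_term b y) \<tau> x)"

text \<open>
  The functions on which \<open>Psi\<close> acts; vanishing outside the domain is preserved since
  \<open>h j t 0 = 0\<close>.
\<close>

definition state :: "real \<Rightarrow> (real \<Rightarrow> real \<Rightarrow> (real, 'n) vec) \<Rightarrow> bool" where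
  "state R y \<longleftrightarrow> jointly_borel y \<and> (\<forall>t x. norm (y t x) \<le> R) \<and> (\<forall>t x. x \<notin> {0..L} \<longrightarrow> y t x = 0)"

text \<open>
  Vanishing of the weights outside \<open>[0,T]\<close> makes all bounds on sources hold for all
  times.
\<close>

definition weights :: "real \<Rightarrow> (real \<Rightarrow> real ^ 'm) \<Rightarrow> bool" where
  "weights T b \<longleftrightarrow> b \<in> borel_measurable borel \<and> (\<forall>t j. \<bar>b t $ j\<bar> \<le> indicat_real {0..T} t)"

definition source_Lipschitz :: "real \<Rightarrow> real \<Rightarrow> bool" where
  "source_Lipschitz R K \<longleftrightarrow> 0 \<le> R \<and> 0 \<le> K \<and>
     (\<forall>j t t' p p'. norm p \<le> R \<longrightarrow> norm p' \<le> R \<longrightarrow> norm (h j t p - h j t' p') \<le> K * (\<bar>t - t'\<bar> + norm (p - p')))"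


lemma stateD:
  assumes "state R y"
  shows "jointly_borel y" "norm (y t x) \<le> R" "x \<notin> {0..L} \<Longrightarrow> y t x = 0"
  using assms unfolding state_def by auto

lemma weightsD:
  assumes "weights T b"
  shows "b \<in> borel_measurable borel" "\<bar>b t $ j\<bar> \<le> indicat_real {0..T} t" "\<bar>b t $ j\<bar> \<le> 1"
  using assms indicator_le_1[of "{0..T}" t] order_trans unfolding weights_def by (auto, blast)

lemma source_LipschitzD:
  assumes "source_Lipschitz R K"
  shows "0 \<le> R" "0 \<le> K"
    and "norm p \<le> R \<Longrightarrow> norm p' \<le> R \<Longrightarrow> norm (h j t p - h j t p') \<le> K * norm (p - p')"
    and "norm p \<le> R \<Longrightarrow> norm p' \<le> R \<Longrightarrow> norm (h j t p - h j t' p') \<le> K * (\<bar>t - t'\<bar> + norm (p - p'))"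
    and "norm p \<le> R \<Longrightarrow> norm (h j t p) \<le> K * norm p"
proof -
  show 1: "0 \<le> R" "0 \<le> K" using assms unfolding source_Lipschitz_def by auto
  show "norm p \<le> R \<Longrightarrow> norm p' \<le> R \<Longrightarrow> norm (h j t p - h j t' p') \<le> K * (\<bar>t - t'\<bar> + norm (p - p'))" for p p' j t t'
    using assms unfolding source_Lipschitz_def by blast
  from this[of p p' j t t] show "norm p \<le> R \<Longrightarrow> norm p' \<le> R \<Longrightarrow> norm (h j t p - h j t p') \<le> K * norm (p - p')"
    by simp
  from \<open>\<And>p p' j t t'. norm p \<le> R \<Longrightarrow> norm p' \<le> R \<Longrightarrow> norm (h j t p - h j t' p') \<le> K * (\<bar>t - t'\<bar> + norm (p - p'))\<close>[of p 0 j t t]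
  show "norm p \<le> R \<Longrightarrow> norm (h j t p) \<le> K * norm p" using 1 by (simp add: h_zero)
qed

lemma h_compose_borel:
  assumes "f \<in> borel_measurable M" "g \<in> borel_measurable M"
  shows "(\<lambda>x. h j (f x) (g x)) \<in> borel_measurable M"
proof -
  have "(\<lambda>x. (f x, g x)) \<in> M \<rightarrow>\<^sub>M borel \<Otimes>\<^sub>M borel" using assms by simp
  from measurable_compose[OF this h_borel] show ?thesis by simp
qed

lemma jointly_borel_h:
  assumes "jointly_borel y" shows "jointly_borel (\<lambda>t x. h j t (y t x))"
  by (intro jointly_borelI h_compose_borel) (use assms in \<open>auto simp: jointly_borel_def\<close>)

lemma jointly_borel_source:
  assumes y: "jointly_borel y" and [measurable]: "b \<in> borel_measurable borel"
  shows "jointly_borel (source_term b y)"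
proof (rule jointly_borelI)
  have [measurable]: "(\<lambda>p. h j (fst p) (y (fst p) (snd p))) \<in> borel_measurable (borel \<Otimes>\<^sub>M borel)" for j
    using jointly_borel_h[OF y] unfolding jointly_borel_def .
  show "(\<lambda>p. source_term b y (fst p) (snd p)) \<in> borel_measurable (borel \<Otimes>\<^sub>M borel)"
    unfolding source_term_def by measurable
qed

lemma source_norm_le:
  assumes K: "source_Lipschitz R K" and b: "weights T b" and y: "norm (y t x) \<le> R"
  shows "norm (source_term b y t x) \<le> (real CARD('m) * K * norm (y t x)) * indicat_real {0..T} t"
proof -
  have "norm (source_term b y t x) \<le> (\<Sum>j\<in>(UNIV::'m set). indicat_real {0..T} t * (K * norm (y t x)))"
    unfolding source_term_def
    by (rule sum_norm_le) (use weightsD(2)[OF b] source_LipschitzD(5)[OF K y] in \<open>auto intro!: mult_mono\<close>)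
  then show ?thesis by (simp add: mult_ac)
qed

lemma source_norm_le':
  assumes K: "source_Lipschitz R K" and b: "weights T b" and y: "norm (y t x) \<le> R"
  shows "norm (source_term b y t x) \<le> (real CARD('m) * K * R) * indicat_real {0..T} t"
  using y source_LipschitzD(1,2)[OF K]
  by (intro order_trans[OF source_norm_le[where y = y and t = t and x = x, OF assms]] mult_right_mono mult_left_mono) auto

lemma source_diff_le:
  assumes K: "source_Lipschitz R K" and b: "weights T b" and y: "norm (y t x) \<le> R" "norm (y' t x) \<le> R"
  shows "norm (source_term b y t x - source_term b y' t x) \<le> (real CARD('m) * K * norm (y t x - y' t x)) * indicat_real {0..T} t"
proof -
  have "source_term b y t x - source_term b y' t x = (\<Sum>j\<in>UNIV. b t $ j *\<^sub>R (h j t (y t x) - h j t (y' t x)))"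
    by (simp add: source_term_def sum_subtractf scaleR_diff_right)
  also have "norm \<dots> \<le> (\<Sum>j\<in>(UNIV::'m set). indicat_real {0..T} t * (K * norm (y t x - y' t x)))"
    by (rule sum_norm_le) (use weightsD(2)[OF b] source_LipschitzD(3)[OF K y] in \<open>auto intro!: mult_mono\<close>)
  finally show ?thesis by (simp add: mult_ac)
qed

lemma jointly_borel_base: "jointly_borel base"
  unfolding base_def by (rule jointly_borelI) measurable

lemma jointly_borel_Psi:
  assumes y: "jointly_borel y" and b: "b \<in> borel_measurable borel"
  shows "jointly_borel (Psi b y)"
proof (rule jointly_borelI)
  have [measurable]: "(\<lambda>p. base (fst p) (snd p)) \<in> borel_measurable (borel \<Otimes>\<^sub>M borel)"
    using jointly_borel_base unfolding jointly_borel_def .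
  have [measurable]: "(\<lambda>p. propagate (source_term b y) (fst p) (snd p)) \<in> borel_measurable (borel \<Otimes>\<^sub>M borel)"
    using jointly_borel_propagate[OF jointly_borel_source[OF assms]] unfolding jointly_borel_def .
  show "(\<lambda>p. Psi b y (fst p) (snd p)) \<in> borel_measurable (borel \<Otimes>\<^sub>M borel)"
    unfolding Psi_def by measurable
qed

lemma Psi_diff_L1:
  assumes K: "source_Lipschitz R K" and b: "weights T b" and y: "state R y" and y': "state R y'"
  shows "(\<integral>\<^sup>+x. ennreal (norm (Psi b y \<tau> x - Psi b y' \<tau> x)) \<partial>lborel)
     \<le> ennreal (\<Gamma> * \<kappa>\<^sup>2 * (real CARD('m) * K)) * (\<integral>\<^sup>+t\<in>{0..\<tau>}. (\<integral>\<^sup>+x. ennreal (norm (y t x - y' t x)) \<partial>lborel) \<partial>lborel)"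
proof -
  let ?F = "source_term b y" and ?F' = "source_term b y'"
  have mK: "0 \<le> real CARD('m) * K" using source_LipschitzD(2)[OF K] by simp
  note Fb = jointly_borel_source[OF stateD(1)[OF y] weightsD(1)[OF b]] jointly_borel_source[OF stateD(1)[OF y'] weightsD(1)[OF b]]
  have bd: "norm (?F t x) \<le> real CARD('m) * K * R" "norm (?F' t x) \<le> real CARD('m) * K * R" for t x
    using source_norm_le'[OF K b stateD(2)[OF y]] source_norm_le'[OF K b stateD(2)[OF y']]
      mult_indicator_le mK source_LipschitzD(1)[OF K] by (meson mult_nonneg_nonneg order_trans)+
  let ?E = "\<lambda>t x. ?F t x - ?F' t x"
  have E: "jointly_borel ?E" "norm (?E t x) \<le> 2 * (real CARD('m) * K * R)" for t x
    using Fb bd[of t x] norm_triangle_ineq4[of "?F t x" "?F' t x"] by (auto simp: jointly_borel_def intro: borel_measurable_diff)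
  have [measurable]: "(\<lambda>q. y (fst q) (snd q)) \<in> borel_measurable (lborel \<Otimes>\<^sub>M lborel)" "(\<lambda>q. y' (fst q) (snd q)) \<in> borel_measurable (lborel \<Otimes>\<^sub>M lborel)"
    by (rule jointly_borel_compose[OF stateD(1)[OF y]] jointly_borel_compose[OF stateD(1)[OF y']]; simp)+
  have "(\<integral>\<^sup>+x. ennreal (norm (Psi b y \<tau> x - Psi b y' \<tau> x)) \<partial>lborel) \<le> (\<integral>\<^sup>+x. ennreal (norm (propagate ?E \<tau> x)) \<partial>lborel)"
  proof (rule nn_integral_mono)
    fix x
    have "Psi b y \<tau> x - Psi b y' \<tau> x = indicat_real {0..L} x *\<^sub>R propagate ?E \<tau> x"
      unfolding Psi_def propagate_diff[OF Fb(1) bd(1) Fb(2) bd(2), symmetric] by (simp add: algebra_simps)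
    then show "ennreal (norm (Psi b y \<tau> x - Psi b y' \<tau> x)) \<le> ennreal (norm (propagate ?E \<tau> x))"
      by (auto simp: indicator_def)
  qed
  also have "\<dots> \<le> ennreal (\<Gamma> * \<kappa>\<^sup>2) * (\<integral>\<^sup>+t\<in>{0..\<tau>}. (\<integral>\<^sup>+x. ennreal (norm (?E t x)) \<partial>lborel) \<partial>lborel)"
    by (rule propagate_L1[OF E])
  also have "\<dots> \<le> ennreal (\<Gamma> * \<kappa>\<^sup>2) * (\<integral>\<^sup>+t. ennreal (real CARD('m) * K) * ((\<integral>\<^sup>+x. ennreal (norm (y t x - y' t x)) \<partial>lborel) * indicator {0..\<tau>} t) \<partial>lborel)"
  proof (intro mult_left_mono nn_integral_mono)
    fix t
    have "(\<integral>\<^sup>+x. ennreal (norm (?E t x)) \<partial>lborel) \<le> (\<integral>\<^sup>+x. ennreal (real CARD('m) * K) * ennreal (norm (y t x - y' t x)) \<partial>lborel)"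
    proof (rule nn_integral_mono)
      fix x
      have "norm (?E t x) \<le> (real CARD('m) * K * norm (y t x - y' t x)) * indicat_real {0..T} t"
        by (intro source_diff_le[OF K b] stateD(2)[OF y] stateD(2)[OF y'])
      also have "\<dots> \<le> real CARD('m) * K * norm (y t x - y' t x)" using mK by (intro mult_indicator_le) simp
      finally show "ennreal (norm (?E t x)) \<le> ennreal (real CARD('m) * K) * ennreal (norm (y t x - y' t x))"
        using mK by (simp add: ennreal_mult'[symmetric] ennreal_leI)
    qed
    also have "\<dots> = ennreal (real CARD('m) * K) * (\<integral>\<^sup>+x. ennreal (norm (y t x - y' t x)) \<partial>lborel)"
    proof -
      have [measurable]: "y t \<in> borel_measurable borel" "y' t \<in> borel_measurable borel"
        using jointly_borel_space stateD(1) y y' by blast+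
      show ?thesis by (rule nn_integral_cmult) simp
    qed
    finally show "(\<integral>\<^sup>+x. ennreal (norm (?E t x)) \<partial>lborel) * indicator {0..\<tau>} t
        \<le> ennreal (real CARD('m) * K) * ((\<integral>\<^sup>+x. ennreal (norm (y t x - y' t x)) \<partial>lborel) * indicator {0..\<tau>} t)"
      by (auto simp: indicator_def)
  qed auto
  also have "\<dots> = ennreal (\<Gamma> * \<kappa>\<^sup>2) * (ennreal (real CARD('m) * K) * (\<integral>\<^sup>+t\<in>{0..\<tau>}. (\<integral>\<^sup>+x. ennreal (norm (y t x - y' t x)) \<partial>lborel) \<partial>lborel))"
    by (subst nn_integral_cmult) (auto simp: split_beta' intro!: borel_measurable_times_ennreal lborel.borel_measurable_nn_integral)
  also have "\<dots> = ennreal (\<Gamma> * \<kappa>\<^sup>2 * (real CARD('m) * K)) * (\<integral>\<^sup>+t\<in>{0..\<tau>}. (\<integral>\<^sup>+x. ennreal (norm (y t x - y' t x)) \<partial>lborel) \<partial>lborel)"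
    using mK \<Gamma>_nonneg by (simp add: ennreal_mult mult.assoc)
  finally show ?thesis .
qed

lemma state_L1_diff_le:
  assumes y: "state R y" and y': "state R y'" and R: "0 \<le> R"
  shows "(\<integral>\<^sup>+x. ennreal (norm (y t x - y' t' x)) \<partial>lborel) \<le> ennreal (2 * R * L)"
proof -
  have "(\<integral>\<^sup>+x. ennreal (norm (y t x - y' t' x)) \<partial>lborel) \<le> (\<integral>\<^sup>+x. ennreal (2 * R) * indicator {0..L} x \<partial>lborel)"
  proof (rule nn_integral_mono)
    fix x
    have "norm (y t x - y' t' x) \<le> 2 * R"
      using norm_triangle_ineq4[of "y t x" "y' t' x"] stateD(2)[OF y, of t x] stateD(2)[OF y', of t' x] by linarith
    then show "ennreal (norm (y t x - y' t' x)) \<le> ennreal (2 * R) * indicator {0..L} x"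
      using stateD(3)[OF y, of x t] stateD(3)[OF y', of x t'] by (cases "x \<in> {0..L}") (auto intro: ennreal_leI)
  qed
  also have "\<dots> = ennreal (2 * R * L)" using L_nonneg R by (simp add: nn_integral_cmult ennreal_mult')
  finally show ?thesis .
qed

text \<open>
  Gronwall instead of contraction: the Lipschitz constant depends on the bound \<open>R\<close> of
  the competitor, so \<open>T\<close> cannot be chosen small in terms of it.
\<close>

lemma fixed_point_unique:
  assumes K: "source_Lipschitz R K" and b: "weights T b" and y: "state R y" and y': "state R y'"
    and fp: "\<And>\<tau>. \<tau> \<in> {0..T} \<Longrightarrow> AE x in lborel. y \<tau> x = Psi b y \<tau> x"
    and fp': "\<And>\<tau>. \<tau> \<in> {0..T} \<Longrightarrow> AE x in lborel. y' \<tau> x = Psi b y' \<tau> x"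
    and \<tau>: "\<tau> \<in> {0..T}"
  shows "AE x in lborel. y \<tau> x = y' \<tau> x"
proof -
  let ?w = "\<lambda>t. (\<integral>\<^sup>+x. ennreal (norm (y t x - y' t x)) \<partial>lborel)"
  have [measurable]: "(\<lambda>q. y (fst q) (snd q)) \<in> borel_measurable (lborel \<Otimes>\<^sub>M lborel)" "(\<lambda>q. y' (fst q) (snd q)) \<in> borel_measurable (lborel \<Otimes>\<^sub>M lborel)"
    by (rule jointly_borel_compose[OF stateD(1)[OF y]] jointly_borel_compose[OF stateD(1)[OF y']]; simp)+
  have [measurable]: "y t \<in> borel_measurable borel" "y' t \<in> borel_measurable borel" for t
    using jointly_borel_space stateD(1) y y' by blast+
  have wm: "?w \<in> borel_measurable lborel"
    by (auto simp: split_beta' intro!: lborel.borel_measurable_nn_integral)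
  have "?w \<tau> = 0"
  proof (rule gronwall_zero[where T = T and C = "\<Gamma> * \<kappa>\<^sup>2 * (real CARD('m) * K)" and B = "2 * R * L"])
    show "?w \<in> borel_measurable borel" using wm by simp
    show "0 \<le> \<Gamma> * \<kappa>\<^sup>2 * (real CARD('m) * K)" using \<Gamma>_nonneg source_LipschitzD(2)[OF K] by simp
    show "?w t \<le> ennreal (2 * R * L)" for t by (rule state_L1_diff_le[OF y y' source_LipschitzD(1)[OF K]])
    fix t assume t: "t \<in> {0..T}"
    have "?w t = (\<integral>\<^sup>+x. ennreal (norm (Psi b y t x - Psi b y' t x)) \<partial>lborel)"
      using fp[OF t] fp'[OF t] by (intro nn_integral_cong_AE) auto
    also have "\<dots> \<le> ennreal (\<Gamma> * \<kappa>\<^sup>2 * (real CARD('m) * K)) * (\<integral>\<^sup>+t\<in>{0..t}. ?w t \<partial>lborel)"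
      by (rule Psi_diff_L1[OF K b y y'])
    finally show "?w t \<le> ennreal (\<Gamma> * \<kappa>\<^sup>2 * (real CARD('m) * K)) * (\<integral>\<^sup>+t\<in>{0..t}. ?w t \<partial>lborel)" .
  qed (rule \<tau>)
  then show ?thesis by (subst (asm) nn_integral_0_iff_AE) auto
qed

end


section \<open>Fixed points for short times and their regularity\<close>

lemma set_integral_bound_Icc:
  fixes f :: "real \<Rightarrow> real"
  assumes "f \<in> borel_measurable borel" "\<And>x. \<bar>f x\<bar> \<le> S" "a \<le> b"
  shows "\<bar>LINT x:{a..b}|lborel. f x\<bar> \<le> S * (b - a)"
proof -
  have int: "set_integrable lborel {a..b} f"
    by (rule set_integrable_bounded_interval[OF assms(1)]) (use assms(2) in auto)
  have "\<bar>LINT x:{a..b}|lborel. f x\<bar> \<le> (LINT x:{a..b}|lborel. \<bar>f x\<bar>)"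
    using set_integral_norm_bound[OF int] by simp
  also have "\<dots> \<le> (LINT x:{a..b}|lborel. S)"
    by (rule set_integral_mono)
      (use set_integrable_abs[OF int] assms in \<open>auto intro!: set_integrable_bounded_interval[where B = "\<bar>S\<bar>"]\<close>)
  also have "\<dots> = S * (b - a)" using assms(3) by (simp add: set_lebesgue_integral_def)
  finally show ?thesis .
qed

text \<open>
  The smallness condition makes \<open>Psi\<close> a contraction with factor one half both in the
  supremum norm and in the norm of \<open>C([0,T];L\<^sup>1)\<close>; the bound on the data leaves
  half of the ball of radius \<open>R\<close> for the sources.
\<close>

locale small_time_transport = semilinear_transport L \<kappa> \<theta> X \<Theta> G h D
  for L \<kappa> :: real and \<theta> X :: "'n::finite \<Rightarrow> real \<Rightarrow> real" and \<Theta> :: "'n \<Rightarrow> real"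
    and G :: "((real, 'n) vec, 'n) vec"
    and h :: "'m::finite \<Rightarrow> real \<Rightarrow> (real, 'n) vec \<Rightarrow> (real, 'n) vec" and D :: "'n \<Rightarrow> real \<Rightarrow> real" +
  fixes T R K V0 :: real
  assumes T: "0 \<le> T" "T \<le> 1" and K: "source_Lipschitz R K"
    and D_bound: "\<And>i z. real CARD('n) * \<bar>D i z\<bar> \<le> R / 2"
    and D_variation: "\<And>i. variation_le (D i) V0"
    and small: "2 * T * (\<Gamma> * \<kappa>\<^sup>2 * (real CARD('m) * K)) \<le> 1"
begin


text \<open>
  The fixed value of the estimate \<open>V \<le> n V0 + V / 2 + 2 R\<close> for the variation
  under one application of \<open>Psi\<close>: data, sources, and the two jumps at the ends of the
  domain.
\<close>

definition V :: real where "V = 2 * (real CARD('n) * V0) + 4 * R"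

lemma K_nonneg: "0 \<le> K" "0 \<le> R" "0 \<le> real CARD('m) * K" using source_LipschitzD(1,2)[OF K] by auto

lemma V0_nonneg: "0 \<le> V0" using variation_le_nonneg[OF D_variation] .

lemma V_nonneg: "0 \<le> V" unfolding V_def using V0_nonneg K_nonneg by simp

lemma small': "\<Gamma> * (T * (real CARD('m) * K)) \<le> 1 / 2"
proof -
  have "1 \<le> \<kappa>\<^sup>2" using \<kappa>_ge_1 by (simp add: one_le_power)
  then have "T * (\<Gamma> * 1 * (real CARD('m) * K)) \<le> T * (\<Gamma> * \<kappa>\<^sup>2 * (real CARD('m) * K))"
    using T \<Gamma>_nonneg K_nonneg by (intro mult_left_mono mult_right_mono) auto
  then show ?thesis using small by (simp add: mult_ac)
qed

lemma base_norm_le: "norm (base \<tau> x) \<le> R / 2"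
proof -
  have "\<bar>D i z\<bar> \<le> R / 2 / real CARD('n)" for i z
    using D_bound[of i z] by (simp add: field_simps)
  then have "(\<Sum>i\<in>UNIV. \<bar>base \<tau> x $ i\<bar>) \<le> (\<Sum>i\<in>(UNIV::'n set). R / 2 / real CARD('n))"
    unfolding base_def by (intro sum_mono) simp
  also have "\<dots> = R / 2" by simp
  finally show ?thesis using norm_le_l1_cart[of "base \<tau> x"] by linarith
qed

lemma base_variation: "variation_le (base \<tau>) (real CARD('n) * V0)"
proof -
  have "variation_le (\<lambda>x. D i (- \<tau> + \<theta> i x)) V0" for i by (rule variation_le_\<theta>[OF D_variation])
  then have "variation_le (base \<tau>) (\<Sum>i\<in>(UNIV::'n set). 1 * V0)"
    by (rule variation_le_sum_bound[rotated])
      (auto simp: base_def intro!: order_trans[OF norm_le_l1_cart])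
  then show ?thesis by simp
qed

lemma source_facts:
  assumes b: "weights T b" and y: "state R y"
  shows "jointly_borel (source_term b y)"
    and "norm (source_term b y t x) \<le> ((real CARD('m) * K) * R) * indicat_real {0..T} t"
    and "norm (source_term b y t x) \<le> (real CARD('m) * K) * R"
proof -
  show "jointly_borel (source_term b y)" by (rule jointly_borel_source[OF stateD(1)[OF y] weightsD(1)[OF b]])
  show 1: "norm (source_term b y t x) \<le> ((real CARD('m) * K) * R) * indicat_real {0..T} t"
    by (rule source_norm_le'[OF K b stateD(2)[OF y]])
  show "norm (source_term b y t x) \<le> (real CARD('m) * K) * R"
    using K_nonneg by (intro order_trans[OF 1] mult_indicator_le) simp
qed

lemma inner_norm_le:
  assumes b: "weights T b" and y: "state R y"
  shows "norm (base \<tau> x + propagate (source_term b y) \<tau> x) \<le> R"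
proof -
  have "norm (propagate (source_term b y) \<tau> x) \<le> \<Gamma> * (T * ((real CARD('m) * K) * R))"
    by (rule propagate_sup_le[OF source_facts(1,2)[OF assms] T(1)])
  also have "\<dots> = (\<Gamma> * (T * (real CARD('m) * K))) * R" by simp
  also have "\<dots> \<le> 1 / 2 * R" using small' K_nonneg by (intro mult_right_mono) auto
  finally show ?thesis using norm_triangle_ineq[of "base \<tau> x" "propagate (source_term b y) \<tau> x"] base_norm_le[of \<tau> x] by linarith
qed

lemma Psi_state:
  assumes b: "weights T b" and y: "state R y"
  shows "state R (Psi b y)"
  unfolding state_def
proof (intro conjI allI impI)
  show "jointly_borel (Psi b y)" by (rule jointly_borel_Psi[OF stateD(1)[OF y] weightsD(1)[OF b]])
  show "norm (Psi b y t x) \<le> R" for t x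
    using inner_norm_le[OF assms] K_nonneg by (auto simp: Psi_def indicator_def)
qed (simp add: Psi_def)

lemma source_variation:
  assumes b: "weights T b" and y: "state R y" and v: "variation_le (y t) W"
  shows "variation_le (source_term b y t) ((real CARD('m) * K) * W)"
proof (rule variation_le_Lipschitz[OF v _ K_nonneg(3)])
  fix x x'
  have "norm (source_term b y t x - source_term b (\<lambda>t _. y t x') t x) \<le> ((real CARD('m) * K) * norm (y t x - y t x')) * indicat_real {0..T} t"
    by (intro source_diff_le[OF K b] stateD(2)[OF y])
  also have "\<dots> \<le> (real CARD('m) * K) * norm (y t x - y t x')" using K_nonneg by (intro mult_indicator_le) simp
  finally show "norm (source_term b y t x - source_term b y t x') \<le> (real CARD('m) * K) * norm (y t x - y t x')"
    by (simp add: source_term_def)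
qed

lemma Psi_variation:
  assumes b: "weights T b" and y: "state R y" and v: "\<And>t. variation_le (y t) V"
  shows "variation_le (Psi b y \<tau>) V"
proof -
  have "variation_le (propagate (source_term b y) \<tau>) (\<Gamma> * (T * ((real CARD('m) * K) * V)))"
    by (rule propagate_variation[OF source_facts(1,2)[OF b y] source_variation[OF b y v] T(1)])
  from variation_le_add[OF base_variation this]
  have inner: "variation_le (\<lambda>x. base \<tau> x + propagate (source_term b y) \<tau> x) (real CARD('n) * V0 + \<Gamma> * (T * ((real CARD('m) * K) * V)))" .
  have "variation_le (Psi b y \<tau>) (1 * (real CARD('n) * V0 + \<Gamma> * (T * ((real CARD('m) * K) * V))) + 2 * R)"
    unfolding Psi_def
    by (rule variation_le_scaleR[OF inner variation_le_indicator_interval(1) _ inner_norm_le[OF b y]])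
      (auto simp: indicator_def)
  moreover have "\<Gamma> * (T * ((real CARD('m) * K) * V)) \<le> 1 / 2 * V"
    using mult_right_mono[OF small' V_nonneg] by (simp add: mult.assoc)
  from this have "1 * (real CARD('n) * V0 + \<Gamma> * (T * (real CARD('m) * K * V))) + 2 * R \<le> V"
  proof -
    note \<open>\<Gamma> * (T * (real CARD('m) * K * V)) \<le> 1 / 2 * V\<close>
    moreover have "real CARD('n) * V0 + 2 * R = V / 2" by (simp add: V_def)
    ultimately show ?thesis by simp
  qed
  ultimately show ?thesis using variation_le_weaken by blast
qed

lemma Psi_contraction:
  assumes b: "weights T b" and y: "state R y" and y': "state R y'"
    and \<delta>: "\<And>t x. norm (y t x - y' t x) \<le> \<delta>"
  shows "norm (Psi b y \<tau> x - Psi b y' \<tau> x) \<le> \<delta> / 2"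
proof -
  let ?E = "\<lambda>t x. source_term b y t x - source_term b y' t x"
  have \<delta>0: "0 \<le> \<delta>" using \<delta>[of 0 0] norm_ge_zero order_trans by blast
  have E: "jointly_borel ?E"
    using source_facts(1)[OF b y] source_facts(1)[OF b y'] by (auto simp: jointly_borel_def)
  have E': "norm (?E t x) \<le> ((real CARD('m) * K) * \<delta>) * indicat_real {0..T} t" for t x
    using \<delta> K_nonneg
    by (intro order_trans[OF source_diff_le[where y = y and y' = y' and t = t and x = x, OF K b stateD(2)[OF y] stateD(2)[OF y']]]
        mult_right_mono mult_left_mono) auto
  have "Psi b y \<tau> x - Psi b y' \<tau> x = indicat_real {0..L} x *\<^sub>R propagate ?E \<tau> x"
    unfolding Psi_def propagate_diff[OF source_facts(1,3)[OF b y] source_facts(1,3)[OF b y'], symmetric] by (simp add: algebra_simps)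
  then have "norm (Psi b y \<tau> x - Psi b y' \<tau> x) \<le> norm (propagate ?E \<tau> x)" by (auto simp: indicator_def)
  also have "\<dots> \<le> \<Gamma> * (T * ((real CARD('m) * K) * \<delta>))" by (rule propagate_sup_le[OF E E' T(1)])
  also have "\<dots> = (\<Gamma> * (T * (real CARD('m) * K))) * \<delta>" by simp
  also have "\<dots> \<le> 1 / 2 * \<delta>" using small' \<delta>0 by (intro mult_right_mono) auto
  finally show ?thesis by simp
qed

primrec iterate :: "(real \<Rightarrow> real ^ 'm) \<Rightarrow> nat \<Rightarrow> real \<Rightarrow> real \<Rightarrow> (real, 'n) vec" where
  "iterate b 0 = (\<lambda>t x. 0)"
| "iterate b (Suc n) = Psi b (iterate b n)"

text \<open>
  Picard iteration in the supremum norm over all points, not almost everywhere: the limit is again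
  Borel, satisfies the equation at every point, and inherits the variation bound of the iterates.
\<close>

theorem fixed_point_exists:
  assumes b: "weights T b"
  obtains y where "state R y" "\<And>t. variation_le (y t) V" "\<And>\<tau> x. y \<tau> x = Psi b y \<tau> x"
proof -
  let ?Y = "iterate b"
  have st: "state R (?Y n)" for n
  proof (induction n)
    case 0 show ?case using K_nonneg by (auto simp: state_def intro!: jointly_borelI)
  next
    case (Suc n) then show ?case by (simp add: Psi_state[OF b])
  qed
  have var: "variation_le (?Y n t) V" for n t
  proof (induction n arbitrary: t)
    case 0 show ?case using V_nonneg by (simp add: variation_le_def)
  next
    case (Suc n) then show ?case by (simp add: Psi_variation[OF b st])
  qed
  have near: "norm (?Y (n + k) t x - ?Y n t x) \<le> R * (1/2) ^ n" for n k t x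
  proof (induction n arbitrary: t x)
    case 0 show ?case using stateD(2)[OF st] by simp
  next
    case (Suc n)
    have "norm (Psi b (?Y (n + k)) t x - Psi b (?Y n) t x) \<le> (R * (1/2) ^ n) / 2"
      by (rule Psi_contraction[OF b st st Suc.IH])
    then show ?case by simp
  qed
  have lim0: "(\<lambda>n. R * (1/2) ^ n) \<longlonglongrightarrow> 0"
    using tendsto_mult[OF tendsto_const[of R] LIMSEQ_power_zero[of "1/2::real"]] by simp
  have "Cauchy (\<lambda>n. ?Y n t x)" for t x
    unfolding Cauchy_altdef
  proof (intro allI impI)
    fix e :: real assume "0 < e"
    then have "eventually (\<lambda>n. R * (1/2) ^ n < e) sequentially" using order_tendstoD(2)[OF lim0] by blast
    then obtain N where N: "\<And>n. n \<ge> N \<Longrightarrow> R * (1/2) ^ n < e" unfolding eventually_sequentially by blast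
    show "\<exists>N. \<forall>m\<ge>N. \<forall>n>m. dist (?Y m t x) (?Y n t x) < e"
    proof (intro exI allI impI)
      fix m n assume "m \<ge> N" "n > m"
      then show "dist (?Y m t x) (?Y n t x) < e"
        using near[of m "n - m" t x] N[of m] by (simp add: dist_norm norm_minus_commute)
    qed
  qed
  then have conv: "convergent (\<lambda>n. ?Y n t x)" for t x by (rule Cauchy_convergent)
  define y where "y t x = lim (\<lambda>n. ?Y n t x)" for t x
  have lim: "(\<lambda>n. ?Y n t x) \<longlonglongrightarrow> y t x" for t x
    using conv[of t x] unfolding y_def convergent_LIMSEQ_iff .
  have sy: "state R y"
    unfolding state_def
  proof (intro conjI allI impI)
    show "jointly_borel y"
      unfolding jointly_borel_def
      by (rule borel_measurable_LIMSEQ_metric[where f = "\<lambda>n p. ?Y n (fst p) (snd p)"])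
        (use stateD(1)[OF st] lim in \<open>auto simp: jointly_borel_def\<close>)
    show "norm (y t x) \<le> R" for t x
      by (rule LIMSEQ_le_const2[OF tendsto_norm[OF lim]]) (use stateD(2)[OF st] in auto)
    show "y t x = 0" if "x \<notin> {0..L}" for t x
      using lim[of t x] stateD(3)[OF st that] by (simp add: LIMSEQ_const_iff)
  qed
  have near_y: "norm (y t x - ?Y n t x) \<le> R * (1/2) ^ n" for n t x
  proof (rule LIMSEQ_le_const2)
    show "(\<lambda>k. norm (?Y (n + k) t x - ?Y n t x)) \<longlonglongrightarrow> norm (y t x - ?Y n t x)"
      using LIMSEQ_ignore_initial_segment[OF lim[of t x], of n]
      by (intro tendsto_intros) (simp add: add.commute)
  qed (use near in auto)
  have "y \<tau> x = Psi b y \<tau> x" for \<tau> x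
  proof (rule LIMSEQ_unique)
    show "(\<lambda>n. ?Y (Suc n) \<tau> x) \<longlonglongrightarrow> y \<tau> x" by (rule LIMSEQ_Suc[OF lim])
    have "(\<lambda>n. ?Y (Suc n) \<tau> x - Psi b y \<tau> x) \<longlonglongrightarrow> 0"
    proof (rule Lim_null_comparison)
      show "\<forall>\<^sub>F n in sequentially. norm (?Y (Suc n) \<tau> x - Psi b y \<tau> x) \<le> R * (1/2) ^ n / 2"
      proof (rule always_eventually, rule allI)
        fix n
        show "norm (?Y (Suc n) \<tau> x - Psi b y \<tau> x) \<le> R * (1/2) ^ n / 2"
          using Psi_contraction[OF b sy st near_y[where n = n], of \<tau> x] by (simp add: norm_minus_commute)
      qed
      show "(\<lambda>n. R * (1/2) ^ n / 2) \<longlonglongrightarrow> 0" using tendsto_divide[OF lim0 tendsto_const[of 2]] by simp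
    qed
    then show "(\<lambda>n. ?Y (Suc n) \<tau> x) \<longlonglongrightarrow> Psi b y \<tau> x" by (rule LIM_zero_cancel)
  qed
  then show thesis using that[OF sy variation_le_limit[OF var lim]] by blast
qed

lemma leg_time_diff:
  assumes F: "jointly_borel F" "\<And>t x. norm (F t x) \<le> S" and \<tau>: "0 \<le> \<tau>" "0 \<le> \<tau>'"
  shows "\<bar>leg F k \<tau> \<zeta> - leg F k \<tau>' \<zeta>\<bar> \<le> S * \<bar>\<tau> - \<tau>'\<bar>"
proof -
  have *: "\<bar>leg F k b \<zeta> - leg F k a \<zeta>\<bar> \<le> S * (b - a)" if "0 \<le> a" "a \<le> b" for a b
    unfolding leg_def set_integral_combine_Icc[OF that leg_integrable[OF F]]
    using set_integral_bound_Icc[OF leg_integrand_measurable[OF F(1)] _ that(2), where S = S] norm_bound_component_le_cart[OF F(2)]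
    by simp
  show ?thesis using *[OF \<tau>(1), of \<tau>'] *[OF \<tau>(2), of \<tau>] by (cases "\<tau> \<le> \<tau>'") (auto simp: abs_minus_commute)
qed

text \<open>
  At each time \<open>t\<close> the two legs sample the same function of bounded variation,
  precomposed with a monotone map, at points that differ by a translation.
\<close>

lemma leg_shift_diff_L1:
  assumes F: "jointly_borel F" "\<And>t x. norm (F t x) \<le> S" and W: "\<And>t. variation_le (F t) W"
    and \<tau>: "0 \<le> \<tau>"
  shows "(\<integral>\<^sup>+x. ennreal \<bar>leg F k \<tau> (a + \<theta> i x) - leg F k \<tau> (a' + \<theta> i x)\<bar> \<partial>lborel) \<le> ennreal (\<tau> * (\<kappa> * (\<bar>a - a'\<bar> * W)))"
proof -
  have W0: "0 \<le> W" using variation_le_nonneg[OF W] .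
  let ?g = "\<lambda>t z. F t (X k (t + z))"
  have [measurable]: "?g t \<in> borel_measurable borel" for t
    by (rule jointly_borel_compose[OF F(1)]) auto
  have m1[measurable]: "(\<lambda>q. F (snd q) (X k (c + \<theta> i (fst q) + snd q))) \<in> borel_measurable (lborel \<Otimes>\<^sub>M lborel)" for c
    by (rule jointly_borel_compose[OF F(1)]) auto
  have m2[measurable]: "(\<lambda>q. F (fst q) (X k (c + \<theta> i (snd q) + fst q))) \<in> borel_measurable (lborel \<Otimes>\<^sub>M lborel)" for c
    by (rule jointly_borel_compose[OF F(1)]) auto
  have "ennreal \<bar>leg F k \<tau> (a + z) - leg F k \<tau> (a' + z)\<bar> \<le>
     (\<integral>\<^sup>+t. ennreal (norm (F t (X k (a + z + t)) - F t (X k (a' + z + t)))) * indicator {0..\<tau>} t \<partial>lborel)" for z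
  proof -
    have "leg F k \<tau> (a + z) - leg F k \<tau> (a' + z) = (LINT t:{0..\<tau>}|lborel. F t (X k (a + z + t)) $ k - F t (X k (a' + z + t)) $ k)"
      unfolding leg_def by (rule set_integral_diff(2)[symmetric]) (rule leg_integrable[OF F])+
    then have "ennreal \<bar>leg F k \<tau> (a + z) - leg F k \<tau> (a' + z)\<bar> \<le>
       (\<integral>\<^sup>+t. ennreal (norm (indicat_real {0..\<tau>} t *\<^sub>R (F t (X k (a + z + t)) $ k - F t (X k (a' + z + t)) $ k))) \<partial>lborel)"
      using integral_norm_bound_ennreal[OF set_integral_diff(1)[OF leg_integrable[OF F] leg_integrable[OF F], unfolded set_integrable_def]]
      by (simp add: set_lebesgue_integral_def)
    also have "\<dots> \<le> (\<integral>\<^sup>+t. ennreal (norm (F t (X k (a + z + t)) - F t (X k (a' + z + t)))) * indicator {0..\<tau>} t \<partial>lborel)"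
      by (intro nn_integral_mono)
        (auto simp: indicator_def vector_minus_component[symmetric] component_le_norm_cart simp del: vector_minus_component intro!: ennreal_leI)
    finally show ?thesis .
  qed
  then have "(\<integral>\<^sup>+x. ennreal \<bar>leg F k \<tau> (a + \<theta> i x) - leg F k \<tau> (a' + \<theta> i x)\<bar> \<partial>lborel)
    \<le> (\<integral>\<^sup>+x. (\<integral>\<^sup>+t. ennreal (norm (F t (X k (a + \<theta> i x + t)) - F t (X k (a' + \<theta> i x + t)))) * indicator {0..\<tau>} t \<partial>lborel) \<partial>lborel)"
    by (intro nn_integral_mono)
  also have "\<dots> = (\<integral>\<^sup>+t. (\<integral>\<^sup>+x. ennreal (norm (F t (X k (a + \<theta> i x + t)) - F t (X k (a' + \<theta> i x + t)))) * indicator {0..\<tau>} t \<partial>lborel) \<partial>lborel)"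
    by (rule lborel_pair.Fubini'[symmetric]) (simp add: split_beta')
  also have "\<dots> \<le> (\<integral>\<^sup>+t. ennreal (\<kappa> * (\<bar>a - a'\<bar> * W)) * indicator {0..\<tau>} t \<partial>lborel)"
  proof (rule nn_integral_mono)
    fix t
    have "variation_le (?g t) W" by (rule variation_le_shift[OF variation_le_X[OF W]])
    then have tr: "(\<integral>\<^sup>+z. ennreal (norm (?g t (z + a) - ?g t (z + a'))) \<partial>lborel) \<le> ennreal (\<bar>a - a'\<bar> * W)"
      by (rule nn_integral_translation_le_variation) simp
    have "(\<integral>\<^sup>+x. ennreal (norm (F t (X k (a + \<theta> i x + t)) - F t (X k (a' + \<theta> i x + t)))) \<partial>lborel)
        = (\<integral>\<^sup>+x. ennreal (norm (?g t (\<theta> i x + a) - ?g t (\<theta> i x + a'))) \<partial>lborel)"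
      by (simp add: algebra_simps)
    also have "\<dots> \<le> ennreal \<kappa> * (\<integral>\<^sup>+z. ennreal (norm (?g t (z + a) - ?g t (z + a'))) \<partial>lborel)"
      by (rule \<theta>_transport[where f = "\<lambda>z. ennreal (norm (?g t (z + a) - ?g t (z + a')))"]) simp
    also have "\<dots> \<le> ennreal \<kappa> * ennreal (\<bar>a - a'\<bar> * W)" by (intro mult_left_mono tr) simp
    also have "\<dots> = ennreal (\<kappa> * (\<bar>a - a'\<bar> * W))" using \<kappa>_ge_1 by (simp add: ennreal_mult')
    finally show "(\<integral>\<^sup>+x. ennreal (norm (F t (X k (a + \<theta> i x + t)) - F t (X k (a' + \<theta> i x + t)))) * indicator {0..\<tau>} t \<partial>lborel)
       \<le> ennreal (\<kappa> * (\<bar>a - a'\<bar> * W)) * indicator {0..\<tau>} t" by (auto simp: indicator_def)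
  qed
  also have "\<dots> = ennreal (\<tau> * (\<kappa> * (\<bar>a - a'\<bar> * W)))"
    using \<tau> \<kappa>_ge_1 W0 by (subst nn_integral_cmult) (auto simp: ennreal_mult'[symmetric] mult_ac)
  finally show ?thesis .
qed

text \<open>
  The three terms come from the data, from the change of the upper limit of the legs, and from the
  change of their labels.
\<close>

definition C_time :: real where
  "C_time = real CARD('n) * (\<kappa> * V0) + \<Gamma> * (L * ((real CARD('m) * K) * R) + \<kappa> * ((real CARD('m) * K) * V))"

lemma C_time_nonneg: "0 \<le> C_time"
  unfolding C_time_def using \<kappa>_ge_1 V0_nonneg \<Gamma>_nonneg L_nonneg K_nonneg V_nonneg by simp

lemma base_time_L1:
  "(\<integral>\<^sup>+x. ennreal (norm (base \<tau> x - base \<tau>' x)) \<partial>lborel) \<le> ennreal (real CARD('n) * (\<kappa> * V0) * \<bar>\<tau> - \<tau>'\<bar>)"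
proof -
  have "(\<integral>\<^sup>+x. ennreal (norm (base \<tau> x - base \<tau>' x)) \<partial>lborel)
     \<le> (\<integral>\<^sup>+x. (\<Sum>i\<in>UNIV. ennreal \<bar>D i (\<theta> i x + - \<tau>) - D i (\<theta> i x + - \<tau>')\<bar>) \<partial>lborel)"
  proof (rule nn_integral_mono)
    fix x
    have "norm (base \<tau> x - base \<tau>' x) \<le> (\<Sum>i\<in>UNIV. \<bar>D i (\<theta> i x + - \<tau>) - D i (\<theta> i x + - \<tau>')\<bar>)"
      using norm_le_l1_cart[of "base \<tau> x - base \<tau>' x"] by (simp add: base_def)
    then show "ennreal (norm (base \<tau> x - base \<tau>' x)) \<le> (\<Sum>i\<in>UNIV. ennreal \<bar>D i (\<theta> i x + - \<tau>) - D i (\<theta> i x + - \<tau>')\<bar>)"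
      by (simp add: ennreal_leI)
  qed
  also have "\<dots> = (\<Sum>i\<in>UNIV. \<integral>\<^sup>+x. ennreal \<bar>D i (\<theta> i x + - \<tau>) - D i (\<theta> i x + - \<tau>')\<bar> \<partial>lborel)"
    by (rule nn_integral_sum) measurable
  also have "\<dots> \<le> (\<Sum>i\<in>(UNIV::'n set). ennreal \<kappa> * ennreal (\<bar>\<tau> - \<tau>'\<bar> * V0))"
  proof (rule sum_mono)
    fix i :: 'n
    have "(\<integral>\<^sup>+x. ennreal \<bar>D i (\<theta> i x + - \<tau>) - D i (\<theta> i x + - \<tau>')\<bar> \<partial>lborel) \<le> ennreal \<kappa> * (\<integral>\<^sup>+z. ennreal \<bar>D i (z + - \<tau>) - D i (z + - \<tau>')\<bar> \<partial>lborel)"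
      by (rule \<theta>_transport[where f = "\<lambda>z. ennreal \<bar>D i (z + - \<tau>) - D i (z + - \<tau>')\<bar>"]) measurable
    also have "\<dots> \<le> ennreal \<kappa> * ennreal (\<bar>\<tau> - \<tau>'\<bar> * V0)"
      using nn_integral_translation_le_variation[OF D_variation[of i] D_borel, of "- \<tau>" "- \<tau>'"]
      by (intro mult_left_mono) (simp_all add: abs_minus_commute)
    finally show "(\<integral>\<^sup>+x. ennreal \<bar>D i (\<theta> i x + - \<tau>) - D i (\<theta> i x + - \<tau>')\<bar> \<partial>lborel) \<le> ennreal \<kappa> * ennreal (\<bar>\<tau> - \<tau>'\<bar> * V0)" .
  qed
  also have "\<dots> = ennreal (real CARD('n) * (\<kappa> * V0) * \<bar>\<tau> - \<tau>'\<bar>)"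
    using \<kappa>_ge_1 V0_nonneg by (simp add: ennreal_of_nat_eq_real_of_nat ennreal_mult'[symmetric] mult_ac)
  finally show ?thesis .
qed

text \<open>
  Regularity in time is regularity in the label of the characteristic, that is, in space.
\<close>

lemma fixed_point_time_L1:
  assumes b: "weights T b" and y: "state R y" and v: "\<And>t. variation_le (y t) V"
    and fp: "\<And>\<tau> x. y \<tau> x = Psi b y \<tau> x"
    and \<tau>: "\<tau> \<in> {0..T}" "\<tau>' \<in> {0..T}"
  shows "(\<integral>\<^sup>+x. ennreal (norm (y \<tau> x - y \<tau>' x)) \<partial>lborel) \<le> ennreal (C_time * \<bar>\<tau> - \<tau>'\<bar>)"
proof -
  let ?F = "source_term b y"
  note F = source_facts(1,3)[OF b y]
  have [measurable]: "leg ?F k t \<in> borel_measurable borel" for k t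
    by (rule jointly_borel_space[OF jointly_borel_leg[OF F(1)]])
  have leg_diff: "(\<integral>\<^sup>+x\<in>{0..L}. ennreal \<bar>leg ?F k \<tau> (c - \<tau> + \<theta> i x) - leg ?F k \<tau>' (c - \<tau>' + \<theta> i x)\<bar> \<partial>lborel)
      \<le> ennreal ((L * ((real CARD('m) * K) * R) + \<kappa> * ((real CARD('m) * K) * V)) * \<bar>\<tau> - \<tau>'\<bar>)" for k c i
  proof -
    have "(\<integral>\<^sup>+x\<in>{0..L}. ennreal \<bar>leg ?F k \<tau> (c - \<tau> + \<theta> i x) - leg ?F k \<tau>' (c - \<tau>' + \<theta> i x)\<bar> \<partial>lborel)
       \<le> (\<integral>\<^sup>+x. ennreal ((real CARD('m) * K) * R * \<bar>\<tau> - \<tau>'\<bar>) * indicator {0..L} x +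
             ennreal \<bar>leg ?F k \<tau>' ((c - \<tau>) + \<theta> i x) - leg ?F k \<tau>' ((c - \<tau>') + \<theta> i x)\<bar> \<partial>lborel)"
    proof (rule nn_integral_mono)
      fix x
      have "\<bar>leg ?F k \<tau> (c - \<tau> + \<theta> i x) - leg ?F k \<tau>' (c - \<tau>' + \<theta> i x)\<bar>
         \<le> (real CARD('m) * K) * R * \<bar>\<tau> - \<tau>'\<bar> + \<bar>leg ?F k \<tau>' ((c - \<tau>) + \<theta> i x) - leg ?F k \<tau>' ((c - \<tau>') + \<theta> i x)\<bar>"
        using leg_time_diff[OF F, of \<tau> \<tau>' k "c - \<tau> + \<theta> i x"] \<tau> by auto
      then have "ennreal \<bar>leg ?F k \<tau> (c - \<tau> + \<theta> i x) - leg ?F k \<tau>' (c - \<tau>' + \<theta> i x)\<bar>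
         \<le> ennreal ((real CARD('m) * K) * R * \<bar>\<tau> - \<tau>'\<bar>) + ennreal \<bar>leg ?F k \<tau>' ((c - \<tau>) + \<theta> i x) - leg ?F k \<tau>' ((c - \<tau>') + \<theta> i x)\<bar>"
        using K_nonneg by (simp add: ennreal_plus[symmetric] ennreal_leI del: ennreal_plus)
      then show "ennreal \<bar>leg ?F k \<tau> (c - \<tau> + \<theta> i x) - leg ?F k \<tau>' (c - \<tau>' + \<theta> i x)\<bar> * indicator {0..L} x
         \<le> ennreal ((real CARD('m) * K) * R * \<bar>\<tau> - \<tau>'\<bar>) * indicator {0..L} x + ennreal \<bar>leg ?F k \<tau>' ((c - \<tau>) + \<theta> i x) - leg ?F k \<tau>' ((c - \<tau>') + \<theta> i x)\<bar>"
        by (cases "x \<in> {0..L}") auto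
    qed
    also have "\<dots> = ennreal ((real CARD('m) * K) * R * \<bar>\<tau> - \<tau>'\<bar>) * ennreal L +
        (\<integral>\<^sup>+x. ennreal \<bar>leg ?F k \<tau>' ((c - \<tau>) + \<theta> i x) - leg ?F k \<tau>' ((c - \<tau>') + \<theta> i x)\<bar> \<partial>lborel)"
      using L_nonneg by (subst nn_integral_add) (auto simp: nn_integral_cmult)
    also have "\<dots> \<le> ennreal ((real CARD('m) * K) * R * \<bar>\<tau> - \<tau>'\<bar>) * ennreal L + ennreal (\<tau>' * (\<kappa> * (\<bar>(c - \<tau>) - (c - \<tau>')\<bar> * ((real CARD('m) * K) * V))))"
      by (intro add_left_mono leg_shift_diff_L1[OF F source_variation[OF b y v]]) (use \<tau> in auto)
    also have "\<dots> \<le> ennreal ((real CARD('m) * K) * R * \<bar>\<tau> - \<tau>'\<bar>) * ennreal L + ennreal (1 * (\<kappa> * (\<bar>\<tau> - \<tau>'\<bar> * ((real CARD('m) * K) * V))))"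
      using \<tau> T \<kappa>_ge_1 K_nonneg V_nonneg
      by (intro add_left_mono ennreal_leI mult_mono) (auto simp: abs_minus_commute)
    also have "\<dots> = ennreal ((L * ((real CARD('m) * K) * R) + \<kappa> * ((real CARD('m) * K) * V)) * \<bar>\<tau> - \<tau>'\<bar>)"
      using L_nonneg \<kappa>_ge_1 K_nonneg V_nonneg
      by (simp add: ennreal_mult'[symmetric] ennreal_plus[symmetric] algebra_simps del: ennreal_plus)
    finally show ?thesis .
  qed
  have prop_diff: "propagate ?F \<tau> x - propagate ?F \<tau>' x = (\<chi> i. (leg ?F i \<tau> (- \<tau> + \<theta> i x) - leg ?F i \<tau>' (- \<tau>' + \<theta> i x)) +
      (\<Sum>k\<in>UNIV. G $ i $ k * (leg ?F k \<tau> (\<Theta> k - \<tau> + \<theta> i x) - leg ?F k \<tau>' (\<Theta> k - \<tau>' + \<theta> i x))))" for x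
    by (simp add: propagate_def vec_eq_iff algebra_simps sum_subtractf)
  have prop_L1: "(\<integral>\<^sup>+x\<in>{0..L}. ennreal (norm (propagate ?F \<tau> x - propagate ?F \<tau>' x)) \<partial>lborel)
     \<le> ennreal \<Gamma> * ennreal ((L * ((real CARD('m) * K) * R) + \<kappa> * ((real CARD('m) * K) * V)) * \<bar>\<tau> - \<tau>'\<bar>)"
    unfolding prop_diff
    by (rule nn_integral_norm_mix_bound) (use leg_diff[of _ 0] leg_diff in simp_all)
  have [measurable]: "propagate ?F t \<in> borel_measurable borel" for t
    by (rule jointly_borel_space[OF jointly_borel_propagate[OF F(1)]])
  have [measurable]: "base t \<in> borel_measurable borel" for t by (rule jointly_borel_space[OF jointly_borel_base])
  have "(\<integral>\<^sup>+x. ennreal (norm (y \<tau> x - y \<tau>' x)) \<partial>lborel)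
     \<le> (\<integral>\<^sup>+x. ennreal (norm (base \<tau> x - base \<tau>' x)) + ennreal (norm (propagate ?F \<tau> x - propagate ?F \<tau>' x)) * indicator {0..L} x \<partial>lborel)"
  proof (rule nn_integral_mono)
    fix x
    have "y \<tau> x - y \<tau>' x = indicat_real {0..L} x *\<^sub>R ((base \<tau> x - base \<tau>' x) + (propagate ?F \<tau> x - propagate ?F \<tau>' x))"
      by (subst (1 2) fp) (simp add: Psi_def algebra_simps)
    then show "ennreal (norm (y \<tau> x - y \<tau>' x)) \<le> ennreal (norm (base \<tau> x - base \<tau>' x)) + ennreal (norm (propagate ?F \<tau> x - propagate ?F \<tau>' x)) * indicator {0..L} x"
      by (auto simp: indicator_def ennreal_plus[symmetric] norm_triangle_ineq simp del: ennreal_plus intro!: ennreal_leI)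
  qed
  also have "\<dots> = (\<integral>\<^sup>+x. ennreal (norm (base \<tau> x - base \<tau>' x)) \<partial>lborel) + (\<integral>\<^sup>+x\<in>{0..L}. ennreal (norm (propagate ?F \<tau> x - propagate ?F \<tau>' x)) \<partial>lborel)"
    by (rule nn_integral_add) measurable
  also have "\<dots> \<le> ennreal (real CARD('n) * (\<kappa> * V0) * \<bar>\<tau> - \<tau>'\<bar>) + ennreal \<Gamma> * ennreal ((L * ((real CARD('m) * K) * R) + \<kappa> * ((real CARD('m) * K) * V)) * \<bar>\<tau> - \<tau>'\<bar>)"
    by (intro add_mono base_time_L1 prop_L1)
  also have "\<dots> = ennreal (C_time * \<bar>\<tau> - \<tau>'\<bar>)"
    using \<kappa>_ge_1 V0_nonneg \<Gamma>_nonneg L_nonneg K_nonneg V_nonneg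
    by (simp add: C_time_def ennreal_mult'[symmetric] ennreal_plus[symmetric] algebra_simps del: ennreal_plus)
  finally show ?thesis .
qed

end


section \<open>Stability under oscillating weights\<close>

context small_time_transport
begin

definition C_lip :: real where
  "C_lip = K * V + \<kappa> * (K * (L + C_time))"

lemma C_lip_nonneg: "0 \<le> C_lip"
  unfolding C_lip_def using K_nonneg V_nonneg \<kappa>_ge_1 L_nonneg C_time_nonneg by simp

text \<open>
  Moving from \<open>t\<close> to \<open>t'\<close>, first the point moves along the
  characteristic at a fixed time, which costs the variation in space, and then time moves at a
  fixed point.
\<close>

lemma source_along_leg_Lipschitz:
  assumes b: "weights T b" and y: "state R y" and v: "\<And>t. variation_le (y t) V"
    and fp: "\<And>\<tau> x. y \<tau> x = Psi b y \<tau> x"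
    and t: "t \<in> {0..T}" "t' \<in> {0..T}"
  shows "(\<integral>\<^sup>+z. ennreal \<bar>h j t (y t (X k (z + t))) $ k - h j t' (y t' (X k (z + t'))) $ k\<bar> \<partial>lborel) \<le> ennreal (C_lip * \<bar>t - t'\<bar>)"
proof -
  let ?g = "\<lambda>t x. h j t (y t x)"
  have g: "jointly_borel ?g" by (rule jointly_borel_h[OF stateD(1)[OF y]])
  have [measurable]: "?g s \<in> borel_measurable borel" "y s \<in> borel_measurable borel" for s
    using jointly_borel_space[OF g, of s] jointly_borel_space[OF stateD(1)[OF y]] by auto
  have sp: "(\<integral>\<^sup>+z. ennreal (norm (?g t (X k (z + t)) - ?g t (X k (z + t')))) \<partial>lborel) \<le> ennreal (\<bar>t - t'\<bar> * (K * V))"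
  proof (rule nn_integral_translation_le_variation[where g = "\<lambda>z. ?g t (X k z)"])
    have "variation_le (?g t) (K * V)"
      by (rule variation_le_Lipschitz[OF v[of t] _ K_nonneg(1)]) (intro source_LipschitzD(3)[OF K] stateD(2)[OF y])
    then show "variation_le (\<lambda>z. ?g t (X k z)) (K * V)" by (rule variation_le_X)
  qed simp
  have "(\<integral>\<^sup>+z. ennreal (norm (?g t (X k (t' + z)) - ?g t' (X k (t' + z)))) \<partial>lborel) \<le> ennreal \<kappa> * (\<integral>\<^sup>+x. ennreal (norm (?g t x - ?g t' x)) \<partial>lborel)"
    by (rule X_transport_shift) simp
  also have "\<dots> \<le> ennreal \<kappa> * (\<integral>\<^sup>+x. ennreal (K * \<bar>t - t'\<bar>) * indicator {0..L} x + ennreal K * ennreal (norm (y t x - y t' x)) \<partial>lborel)"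
  proof (intro mult_left_mono nn_integral_mono)
    fix x
    show "ennreal (norm (?g t x - ?g t' x)) \<le> ennreal (K * \<bar>t - t'\<bar>) * indicator {0..L} x + ennreal K * ennreal (norm (y t x - y t' x))"
    proof (cases "x \<in> {0..L}")
      case True
      have "norm (?g t x - ?g t' x) \<le> K * \<bar>t - t'\<bar> + K * norm (y t x - y t' x)"
        using source_LipschitzD(4)[OF K stateD(2)[OF y] stateD(2)[OF y], of j t t x t' t' x] by (simp add: distrib_left)
      then show ?thesis using True K_nonneg
        by (simp add: ennreal_mult'[symmetric] ennreal_plus[symmetric] ennreal_leI del: ennreal_plus)
    next
      case False
      then show ?thesis using stateD(3)[OF y False] by (simp add: h_zero)
    qed
  qed simp
  also have "\<dots> = ennreal \<kappa> * (ennreal (K * \<bar>t - t'\<bar>) * ennreal L + ennreal K * (\<integral>\<^sup>+x. ennreal (norm (y t x - y t' x)) \<partial>lborel))"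
    using L_nonneg by (subst nn_integral_add) (auto simp: nn_integral_cmult)
  also have "\<dots> \<le> ennreal \<kappa> * (ennreal (K * \<bar>t - t'\<bar>) * ennreal L + ennreal K * ennreal (C_time * \<bar>t - t'\<bar>))"
    by (intro mult_left_mono add_left_mono fixed_point_time_L1[OF b y v fp t]) auto
  also have "\<dots> = ennreal (\<kappa> * (K * (L + C_time)) * \<bar>t - t'\<bar>)"
    using \<kappa>_ge_1 K_nonneg L_nonneg C_time_nonneg
    by (simp add: ennreal_mult'[symmetric] ennreal_plus[symmetric] algebra_simps del: ennreal_plus)
  finally have tm: "(\<integral>\<^sup>+z. ennreal (norm (?g t (X k (t' + z)) - ?g t' (X k (t' + z)))) \<partial>lborel) \<le> ennreal (\<kappa> * (K * (L + C_time)) * \<bar>t - t'\<bar>)" .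
  have "(\<integral>\<^sup>+z. ennreal \<bar>h j t (y t (X k (z + t))) $ k - h j t' (y t' (X k (z + t'))) $ k\<bar> \<partial>lborel)
     \<le> (\<integral>\<^sup>+z. ennreal (norm (?g t (X k (z + t)) - ?g t (X k (z + t')))) + ennreal (norm (?g t (X k (t' + z)) - ?g t' (X k (t' + z)))) \<partial>lborel)"
  proof (rule nn_integral_mono)
    fix z
    have "\<bar>?g t (X k (z + t)) $ k - ?g t' (X k (z + t')) $ k\<bar> \<le> norm (?g t (X k (z + t)) - ?g t' (X k (z + t')))"
      unfolding vector_minus_component[symmetric] by (rule component_le_norm_cart)
    also have "\<dots> \<le> norm (?g t (X k (z + t)) - ?g t (X k (z + t'))) + norm (?g t (X k (t' + z)) - ?g t' (X k (t' + z)))"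
      using norm_triangle_ineq[of "?g t (X k (z + t)) - ?g t (X k (z + t'))" "?g t (X k (z + t')) - ?g t' (X k (z + t'))"]
      by (simp add: add.commute)
    finally show "ennreal \<bar>?g t (X k (z + t)) $ k - ?g t' (X k (z + t')) $ k\<bar> \<le>
       ennreal (norm (?g t (X k (z + t)) - ?g t (X k (z + t')))) + ennreal (norm (?g t (X k (t' + z)) - ?g t' (X k (t' + z))))"
      by (simp add: ennreal_plus[symmetric] ennreal_leI del: ennreal_plus)
  qed
  also have "\<dots> = (\<integral>\<^sup>+z. ennreal (norm (?g t (X k (z + t)) - ?g t (X k (z + t')))) \<partial>lborel) + (\<integral>\<^sup>+z. ennreal (norm (?g t (X k (t' + z)) - ?g t' (X k (t' + z)))) \<partial>lborel)"
    by (rule nn_integral_add) measurable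
  also have "\<dots> \<le> ennreal (\<bar>t - t'\<bar> * (K * V)) + ennreal (\<kappa> * (K * (L + C_time)) * \<bar>t - t'\<bar>)"
    by (intro add_mono sp tm)
  also have "\<dots> = ennreal (C_lip * \<bar>t - t'\<bar>)"
    using \<kappa>_ge_1 K_nonneg L_nonneg C_time_nonneg V_nonneg
    by (simp add: C_lip_def ennreal_plus[symmetric] algebra_simps del: ennreal_plus)
  finally show ?thesis .
qed

text \<open>
  The factor \<open>2\<close> pays for absorbing the Lipschitz part of the source into the
  left-hand side.
\<close>

definition C_stab :: real where
  "C_stab = 2 * (\<Gamma> * (real CARD('m) * (\<kappa> * (\<kappa> * (K * R * L) + C_lip))))"

lemma C_stab_nonneg: "0 \<le> C_stab"
  unfolding C_stab_def using \<Gamma>_nonneg \<kappa>_ge_1 K_nonneg L_nonneg C_lip_nonneg by simp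

text \<open>
  After passing from the end point \<open>x\<close> to the label of the characteristic, the
  integrand is sampled at the same labels for all times, which is the situation of
  \<open>oscillation_L1_bound\<close>.
\<close>

lemma oscillating_leg_L1:
  assumes b: "weights T b" and y: "state R y" and v: "\<And>t. variation_le (y t) V"
    and fp: "\<And>\<tau> x. y \<tau> x = Psi b y \<tau> x"
    and \<beta>[measurable]: "\<beta> \<in> borel_measurable borel" and \<beta>_le: "\<And>t. \<bar>\<beta> t\<bar> \<le> 1"
    and prim: "\<And>t. t \<in> {0..T} \<Longrightarrow> \<bar>LINT s:{0..t}|lborel. \<beta> s\<bar> \<le> \<epsilon>" and \<epsilon>: "0 \<le> \<epsilon>"
    and \<tau>: "\<tau> \<in> {0..T}"
  shows "(\<integral>\<^sup>+x. ennreal \<bar>leg (\<lambda>t x. \<beta> t *\<^sub>R h j t (y t x)) k \<tau> (c + \<theta> i x)\<bar> \<partial>lborel) \<le> ennreal (\<epsilon> * (\<kappa> * (\<kappa> * (K * R * L) + C_lip)))"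
proof -
  let ?g = "\<lambda>t x. h j t (y t x)"
  let ?q = "\<lambda>t z. ?g t (X k (z + t)) $ k"
  have g: "jointly_borel ?g" by (rule jointly_borel_h[OF stateD(1)[OF y]])
  have [measurable]: "?g s \<in> borel_measurable borel" for s using jointly_borel_space[OF g, of s] .
  have gb: "norm (?g t x) \<le> K * R" for t x
    using source_LipschitzD(5)[OF K stateD(2)[OF y]] mult_left_mono[OF stateD(2)[OF y] K_nonneg(1)] by (rule order_trans)
  have \<beta>g: "jointly_borel (\<lambda>t x. \<beta> t *\<^sub>R ?g t x)"
    using g by (auto simp: jointly_borel_def)
  have [measurable]: "(\<lambda>p. ?g (fst p) (X k (snd p + fst p))) \<in> borel_measurable (borel \<Otimes>\<^sub>M borel)"
    by (rule jointly_borel_compose[OF g]) auto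
  have osc: "(\<integral>\<^sup>+z. ennreal \<bar>LINT t:{0..\<tau>}|lborel. \<beta> t * ?q t z\<bar> \<partial>lborel) \<le> ennreal (\<epsilon> * (\<kappa> * (K * R * L) + C_lip * \<tau>))"
  proof (rule oscillation_L1_bound[where Q = "K * R"])
    have "(\<lambda>p. ?q (fst p) (snd p)) \<in> borel_measurable (borel \<Otimes>\<^sub>M borel)" by measurable
    then show "(\<lambda>(t, z). ?q t z) \<in> borel_measurable borel" by (simp add: borel_prod split_beta')
    show "\<bar>?q t z\<bar> \<le> K * R" for t z by (rule norm_bound_component_le_cart[OF gb])
    show "(\<integral>\<^sup>+z. ennreal \<bar>?q t z - ?q t' z\<bar> \<partial>lborel) \<le> ennreal (C_lip * \<bar>t - t'\<bar>)"
      if "t \<in> {0..\<tau>}" "t' \<in> {0..\<tau>}" for t t'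
      by (rule source_along_leg_Lipschitz[OF b y v fp]) (use that \<tau> in auto)
    show "(\<integral>\<^sup>+z. ennreal \<bar>?q t z\<bar> \<partial>lborel) \<le> ennreal (\<kappa> * (K * R * L))" if "t \<in> {0..\<tau>}" for t
    proof -
      have "(\<integral>\<^sup>+z. ennreal \<bar>?g t (X k (t + z)) $ k\<bar> \<partial>lborel) \<le> ennreal \<kappa> * (\<integral>\<^sup>+x. ennreal \<bar>?g t x $ k\<bar> \<partial>lborel)"
        by (rule X_transport_shift) measurable
      also have "\<dots> \<le> ennreal \<kappa> * (\<integral>\<^sup>+x. ennreal (K * R) * indicator {0..L} x \<partial>lborel)"
      proof (intro mult_left_mono nn_integral_mono)
        fix x show "ennreal \<bar>?g t x $ k\<bar> \<le> ennreal (K * R) * indicator {0..L} x"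
          using norm_bound_component_le_cart[OF gb[of t x], of k] stateD(3)[OF y, of x t]
          by (cases "x \<in> {0..L}") (auto simp: h_zero intro!: ennreal_leI)
      qed simp
      also have "\<dots> = ennreal (\<kappa> * (K * R * L))"
        using L_nonneg K_nonneg \<kappa>_ge_1 by (subst nn_integral_cmult) (auto simp: ennreal_mult'[symmetric])
      finally show ?thesis by (simp add: add.commute)
    qed
  qed (use \<beta>_le prim \<epsilon> \<tau> C_lip_nonneg K_nonneg \<kappa>_ge_1 L_nonneg in auto)
  have [measurable]: "leg (\<lambda>t x. \<beta> t *\<^sub>R ?g t x) k \<tau> \<in> borel_measurable borel"
    by (rule jointly_borel_space[OF jointly_borel_leg[OF \<beta>g]])
  have "(\<integral>\<^sup>+x. ennreal \<bar>leg (\<lambda>t x. \<beta> t *\<^sub>R ?g t x) k \<tau> (c + \<theta> i x)\<bar> \<partial>lborel)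
     \<le> ennreal \<kappa> * (\<integral>\<^sup>+z. ennreal \<bar>leg (\<lambda>t x. \<beta> t *\<^sub>R ?g t x) k \<tau> z\<bar> \<partial>lborel)"
    by (rule \<theta>_transport_shift) measurable
  also have "(\<integral>\<^sup>+z. ennreal \<bar>leg (\<lambda>t x. \<beta> t *\<^sub>R ?g t x) k \<tau> z\<bar> \<partial>lborel) = (\<integral>\<^sup>+z. ennreal \<bar>LINT t:{0..\<tau>}|lborel. \<beta> t * ?q t z\<bar> \<partial>lborel)"
    by (simp add: leg_def)
  also have "ennreal \<kappa> * \<dots> \<le> ennreal \<kappa> * ennreal (\<epsilon> * (\<kappa> * (K * R * L) + C_lip * \<tau>))"
    by (intro mult_left_mono osc) simp
  also have "\<dots> \<le> ennreal \<kappa> * ennreal (\<epsilon> * (\<kappa> * (K * R * L) + C_lip * 1))"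
    using \<epsilon> \<tau> T C_lip_nonneg by (intro mult_left_mono ennreal_leI add_left_mono) auto
  also have "\<dots> = ennreal (\<epsilon> * (\<kappa> * (\<kappa> * (K * R * L) + C_lip)))"
    using \<epsilon> \<kappa>_ge_1 K_nonneg L_nonneg C_lip_nonneg by (simp add: ennreal_mult'[symmetric] mult_ac)
  finally show ?thesis .
qed

lemma Psi_weights_L1:
  assumes b: "weights T b" "\<And>t j. 0 \<le> b t $ j" and b': "weights T b'" "\<And>t j. 0 \<le> b' t $ j"
    and y: "state R y" and v: "\<And>t. variation_le (y t) V" and fp: "\<And>\<tau> x. y \<tau> x = Psi b y \<tau> x"
    and prim: "\<And>t j. t \<in> {0..T} \<Longrightarrow> \<bar>LINT s:{0..t}|lborel. b s $ j - b' s $ j\<bar> \<le> \<epsilon>" and \<epsilon>: "0 \<le> \<epsilon>"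
    and \<tau>: "\<tau> \<in> {0..T}"
  shows "(\<integral>\<^sup>+x. ennreal (norm (Psi b y \<tau> x - Psi b' y \<tau> x)) \<partial>lborel) \<le> ennreal (C_stab / 2 * \<epsilon>)"
proof -
  let ?A = "real CARD('m) * (\<epsilon> * (\<kappa> * (\<kappa> * (K * R * L) + C_lip)))"
  have A0: "0 \<le> ?A" using \<epsilon> \<kappa>_ge_1 K_nonneg L_nonneg C_lip_nonneg by simp
  let ?E = "\<lambda>t x. source_term b y t x - source_term b' y t x"
  have [measurable]: "b \<in> borel_measurable borel" "b' \<in> borel_measurable borel"
    using weightsD(1) b(1) b'(1) by auto
  have b_diff: "\<bar>b t $ j - b' t $ j\<bar> \<le> 1" for t j
    using weightsD(3)[OF b(1), of t j] weightsD(3)[OF b'(1), of t j] b(2)[of t j] b'(2)[of t j] by linarith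
  have gb: "norm (h j t (y t x)) \<le> K * R" for j t x
    using source_LipschitzD(5)[OF K stateD(2)[OF y]] mult_left_mono[OF stateD(2)[OF y] K_nonneg(1)] by (rule order_trans)
  have Ej: "jointly_borel (\<lambda>t x. (b t $ j - b' t $ j) *\<^sub>R h j t (y t x))" for j
    using jointly_borel_h[OF stateD(1)[OF y]] by (auto simp: jointly_borel_def)
  have Ej': "norm ((b t $ j - b' t $ j) *\<^sub>R h j t (y t x)) \<le> 1 * (K * R)" for j t x
    unfolding norm_scaleR using b_diff gb by (intro mult_mono) auto
  have E_eq: "?E = (\<lambda>t x. \<Sum>j\<in>UNIV. (b t $ j - b' t $ j) *\<^sub>R h j t (y t x))"
    by (simp add: source_term_def sum_subtractf scaleR_diff_left fun_eq_iff)
  have E: "jointly_borel ?E"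
    using source_facts(1)[OF b(1) y] source_facts(1)[OF b'(1) y] by (auto simp: jointly_borel_def)
  have [measurable]: "leg (\<lambda>t x. (b t $ j - b' t $ j) *\<^sub>R h j t (y t x)) k \<tau> \<in> borel_measurable borel" for j k
    by (rule jointly_borel_space[OF jointly_borel_leg[OF Ej]])
  have [measurable]: "leg ?E k \<tau> \<in> borel_measurable borel" for k
    by (rule jointly_borel_space[OF jointly_borel_leg[OF E]])
  have leg_E: "(\<integral>\<^sup>+x. ennreal \<bar>leg ?E k \<tau> (c + \<theta> i x)\<bar> \<partial>lborel) \<le> ennreal ?A" for k c i
  proof -
    have "(\<integral>\<^sup>+x. ennreal \<bar>leg ?E k \<tau> (c + \<theta> i x)\<bar> \<partial>lborel)
       \<le> (\<integral>\<^sup>+x. (\<Sum>j\<in>UNIV. ennreal \<bar>leg (\<lambda>t x. (b t $ j - b' t $ j) *\<^sub>R h j t (y t x)) k \<tau> (c + \<theta> i x)\<bar>) \<partial>lborel)"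
      unfolding E_eq leg_sum[OF finite_class.finite_UNIV Ej Ej'] by (intro nn_integral_mono) (simp add: ennreal_leI sum_abs)
    also have "\<dots> = (\<Sum>j\<in>UNIV. \<integral>\<^sup>+x. ennreal \<bar>leg (\<lambda>t x. (b t $ j - b' t $ j) *\<^sub>R h j t (y t x)) k \<tau> (c + \<theta> i x)\<bar> \<partial>lborel)"
      by (rule nn_integral_sum) measurable
    also have "\<dots> \<le> (\<Sum>j\<in>(UNIV::'m set). ennreal (\<epsilon> * (\<kappa> * (\<kappa> * (K * R * L) + C_lip))))"
      by (intro sum_mono oscillating_leg_L1[OF b(1) y v fp]) (use b_diff prim \<epsilon> \<tau> in auto)
    also have "\<dots> = ennreal ?A" by (simp add: ennreal_of_nat_eq_real_of_nat ennreal_mult')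
    finally show ?thesis .
  qed
  have "(\<integral>\<^sup>+x\<in>UNIV. ennreal (norm (propagate ?E \<tau> x)) \<partial>lborel) \<le> ennreal \<Gamma> * ennreal ?A"
    unfolding propagate_def
    by (rule nn_integral_norm_mix_bound) (use leg_E leg_E[of _ "- \<tau>"] in simp_all)
  then have E_L1: "(\<integral>\<^sup>+x. ennreal (norm (propagate ?E \<tau> x)) \<partial>lborel) \<le> ennreal \<Gamma> * ennreal ?A" by simp
  have "(\<integral>\<^sup>+x. ennreal (norm (Psi b y \<tau> x - Psi b' y \<tau> x)) \<partial>lborel) \<le> (\<integral>\<^sup>+x. ennreal (norm (propagate ?E \<tau> x)) \<partial>lborel)"
  proof (rule nn_integral_mono)
    fix x
    have "Psi b y \<tau> x - Psi b' y \<tau> x = indicat_real {0..L} x *\<^sub>R propagate ?E \<tau> x"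
      unfolding Psi_def propagate_diff[OF source_facts(1,3)[OF b(1) y] source_facts(1,3)[OF b'(1) y], symmetric]
      by (simp add: algebra_simps)
    then show "ennreal (norm (Psi b y \<tau> x - Psi b' y \<tau> x)) \<le> ennreal (norm (propagate ?E \<tau> x))"
      by (auto simp: indicator_def)
  qed
  also note E_L1
  also have "ennreal \<Gamma> * ennreal ?A = ennreal (C_stab / 2 * \<epsilon>)"
  proof -
    have "C_stab / 2 * \<epsilon> = \<Gamma> * ?A" unfolding C_stab_def by simp
    then show ?thesis using \<Gamma>_nonneg A0 by (simp only: ennreal_mult)
  qed
  finally show ?thesis .
qed

text \<open>
  \<open>Psi b y - Psi b' y'\<close> is split at \<open>Psi b' y\<close>: only the weights change
  in the first difference, and the contraction property applies to the second.
\<close>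

theorem stability:
  assumes b: "weights T b" "\<And>t j. 0 \<le> b t $ j" and b': "weights T b'" "\<And>t j. 0 \<le> b' t $ j"
    and y: "state R y" and v: "\<And>t. variation_le (y t) V" and fp: "\<And>\<tau> x. y \<tau> x = Psi b y \<tau> x"
    and y': "state R y'" and fp': "\<And>\<tau> x. y' \<tau> x = Psi b' y' \<tau> x"
    and prim: "\<And>t j. t \<in> {0..T} \<Longrightarrow> \<bar>LINT s:{0..t}|lborel. b s $ j - b' s $ j\<bar> \<le> \<epsilon>" and \<epsilon>: "0 \<le> \<epsilon>"
    and \<tau>: "\<tau> \<in> {0..T}"
  shows "(\<integral>\<^sup>+x. ennreal (norm (y \<tau> x - y' \<tau> x)) \<partial>lborel) \<le> ennreal (C_stab * \<epsilon>)"
proof -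
  let ?w = "\<lambda>t. (\<integral>\<^sup>+x. ennreal (norm (y t x - y' t x)) \<partial>lborel)"
  define S where "S = (SUP t\<in>{0..T}. ?w t)"
  have "S \<le> ennreal (2 * R * L)"
    unfolding S_def by (intro SUP_least state_L1_diff_le[OF y y'] K_nonneg)
  then have "S < top" using ennreal_less_top le_less_trans by blast
  then obtain s where s: "0 \<le> s" "S = ennreal s" by (cases S) auto
  have Psi_m: "Psi b y t \<in> borel_measurable borel" "Psi b' y t \<in> borel_measurable borel" "Psi b' y' t \<in> borel_measurable borel" for t
    using jointly_borel_space[OF jointly_borel_Psi[OF stateD(1)[OF y] weightsD(1)[OF b(1)]]]
      jointly_borel_space[OF jointly_borel_Psi[OF stateD(1)[OF y] weightsD(1)[OF b'(1)]]]
      jointly_borel_space[OF jointly_borel_Psi[OF stateD(1)[OF y'] weightsD(1)[OF b'(1)]]] by auto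
  note [measurable] = Psi_m
  let ?c = "\<Gamma> * \<kappa>\<^sup>2 * (real CARD('m) * K)"
  have c0: "0 \<le> ?c" using \<Gamma>_nonneg K_nonneg by simp
  have "?w t \<le> ennreal (C_stab / 2 * \<epsilon> + s / 2)" if t: "t \<in> {0..T}" for t
  proof -
    have "?w t \<le> (\<integral>\<^sup>+x. ennreal (norm (Psi b y t x - Psi b' y t x)) + ennreal (norm (Psi b' y t x - Psi b' y' t x)) \<partial>lborel)"
    proof (rule nn_integral_mono)
      fix x
      have "norm (y t x - y' t x) \<le> norm (Psi b y t x - Psi b' y t x) + norm (Psi b' y t x - Psi b' y' t x)"
        using norm_triangle_ineq[of "Psi b y t x - Psi b' y t x" "Psi b' y t x - Psi b' y' t x"]
        by (subst fp, subst fp') simp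
      then show "ennreal (norm (y t x - y' t x)) \<le> ennreal (norm (Psi b y t x - Psi b' y t x)) + ennreal (norm (Psi b' y t x - Psi b' y' t x))"
        by (simp add: ennreal_plus[symmetric] ennreal_leI del: ennreal_plus)
    qed
    also have "\<dots> = (\<integral>\<^sup>+x. ennreal (norm (Psi b y t x - Psi b' y t x)) \<partial>lborel) + (\<integral>\<^sup>+x. ennreal (norm (Psi b' y t x - Psi b' y' t x)) \<partial>lborel)"
      by (rule nn_integral_add) measurable
    also have "\<dots> \<le> ennreal (C_stab / 2 * \<epsilon>) + ennreal ?c * (\<integral>\<^sup>+t\<in>{0..t}. ?w t \<partial>lborel)"
      by (intro add_mono Psi_weights_L1[OF b b' y v fp prim \<epsilon> t] Psi_diff_L1[OF K b'(1) y y'])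
    also have "\<dots> \<le> ennreal (C_stab / 2 * \<epsilon>) + ennreal ?c * (\<integral>\<^sup>+u. ennreal s * indicator {0..T} u \<partial>lborel)"
    proof (intro add_left_mono mult_left_mono nn_integral_mono)
      fix u
      have "u \<in> {0..T} \<Longrightarrow> ?w u \<le> ennreal s" unfolding s(2)[symmetric] S_def by (rule SUP_upper)
      then show "?w u * indicator {0..t} u \<le> ennreal s * indicator {0..T} u"
        using t by (cases "u \<in> {0..t}") auto
    qed auto
    also have "\<dots> = ennreal (C_stab / 2 * \<epsilon>) + ennreal ?c * ennreal (s * T)"
      using T s by (subst nn_integral_cmult) (auto simp: ennreal_mult')
    also have "\<dots> = ennreal (C_stab / 2 * \<epsilon> + ?c * (s * T))"
      using c0 s T \<epsilon> C_stab_nonneg by (simp add: ennreal_mult[symmetric] ennreal_plus[symmetric] del: ennreal_plus)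
    also have "\<dots> \<le> ennreal (C_stab / 2 * \<epsilon> + s / 2)"
      using mult_right_mono[OF small s(1)] by (intro ennreal_leI) (simp add: mult_ac)
    finally show ?thesis .
  qed
  then have "S \<le> ennreal (C_stab / 2 * \<epsilon> + s / 2)" unfolding S_def by (rule SUP_least)
  then have "s \<le> C_stab / 2 * \<epsilon> + s / 2"
    unfolding s(2) using s(1) \<epsilon> C_stab_nonneg by (subst (asm) ennreal_le_iff) auto
  then have "S \<le> ennreal (C_stab * \<epsilon>)" unfolding s(2) by (intro ennreal_leI) simp
  moreover have "?w \<tau> \<le> S" unfolding S_def by (rule SUP_upper[OF \<tau>])
  ultimately show ?thesis by (rule order_trans[rotated])
qed

end


section \<open>Characteristic coordinates\<close>

text \<open>
  A slope bounded below by a positive constant gives growth at least linear, hence surjectivity.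
\<close>

lemma real_diffeomorphism_pos:
  fixes \<phi> \<phi>' :: "real \<Rightarrow> real"
  assumes der: "\<And>x. (\<phi> has_real_derivative \<phi>' x) (at x)" and c: "0 < c" "\<And>x. c \<le> \<phi>' x"
  shows "bij \<phi>" "mono \<phi>" "mono (inv \<phi>)"
proof -
  have pos: "0 < \<phi>' x" for x using c less_le_trans by blast
  have growth: "c * (y - x) \<le> \<phi> y - \<phi> x" if "x \<le> y" for x y
  proof -
    have "\<phi> x - c * x \<le> \<phi> y - c * y"
    proof (rule DERIV_nonneg_imp_nondecreasing[OF that])
      fix u show "\<exists>d. ((\<lambda>x. \<phi> x - c * x) has_real_derivative d) (at u) \<and> 0 \<le> d"
        using c(2)[of u] by (intro exI[of _ "\<phi>' u - c"]) (auto intro!: derivative_eq_intros der)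
    qed
    then show ?thesis by (simp add: algebra_simps)
  qed
  have inc: "\<phi> x < \<phi> y" if "x < y" for x y
    using growth[of x y] that c(1) mult_pos_pos[of c "y - x"] by linarith
  have "inj \<phi>" by (rule injI) (metis inc less_irrefl linorder_neqE_linordered_idom)
  moreover have "surj \<phi>"
      unfolding surj_def
  proof
    fix z
    define b where "b = \<bar>z - \<phi> 0\<bar> / c"
    have b: "0 \<le> b" "c * b = \<bar>z - \<phi> 0\<bar>" using c(1) by (auto simp: b_def)
    have "\<exists>x. - b \<le> x \<and> x \<le> b \<and> \<phi> x = z"
    proof (rule IVT')
      show "\<phi> (- b) \<le> z" using growth[of "- b" 0] b by simp
      show "z \<le> \<phi> b" using growth[of 0 b] b by simp
      show "continuous_on {- b..b} \<phi>"
        using der by (intro continuous_at_imp_continuous_on) (auto intro: DERIV_isCont)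
    qed (use b in auto)
    then show "\<exists>x. z = \<phi> x" by blast
  qed
  ultimately show bij: "bij \<phi>" by (rule bijI)
  show "mono \<phi>" using inc by (metis less_imp_le mono_onI order_le_less)
  show "mono (inv \<phi>)"
  proof (rule monoI, rule ccontr)
    fix x y :: real assume xy: "x \<le> y" "\<not> inv \<phi> x \<le> inv \<phi> y"
    then have "\<phi> (inv \<phi> y) < \<phi> (inv \<phi> x)" using inc by simp
    then show False using xy bij by (simp add: bij_is_surj surj_f_inv_f)
  qed
qed

lemma real_diffeomorphism:
  fixes \<phi> \<phi>' :: "real \<Rightarrow> real"
  assumes der: "\<And>x. (\<phi> has_real_derivative \<phi>' x) (at x)" and c: "0 < c" "(\<forall>x. c \<le> \<phi>' x) \<or> (\<forall>x. \<phi>' x \<le> - c)"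
  shows "bij \<phi>" "mono \<phi> \<or> antimono \<phi>" "mono (inv \<phi>) \<or> antimono (inv \<phi>)"
    "(inv \<phi> has_real_derivative inverse (\<phi>' (inv \<phi> z))) (at z)"
proof -
  have *: "bij \<phi> \<and> (mono \<phi> \<or> antimono \<phi>) \<and> (mono (inv \<phi>) \<or> antimono (inv \<phi>))"
    using c(2)
  proof
    assume "\<forall>x. c \<le> \<phi>' x"
    then show ?thesis using real_diffeomorphism_pos[OF der c(1)] by simp
  next
    assume "\<forall>x. \<phi>' x \<le> - c"
    then have c': "c \<le> - \<phi>' x" for x by (simp add: le_minus_iff)
    have n: "bij (\<lambda>x. - \<phi> x)" "mono (\<lambda>x. - \<phi> x)" "mono (inv (\<lambda>x. - \<phi> x))"
      using real_diffeomorphism_pos[OF DERIV_minus[OF der] c(1) c'] by auto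
    have "bij (\<lambda>x. - (- \<phi> x))"
      using bij_comp[OF n(1), of uminus] bij_uminus[where 'a = real] by (simp add: comp_def)
    then have b: "bij \<phi>" by simp
    have a: "antimono \<phi>" using n(2) by (auto simp: mono_def antimono_def)
    have "antimono (inv \<phi>)"
    proof (rule antimonoI)
      fix x y :: real assume "x \<le> y"
      have eq: "inv (\<lambda>x. - \<phi> x) (- z) = inv \<phi> z" for z
        by (rule inv_f_eq[OF bij_is_inj[OF n(1)]]) (simp add: surj_f_inv_f[OF bij_is_surj[OF b]])
      have "inv (\<lambda>x. - \<phi> x) (- y) \<le> inv (\<lambda>x. - \<phi> x) (- x)" using monoD[OF n(3)] \<open>x \<le> y\<close> by simp
      then show "inv \<phi> y \<le> inv \<phi> x" unfolding eq .
    qed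
    with a b show ?thesis by simp
  qed
  then show b: "bij \<phi>" "mono \<phi> \<or> antimono \<phi>" "mono (inv \<phi>) \<or> antimono (inv \<phi>)" by auto
  have surj: "\<phi> (inv \<phi> y) = y" for y by (rule surj_f_inv_f[OF bij_is_surj[OF b(1)]])
  have "isCont (inv \<phi>) (\<phi> (inv \<phi> z))"
    by (rule isCont_inverse_function[where d = 1]) (use der bij_is_inj[OF b(1)] in \<open>auto intro: DERIV_isCont\<close>)
  moreover have "\<phi>' (inv \<phi> z) \<noteq> 0"
  proof
    assume "\<phi>' (inv \<phi> z) = 0"
    then show False using c by (auto dest!: spec[of _ "inv \<phi> z"])
  qed
  ultimately show "(inv \<phi> has_real_derivative inverse (\<phi>' (inv \<phi> z))) (at z)"
    by (intro DERIV_inverse_function[where f = \<phi> and a = "z - 1" and b = "z + 1"] der) (auto simp: surj)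
qed

text \<open>
  A single component. \<open>\<theta>\<close> is a primitive of \<open>1/lam\<close>, normalised
  to vanish at the inlet, so that it increases at unit rate along the characteristics for either
  sign of the speed.
\<close>

locale characteristic_coordinate =
  fixes L :: real and lam \<theta> X :: "real \<Rightarrow> real" and \<Theta> \<kappa> :: real and outlet :: real
  assumes \<theta>_X: "\<And>z. \<theta> (X z) = z" and X_\<theta>: "\<And>x. X (\<theta> x) = x"
    and range: "\<And>x. x \<in> {0..L} \<longleftrightarrow> \<theta> x \<in> {0..\<Theta>}"
    and \<Theta>_pos: "0 < \<Theta>" and outlet: "\<theta> outlet = \<Theta>"
    and lam_nz: "\<And>x. x \<in> {0..L} \<Longrightarrow> lam x \<noteq> 0"
    and \<theta>_deriv: "\<And>x. x \<in> {0..L} \<Longrightarrow> (\<theta> has_real_derivative inverse (lam x)) (at x)"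
    and X_deriv: "\<And>z. X z \<in> {0..L} \<Longrightarrow> (X has_real_derivative lam (X z)) (at z)"
    and cont: "continuous_on UNIV \<theta>" "continuous_on UNIV X"
    and monotone: "mono \<theta> \<or> antimono \<theta>" "mono X \<or> antimono X"
    and \<kappa>: "1 \<le> \<kappa>"
    and transport_\<theta>: "\<And>f. f \<in> borel_measurable borel \<Longrightarrow>
          (\<integral>\<^sup>+x. f (\<theta> x) \<partial>lborel) \<le> ennreal \<kappa> * (\<integral>\<^sup>+x. f x \<partial>lborel)"
    and transport_X: "\<And>f. f \<in> borel_measurable borel \<Longrightarrow>
          (\<integral>\<^sup>+x. f (X x) \<partial>lborel) \<le> ennreal \<kappa> * (\<integral>\<^sup>+x. f x \<partial>lborel)"
begin

lemma outlet_in: "outlet \<in> {0..L}"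
  using range[of outlet] outlet \<Theta>_pos by simp

text \<open>
  \<open>\<theta> (s t) - t\<close> has derivative zero along a characteristic; in particular
  characteristics are unique.
\<close>

lemma backward_curve_eq:
  assumes bc: "backward_curve lam L \<tau> \<sigma> t0 s" and t: "t \<in> {t0..\<tau>}"
  shows "s t = X (- \<tau> + \<theta> \<sigma> + t)" "\<theta> (s t) = - \<tau> + \<theta> \<sigma> + t"
proof -
  have s: "s \<tau> = \<sigma>" "s u \<in> {0..L}" "(s has_real_derivative lam (s u)) (at u within {t0..\<tau>})" if "u \<in> {t0..\<tau>}" for u
    using bc that unfolding backward_curve_def by auto
  have "((\<lambda>u. \<theta> (s u) - u) has_real_derivative 0) (at u within {t0..\<tau>})" if u: "u \<in> {t0..\<tau>}" for u
  proof -
    have "((\<lambda>u. \<theta> (s u)) has_real_derivative inverse (lam (s u)) * lam (s u)) (at u within {t0..\<tau>})"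
      using DERIV_chain2[OF \<theta>_deriv[OF s(2)[OF u]] s(3)[OF u]] .
    then have "((\<lambda>u. \<theta> (s u) - u) has_real_derivative inverse (lam (s u)) * lam (s u) - 1) (at u within {t0..\<tau>})"
      by (intro derivative_intros)
    then show ?thesis using lam_nz[OF s(2)[OF u]] by simp
  qed
  then obtain k where "\<And>u. u \<in> {t0..\<tau>} \<Longrightarrow> \<theta> (s u) - u = k"
    using has_field_derivative_zero_constant[of "{t0..\<tau>}" "\<lambda>u. \<theta> (s u) - u"] by auto
  from this[OF t] this[of \<tau>] s(1)[OF t] t show "\<theta> (s t) = - \<tau> + \<theta> \<sigma> + t" by auto
  then show "s t = X (- \<tau> + \<theta> \<sigma> + t)" using X_\<theta> by metis
qed

lemma backward_curve_exists:
  assumes \<sigma>: "\<sigma> \<in> {0..L}" and t0: "\<tau> - \<theta> \<sigma> \<le> t0"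
  shows "backward_curve lam L \<tau> \<sigma> t0 (\<lambda>t. X (- \<tau> + \<theta> \<sigma> + t))"
  unfolding backward_curve_def
proof (intro conjI ballI)
  show "X (- \<tau> + \<theta> \<sigma> + \<tau>) = \<sigma>" by (simp add: X_\<theta>)
  fix t assume t: "t \<in> {t0..\<tau>}"
  show in_L: "X (- \<tau> + \<theta> \<sigma> + t) \<in> {0..L}"
    unfolding range \<theta>_X using t t0 \<sigma>[unfolded range] by auto
  have "((\<lambda>t. X (- \<tau> + \<theta> \<sigma> + t)) has_real_derivative lam (X (- \<tau> + \<theta> \<sigma> + t)) * 1) (at t)"
    by (rule DERIV_chain2[where f = X and g = "\<lambda>t. - \<tau> + \<theta> \<sigma> + t", OF X_deriv[OF in_L]]) (auto intro!: derivative_eq_intros)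
  then show "((\<lambda>t. X (- \<tau> + \<theta> \<sigma> + t)) has_real_derivative lam (X (- \<tau> + \<theta> \<sigma> + t))) (at t within {t0..\<tau>})"
    by (simp add: has_field_derivative_at_within)
qed

text \<open>
  The characteristic stays in the domain exactly as long as its travel time from the inlet is
  nonnegative.
\<close>

lemma exit_time_eq:
  assumes \<sigma>: "\<sigma> \<in> {0..L}" and \<tau>: "0 \<le> \<tau>"
  shows "exit_time lam L \<tau> \<sigma> = max 0 (\<tau> - \<theta> \<sigma>)"
proof -
  have "{t0 \<in> {0..\<tau>}. \<exists>s. backward_curve lam L \<tau> \<sigma> t0 s} = {max 0 (\<tau> - \<theta> \<sigma>)..\<tau>}" (is "?A = ?B")
  proof (intro set_eqI iffI)
    fix t0 assume "t0 \<in> ?A"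
    then obtain s where t0: "t0 \<in> {0..\<tau>}" and s: "backward_curve lam L \<tau> \<sigma> t0 s" by blast
    have "s t0 \<in> {0..L}" using s t0 unfolding backward_curve_def by auto
    then have "0 \<le> - \<tau> + \<theta> \<sigma> + t0" unfolding range using backward_curve_eq(2)[OF s, of t0] t0 by auto
    then show "t0 \<in> ?B" using t0 by auto
  next
    fix t0 assume "t0 \<in> ?B"
    then show "t0 \<in> ?A" using backward_curve_exists[OF \<sigma>, of \<tau> t0] by auto
  qed
  moreover have "max 0 (\<tau> - \<theta> \<sigma>) \<le> \<tau>" using \<tau> \<sigma>[unfolded range] by auto
  ultimately show ?thesis unfolding exit_time_def by (simp add: cInf_atLeastAtMost)
qed

lemma char_curve_eq:
  assumes \<sigma>: "\<sigma> \<in> {0..L}" and \<tau>: "0 \<le> \<tau>" and t: "t \<in> {exit_time lam L \<tau> \<sigma>..\<tau>}"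
  shows "char_curve lam L \<tau> \<sigma> t = X (- \<tau> + \<theta> \<sigma> + t)"
proof -
  have "backward_curve lam L \<tau> \<sigma> (exit_time lam L \<tau> \<sigma>) (char_curve lam L \<tau> \<sigma>)"
    unfolding char_curve_def
    using backward_curve_exists[OF \<sigma>, of \<tau> "exit_time lam L \<tau> \<sigma>"]
    by (intro someI[of "backward_curve lam L \<tau> \<sigma> (exit_time lam L \<tau> \<sigma>)"]) (auto simp: exit_time_eq[OF \<sigma> \<tau>])
  from backward_curve_eq(1)[OF this t] show ?thesis .
qed

end

text \<open>
  Extending the speed by its end values beyond \<open>[0,L]\<close> keeps it continuous, bounded
  and bounded away from zero, so that the travel time becomes a diffeomorphism of the line.
\<close>

lemma characteristic_coordinate_exists:
  fixes lam :: "real \<Rightarrow> real"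
  assumes L: "0 < L" and cont: "continuous_on {0..L} lam"
    and sign: "(up \<and> (\<forall>x\<in>{0..L}. 0 < lam x)) \<or> (\<not> up \<and> (\<forall>x\<in>{0..L}. lam x < 0))"
  shows "\<exists>\<theta> X \<Theta> \<kappa>. characteristic_coordinate L lam \<theta> X \<Theta> \<kappa> (if up then L else 0)"
proof -
  define clamp where "clamp x = max 0 (min L x)" for x :: real
  define g where "g x = lam (clamp x)" for x
  have clamp: "clamp x \<in> {0..L}" "x \<in> {0..L} \<Longrightarrow> clamp x = x" for x using L by (auto simp: clamp_def)
  have g_cont: "continuous_on UNIV g"
    unfolding g_def
    by (rule continuous_on_compose2[OF cont]) (use clamp in \<open>auto simp: clamp_def intro!: continuous_intros\<close>)
  have g_nz: "g x \<noteq> 0" for x using sign clamp(1)[of x] unfolding g_def by force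
  have cpt: "compact ((\<lambda>x. \<bar>lam x\<bar>) ` {0..L})" "(\<lambda>x. \<bar>lam x\<bar>) ` {0..L} \<noteq> {}"
    using L by (auto intro!: compact_continuous_image continuous_intros cont)
  obtain xm where xm: "xm \<in> {0..L}" "\<And>x. x \<in> {0..L} \<Longrightarrow> \<bar>lam xm\<bar> \<le> \<bar>lam x\<bar>"
    using compact_attains_inf[OF cpt] by auto
  obtain xM where xM: "xM \<in> {0..L}" "\<And>x. x \<in> {0..L} \<Longrightarrow> \<bar>lam x\<bar> \<le> \<bar>lam xM\<bar>"
    using compact_attains_sup[OF cpt] by auto
  define mn where "mn = \<bar>lam xm\<bar>"
  define mx where "mx = \<bar>lam xM\<bar>"
  have mn: "0 < mn" "\<And>x. mn \<le> \<bar>g x\<bar>" using xm sign clamp(1) unfolding mn_def g_def by force+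
  have mx: "0 < mx" "\<And>x. \<bar>g x\<bar> \<le> mx" using xM sign clamp(1) unfolding mx_def g_def by force+
  define e where "e = (if up then 0 else L)"
  define \<theta> :: "real \<Rightarrow> real" where "\<theta> x = (LBINT y=e..x. inverse (g y))" for x
  have der: "(\<theta> has_real_derivative inverse (g x)) (at x)" for x
  proof -
    have "((\<lambda>u. LBINT y=e..u. inverse (g y)) has_vector_derivative inverse (g x)) (at x within {min e x - 1..max e x + 1})"
      by (rule interval_integral_FTC2)
        (auto intro!: continuous_intros continuous_on_subset[OF g_cont] simp: g_nz)
    moreover have "at x within {min e x - 1..max e x + 1} = at x"
      by (rule at_within_interior) auto
    ultimately show ?thesis unfolding \<theta>_def has_real_derivative_iff_has_vector_derivative by simp
  qed
  have bd: "(\<forall>x. inverse mx \<le> inverse (g x)) \<or> (\<forall>x. inverse (g x) \<le> - inverse mx)"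
    using sign
  proof
    assume s: "up \<and> (\<forall>x\<in>{0..L}. 0 < lam x)"
    have "0 < g x" for x using s clamp(1) by (simp add: g_def)
    then show ?thesis using mx by (auto intro!: disjI1 le_imp_inverse_le) (metis abs_of_pos)
  next
    assume s: "\<not> up \<and> (\<forall>x\<in>{0..L}. lam x < 0)"
    have "0 < - g x" for x using s clamp(1) by (simp add: g_def)
    then have "inverse mx \<le> inverse (- g x)" for x
      using mx by (intro le_imp_inverse_le) (auto simp: abs_if split: if_splits)
    then show ?thesis by (auto simp: le_minus_iff)
  qed
  have imx: "0 < inverse mx" using mx by simp
  note diffeo = real_diffeomorphism[OF der imx bd]
  define X where "X = inv \<theta>"
  have X: "\<theta> (X z) = z" "X (\<theta> x) = x" for x z
    unfolding X_def using diffeo(1) by (simp_all add: bij_is_surj surj_f_inv_f bij_is_inj)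
  have X_der: "(X has_real_derivative g (X z)) (at z)" for z
    using diffeo(4)[of z] unfolding X_def by simp
  have \<theta>_c: "continuous_on UNIV \<theta>" using der by (intro continuous_at_imp_continuous_on) (auto intro: DERIV_isCont)
  have X_c: "continuous_on UNIV X" using X_der by (intro continuous_at_imp_continuous_on) (auto intro: DERIV_isCont)
  have \<theta>e: "\<theta> e = 0" unfolding \<theta>_def by simp
  define out where "out = (if up then L else 0)"
  define \<kappa> where "\<kappa> = max 1 (max mx (1 / mn))"
  have inj: "\<theta> x = \<theta> y \<longleftrightarrow> x = y" for x y using X(2) by metis
  have rng: "0 < \<theta> out \<and> (\<forall>x. x \<in> {0..L} \<longleftrightarrow> \<theta> x \<in> {0..\<theta> out})"
    using sign
  proof
    assume s: "up \<and> (\<forall>x\<in>{0..L}. 0 < lam x)"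
    have inc: "\<theta> x < \<theta> y" if "x < y" for x y
      by (rule DERIV_pos_imp_increasing[OF that]) (use der s clamp(1) in \<open>auto simp: g_def intro!: exI[of _ "inverse (g _)"]\<close>)
    have le: "\<theta> x \<le> \<theta> y \<longleftrightarrow> x \<le> y" for x y using inc[of x y] inc[of y x] by (cases x y rule: linorder_cases) auto
    have "\<theta> 0 = 0" using \<theta>e s by (simp add: e_def)
    then show ?thesis using s inc[of 0 L] L le[of 0] le[of _ L] by (auto simp: out_def)
  next
    assume s: "\<not> up \<and> (\<forall>x\<in>{0..L}. lam x < 0)"
    have dec: "\<theta> y < \<theta> x" if "x < y" for x y
      by (rule DERIV_neg_imp_decreasing[OF that]) (use der s clamp(1) in \<open>auto simp: g_def intro!: exI[of _ "inverse (g _)"]\<close>)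
    have le: "\<theta> x \<le> \<theta> y \<longleftrightarrow> y \<le> x" for x y using dec[of x y] dec[of y x] by (cases x y rule: linorder_cases) auto
    have "\<theta> L = 0" using \<theta>e s by (simp add: e_def)
    then show ?thesis using s dec[of 0 L] L le[of L] le[of _ 0] by (auto simp: out_def)
  qed
  have tr_\<theta>: "(\<integral>\<^sup>+x. f (\<theta> x) \<partial>lborel) \<le> ennreal \<kappa> * (\<integral>\<^sup>+x. f x \<partial>lborel)"
    if [measurable]: "f \<in> borel_measurable borel" for f :: "real \<Rightarrow> ennreal"
  proof -
    have "(\<integral>\<^sup>+x. f (\<theta> x) \<partial>lborel) \<le> ennreal (1 / inverse mx) * (\<integral>\<^sup>+x. f x \<partial>lborel)"
      by (rule nn_integral_change_of_variables_le[OF der _ imx bd that]) (auto intro!: continuous_intros g_cont simp: g_nz)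
    also have "\<dots> \<le> ennreal \<kappa> * (\<integral>\<^sup>+x. f x \<partial>lborel)"
      by (intro mult_right_mono ennreal_leI) (auto simp: \<kappa>_def inverse_eq_divide)
    finally show ?thesis .
  qed
  have bdX: "(\<forall>z. mn \<le> g (X z)) \<or> (\<forall>z. g (X z) \<le> - mn)"
    using sign
  proof
    assume s: "up \<and> (\<forall>x\<in>{0..L}. 0 < lam x)"
    have "0 < g x" for x using s clamp(1) by (simp add: g_def)
    then show ?thesis using mn by (metis abs_of_pos)
  next
    assume s: "\<not> up \<and> (\<forall>x\<in>{0..L}. lam x < 0)"
    have "g x < 0" for x using s clamp(1) by (simp add: g_def)
    then show ?thesis using mn by (metis abs_of_neg le_minus_iff)
  qed
  have tr_X: "(\<integral>\<^sup>+x. f (X x) \<partial>lborel) \<le> ennreal \<kappa> * (\<integral>\<^sup>+x. f x \<partial>lborel)"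
    if [measurable]: "f \<in> borel_measurable borel" for f :: "real \<Rightarrow> ennreal"
  proof -
    have "(\<integral>\<^sup>+x. f (X x) \<partial>lborel) \<le> ennreal (1 / mn) * (\<integral>\<^sup>+x. f x \<partial>lborel)"
      by (rule nn_integral_change_of_variables_le[OF X_der _ mn(1) bdX that])
        (rule continuous_on_compose2[OF g_cont X_c], auto)
    also have "\<dots> \<le> ennreal \<kappa> * (\<integral>\<^sup>+x. f x \<partial>lborel)"
      by (intro mult_right_mono ennreal_leI) (auto simp: \<kappa>_def)
    finally show ?thesis .
  qed
  have "characteristic_coordinate L lam \<theta> X (\<theta> out) \<kappa> out"
  proof
    show "lam x \<noteq> 0" "(\<theta> has_real_derivative inverse (lam x)) (at x)" if "x \<in> {0..L}" for x
      using g_nz[of x] der[of x] clamp(2)[OF that] by (auto simp: g_def)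
    show "(X has_real_derivative lam (X z)) (at z)" if "X z \<in> {0..L}" for z
      using X_der[of z] clamp(2)[OF that] by (auto simp: g_def)
    show "1 \<le> \<kappa>" by (simp add: \<kappa>_def)
  qed (use X rng \<theta>_c X_c diffeo(2,3) tr_\<theta> tr_X in \<open>auto simp: X_def\<close>)
  then show ?thesis unfolding out_def by blast
qed


section \<open>Sobolev data have representatives of bounded variation\<close>

text \<open>
  The primitive of the absolute value is a monotone majorant in the sense of
  \<open>variation_le_dominated\<close>.
\<close>

lemma integrable_primitive_variation:
  fixes h :: "real \<Rightarrow> real"
  assumes [measurable]: "h \<in> borel_measurable borel" and int: "integrable lborel h"
  shows "(\<lambda>x. LINT t:{..x}|lborel. h t) \<in> borel_measurable borel"
    and "variation_le (\<lambda>x. LINT t:{..x}|lborel. h t) (LINT t|lborel. \<bar>h t\<bar>)"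
    and "\<bar>LINT t:{..x}|lborel. h t\<bar> \<le> (LINT t|lborel. \<bar>h t\<bar>)"
proof -
  have si: "set_integrable lborel A f" if "integrable lborel f" "A \<in> sets borel" for f :: "real \<Rightarrow> real" and A
    unfolding set_integrable_def by (rule integrable_mult_indicator) (use that in auto)
  have "(\<lambda>(x, t). if t \<le> x then h t else 0) \<in> borel_measurable (borel \<Otimes>\<^sub>M lborel)"
    by (simp add: split_beta')
  from sigma_finite_measure.borel_measurable_lebesgue_integral[OF sigma_finite_lborel this]
  have "(\<lambda>x. LINT t|lborel. (if t \<le> x then h t else 0)) \<in> borel_measurable borel" .
  also have "(\<lambda>x. LINT t|lborel. (if t \<le> x then h t else 0)) = (\<lambda>x. LINT t:{..x}|lborel. h t)"
    unfolding set_lebesgue_integral_def by (intro ext Bochner_Integration.integral_cong) auto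
  finally show "(\<lambda>x. LINT t:{..x}|lborel. h t) \<in> borel_measurable borel" .
  let ?v = "\<lambda>x. LINT t:{..x}|lborel. \<bar>h t\<bar>"
  have abs_le: "\<bar>LINT t:A|lborel. h t\<bar> \<le> (LINT t:A|lborel. \<bar>h t\<bar>)" if "A \<in> sets borel" for A
    using set_integral_norm_bound[OF si[OF int that]] by simp
  have v: "?v x \<in> {0..(LINT t|lborel. \<bar>h t\<bar>)}" for x
  proof -
    have "?v x \<le> (LINT t|lborel. \<bar>h t\<bar>)"
      unfolding set_lebesgue_integral_def
      using si[of "\<lambda>t. \<bar>h t\<bar>" "{..x}"] int
      by (intro integral_mono) (auto simp: set_integrable_def indicator_def)
    moreover have "0 \<le> ?v x" unfolding set_lebesgue_integral_def by (intro integral_nonneg_AE) auto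
    ultimately show ?thesis by simp
  qed
  show "\<bar>LINT t:{..x}|lborel. h t\<bar> \<le> (LINT t|lborel. \<bar>h t\<bar>)"
    using abs_le[of "{..x}"] v[of x] by simp
  have "variation_le (\<lambda>x. LINT t:{..x}|lborel. h t) ((LINT t|lborel. \<bar>h t\<bar>) - 0)"
  proof (rule variation_le_dominated[where v = ?v])
    fix x y :: real assume "x \<le> y"
    then have eq: "{..y} = {..x} \<union> {x<..y}" by auto
    have split: "(LINT t:{..y}|lborel. f t) = (LINT t:{..x}|lborel. f t) + (LINT t:{x<..y}|lborel. f t)"
      if "integrable lborel f" for f :: "real \<Rightarrow> real"
      unfolding eq by (rule set_integral_Un) (use si that in auto)
    show "norm ((LINT t:{..y}|lborel. h t) - (LINT t:{..x}|lborel. h t)) \<le> ?v y - ?v x"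
      using abs_le[of "{x<..y}"] split[OF int] split[of "\<lambda>t. \<bar>h t\<bar>"] int by simp
  qed (rule v)
  then show "variation_le (\<lambda>x. LINT t:{..x}|lborel. h t) (LINT t|lborel. \<bar>h t\<bar>)" by simp
qed

lemma set_integrable_scaleR_continuous:
  fixes g :: "real \<Rightarrow> 'a::euclidean_space"
  assumes \<phi>: "continuous_on UNIV \<phi>" and g: "set_integrable lebesgue {a<..<b} g"
  shows "set_integrable lebesgue {a<..<b} (\<lambda>x. \<phi> x *\<^sub>R g x)"
proof -
  have "compact (\<phi> ` {a..b})"
    by (rule compact_continuous_image[OF continuous_on_subset[OF \<phi>]]) auto
  then obtain B where B: "\<And>x. x \<in> {a..b} \<Longrightarrow> norm (\<phi> x) \<le> B"
    by (meson bounded_iff compact_imp_bounded imageI)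
  have [measurable]: "\<phi> \<in> borel_measurable lebesgue"
    using borel_measurable_continuous_onI[OF \<phi>] by (simp add: measurable_completion)
  have m: "(\<lambda>x. indicat_real {a<..<b} x *\<^sub>R g x) \<in> borel_measurable lebesgue"
    using g unfolding set_integrable_def by (rule borel_measurable_integrable)
  show ?thesis
    unfolding set_integrable_def
  proof (rule Bochner_Integration.integrable_bound)
    show "integrable lebesgue (\<lambda>x. B *\<^sub>R norm (indicat_real {a<..<b} x *\<^sub>R g x))"
      using g unfolding set_integrable_def by (intro integrable_scaleR_right integrable_norm)
    have "(\<lambda>x. \<phi> x *\<^sub>R (indicat_real {a<..<b} x *\<^sub>R g x)) \<in> borel_measurable lebesgue"
      by (rule borel_measurable_scaleR[OF _ m]) simp
    then show "(\<lambda>x. indicat_real {a<..<b} x *\<^sub>R \<phi> x *\<^sub>R g x) \<in> borel_measurable lebesgue"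
      by (simp add: mult.commute)
    show "AE x in lebesgue. norm (indicat_real {a<..<b} x *\<^sub>R \<phi> x *\<^sub>R g x) \<le> norm (B *\<^sub>R norm (indicat_real {a<..<b} x *\<^sub>R g x))"
    proof (rule AE_I2)
      fix x
      show "norm (indicat_real {a<..<b} x *\<^sub>R \<phi> x *\<^sub>R g x) \<le> norm (B *\<^sub>R norm (indicat_real {a<..<b} x *\<^sub>R g x))"
        using B[of x] by (cases "x \<in> {a<..<b}") (auto intro!: mult_right_mono)
    qed
  qed
qed

lemma W11_component:
  fixes g :: "real \<Rightarrow> (real, 'n::finite) vec"
  assumes "W11 a b g" shows "W11 a b (\<lambda>x. g x $ k)"
proof -
  obtain h where g: "set_integrable lebesgue {a<..<b} g" and h: "set_integrable lebesgue {a<..<b} h"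
    and weak: "\<And>\<phi> \<phi>'. test_function a b \<phi> \<phi>' \<Longrightarrow>
       (LINT x:{a<..<b}|lebesgue. \<phi>' x *\<^sub>R g x) = - (LINT x:{a<..<b}|lebesgue. \<phi> x *\<^sub>R h x)"
    using assms unfolding W11_def by blast
  have comp: "set_integrable lebesgue {a<..<b} (\<lambda>x. f x $ k)"
    "(LINT x:{a<..<b}|lebesgue. f x $ k) = (LINT x:{a<..<b}|lebesgue. f x) $ k"
    if "set_integrable lebesgue {a<..<b} f" for f :: "real \<Rightarrow> (real, 'n) vec"
    using integrable_bounded_linear[OF bounded_linear_vec_nth[of k] that[unfolded set_integrable_def]]
      integral_bounded_linear[OF bounded_linear_vec_nth[of k] that[unfolded set_integrable_def]]
    by (auto simp: set_integrable_def set_lebesgue_integral_def)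
  show ?thesis
    unfolding W11_def
  proof (intro conjI exI[of _ "\<lambda>x. h x $ k"] allI impI)
    fix \<phi> \<phi>' assume t: "test_function a b \<phi> \<phi>'"
    have c: "continuous_on UNIV \<phi>" "continuous_on UNIV \<phi>'"
      using t unfolding test_function_def by (auto intro!: continuous_at_imp_continuous_on DERIV_isCont)
    show "(LINT x:{a<..<b}|lebesgue. \<phi>' x *\<^sub>R g x $ k) = - (LINT x:{a<..<b}|lebesgue. \<phi> x *\<^sub>R h x $ k)"
      using comp(2)[OF set_integrable_scaleR_continuous[OF c(2) g]] comp(2)[OF set_integrable_scaleR_continuous[OF c(1) h]]
        weak[OF t] by simp
  qed (use comp(1) g h in auto)
qed

text \<open>
  By Fubini, \<open>g\<close> minus the primitive of \<open>h\<close> is orthogonal to every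
  continuous compactly supported \<open>\<psi>\<close> with mean zero, hence, after subtraction of
  a constant \<open>c\<close>, to all continuous compactly supported functions. Such functions
  approximate the sign of the difference \<open>w\<close> almost everywhere (measurability in the
  sense of \<open>measurable_on\<close>), so \<open>\<integral>|w| = 0\<close>.
\<close>

lemma du_Bois_Reymond:
  fixes g h :: "real \<Rightarrow> real"
  assumes ab: "a < b" and g: "set_integrable lebesgue {a<..<b} g"
    and h [measurable]: "h \<in> borel_measurable borel" "integrable lborel h"
    and weak: "\<And>\<phi> \<phi>'. test_function a b \<phi> \<phi>' \<Longrightarrow>
       (LINT x:{a<..<b}|lebesgue. \<phi>' x * g x) = - (LINT x:{a<..<b}|lborel. \<phi> x * h x)"
    and h0: "\<And>x. x \<notin> {a<..<b} \<Longrightarrow> h x = 0"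
  shows "\<exists>c. AE x in lebesgue. x \<in> {a<..<b} \<longrightarrow> g x = c + (LINT t:{..x}|lborel. h t)"
proof -
  define H where "H x = (LINT t:{..x}|lborel. h t)" for x
  have H_int: "set_integrable lborel {..x} h" for x
    using h(2) unfolding set_integrable_def by (intro integrable_mult_indicator) auto
  have H_m [measurable]: "H \<in> borel_measurable borel"
    and H_bd: "\<bar>H x\<bar> \<le> (LINT t|lborel. \<bar>h t\<bar>)" for x
    unfolding H_def[abs_def] by (rule integrable_primitive_variation(1,3)[OF h])+
  define I where "I = (LINT t|lborel. h t)"
  let ?S = "{a<..<b}"
  have gI: "integrable lebesgue (\<lambda>x. indicat_real ?S x * g x)" using g by (simp add: set_integrable_def)
  have HI: "integrable lebesgue (\<lambda>x. indicat_real ?S x * H x)"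
  proof (rule integrable_completion[THEN iffD2])
    show "integrable lborel (\<lambda>x. indicat_real ?S x * H x)"
      using integrableI_bounded_set_indicator[of ?S lborel H "LINT t|lborel. \<bar>h t\<bar>"] H_bd by (simp add: ab less_imp_le)
  qed simp
  have basic: "(LINT x|lebesgue. \<psi> x * (indicat_real ?S x * (g x - H x))) = 0"
    if \<psi>: "continuous_on UNIV \<psi>" and ce: "a < c" "e < b" "\<And>x. x \<notin> {c..e} \<Longrightarrow> \<psi> x = 0" and z: "(LINT x|lborel. \<psi> x) = 0"
    for \<psi> c e
  proof -
    have [measurable]: "\<psi> \<in> borel_measurable borel" by (rule borel_measurable_continuous_onI[OF \<psi>])
    have "integrable lborel (\<lambda>x. indicator {c..e} x *\<^sub>R \<psi> x)"
      by (rule borel_integrable_compact) (auto intro: continuous_on_subset[OF \<psi>])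
    also have "(\<lambda>x. indicator {c..e} x *\<^sub>R \<psi> x) = \<psi>"
      using ce(3) by (auto simp: fun_eq_iff indicator_def)
    finally have \<psi>_int: "integrable lborel \<psi>" .
    define \<phi> where "\<phi> x = (LINT t:{..x}|lborel. \<psi> t)" for x
    have \<phi>_der: "(\<phi> has_real_derivative \<psi> x) (at x)" for x
    proof -
      define l where "l = min c x - 1"
      have "((\<lambda>u. LBINT y=l..u. \<psi> y) has_vector_derivative \<psi> x) (at x within {l..x + 1})"
        by (rule interval_integral_FTC2) (auto simp: l_def intro: continuous_on_subset[OF \<psi>])
      moreover have "at x within {l..x + 1} = at x" by (rule at_within_interior) (auto simp: l_def)
      ultimately have d: "((\<lambda>u. LBINT y=l..u. \<psi> y) has_real_derivative \<psi> x) (at x)"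
        by (simp add: has_real_derivative_iff_has_vector_derivative)
      show ?thesis
      proof (rule has_field_derivative_transform_within_open[OF d, of "{l<..}"])
        fix u assume "u \<in> {l<..}"
        then have u: "l \<le> u" by simp
        have "(LBINT y=l..u. \<psi> y) = (LINT t:{l..u}|lborel. \<psi> t)"
          using u by (rule interval_integral_Icc)
        also have "\<dots> = \<phi> u"
        proof -
          have "l < c" by (auto simp: l_def)
          then have "\<psi> t = 0" if "t < l" for t using ce(3)[of t] that by auto
          then show ?thesis
            unfolding \<phi>_def set_lebesgue_integral_def
            by (intro Bochner_Integration.integral_cong) (auto simp: indicator_def not_le)
        qed
        finally show "(LBINT y=l..u. \<psi> y) = \<phi> u" .
      qed (auto simp: l_def)
    qed
    have \<phi>0: "\<phi> x = 0" if x: "x \<notin> {c..e}" for x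
    proof (cases "x < c")
      case True
      then have "(\<lambda>t. indicat_real {..x} t *\<^sub>R \<psi> t) = (\<lambda>t. 0)" using ce(3) by (auto simp: indicator_def)
      then show ?thesis unfolding \<phi>_def set_lebesgue_integral_def by simp
    next
      case False
      then have "indicat_real {..x} t *\<^sub>R \<psi> t = \<psi> t" for t using ce(3)[of t] x by (cases "t \<le> x") auto
      then have "(\<lambda>t. indicat_real {..x} t *\<^sub>R \<psi> t) = \<psi>" by (rule ext)
      then show ?thesis unfolding \<phi>_def set_lebesgue_integral_def using z by simp
    qed
    have "test_function a b \<phi> \<psi>"
      unfolding test_function_def using \<phi>_der \<psi> ce(1,2) \<phi>0 by blast
    from weak[OF this] have w: "(LINT x|lebesgue. indicat_real ?S x * (\<psi> x * g x)) = - (LINT x|lborel. \<phi> x * h x)"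
    proof -
      have "(\<lambda>x. indicat_real ?S x * (\<phi> x * h x)) = (\<lambda>x. \<phi> x * h x)" using h0 by (auto simp: indicator_def fun_eq_iff)
      then show ?thesis using weak[OF \<open>test_function a b \<phi> \<psi>\<close>] by (simp add: set_lebesgue_integral_def)
    qed
    let ?f = "\<lambda>(x, t). (if t \<le> x then 1 else 0) * (h x * \<psi> t)"
    \<comment> \<open>the double integral of \<open>h x * \<psi> t\<close> over \<open>t \<le>
      x\<close>; integrating in \<open>x\<close> first turns \<open>\<phi>\<close> into the
      primitive \<open>H\<close> of \<open>h\<close>\<close>
    have f_int: "integrable (lborel \<Otimes>\<^sub>M lborel) ?f"
    proof (rule Bochner_Integration.integrable_bound)
      show "integrable (lborel \<Otimes>\<^sub>M lborel) (\<lambda>(x, t). h x * \<psi> t)"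
      proof (rule lborel_pair.Fubini_integrable)
        show "integrable lborel (\<lambda>x. LINT t|lborel. norm (case (x, t) of (x, t) \<Rightarrow> h x * \<psi> t))"
          using h(2) \<psi>_int by (simp add: abs_mult)
      qed (use \<psi>_int in \<open>auto simp: split_beta'\<close>)
      show "?f \<in> borel_measurable (lborel \<Otimes>\<^sub>M lborel)" by (simp add: split_beta')
    qed auto
    have "(LINT x|lborel. \<phi> x * h x) = (LINT x|lborel. LINT t|lborel. ?f (x, t))"
    proof (intro Bochner_Integration.integral_cong refl)
      fix x
      have "\<phi> x * h x = (LINT t|lborel. h x * (indicat_real {..x} t *\<^sub>R \<psi> t))"
        by (simp add: \<phi>_def set_lebesgue_integral_def mult.commute)
      also have "\<dots> = (LINT t|lborel. ?f (x, t))" by (intro Bochner_Integration.integral_cong) auto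
      finally show "\<phi> x * h x = (LINT t|lborel. ?f (x, t))" .
    qed
    also have "\<dots> = (LINT t|lborel. LINT x|lborel. ?f (x, t))"
      using lborel_pair.Fubini_integral[OF f_int] by simp
    also have "\<dots> = (LINT t|lborel. \<psi> t * I - \<psi> t * H t)"
    proof (intro Bochner_Integration.integral_cong refl)
      fix t
      have "(LINT x|lborel. ?f (x, t)) = (LINT x|lborel. \<psi> t * (h x - indicat_real {..t} x *\<^sub>R h x))"
      proof (rule integral_cong_AE)
        show "AE x in lborel. ?f (x, t) = \<psi> t * (h x - indicat_real {..t} x *\<^sub>R h x)"
          using AE_lborel_singleton[of t] by eventually_elim (auto simp: indicator_def)
      qed auto
      also have "\<dots> = \<psi> t * (I - H t)"
        using h(2) H_int[of t] by (simp add: I_def H_def set_lebesgue_integral_def set_integrable_def)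
      finally show "(LINT x|lborel. ?f (x, t)) = \<psi> t * I - \<psi> t * H t" by (simp add: right_diff_distrib)
    qed
    also have "\<dots> = (LINT t|lborel. \<psi> t * I) - (LINT t|lborel. \<psi> t * H t)"
    proof (rule Bochner_Integration.integral_diff)
      show "integrable lborel (\<lambda>t. \<psi> t * H t)"
      proof (rule Bochner_Integration.integrable_bound)
        show "integrable lborel (\<lambda>t. \<psi> t * (LINT t|lborel. \<bar>h t\<bar>))" using \<psi>_int by simp
        show "AE x in lborel. norm (\<psi> x * H x) \<le> norm (\<psi> x * (LINT t|lborel. \<bar>h t\<bar>))"
          using H_bd order_trans[OF H_bd abs_ge_self] by (auto simp: abs_mult intro!: mult_left_mono)
      qed simp
    qed (use \<psi>_int in simp)
    also have "\<dots> = - (LINT t|lborel. \<psi> t * H t)" using z by simp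
    finally have "(LINT x|lebesgue. indicat_real ?S x * (\<psi> x * g x)) = (LINT t|lborel. \<psi> t * H t)" using w by simp
    also have "\<dots> = (LINT x|lebesgue. \<psi> x * H x)" by (rule integral_completion[symmetric]) simp
    also have "\<dots> = (LINT x|lebesgue. indicat_real ?S x * (\<psi> x * H x))"
    proof (intro Bochner_Integration.integral_cong refl)
      fix x
      have "\<psi> x = 0" if "x \<notin> ?S" using ce(3)[of x] ce(1,2) that by fastforce
      then show "\<psi> x * H x = indicat_real ?S x * (\<psi> x * H x)" by (cases "x \<in> ?S") auto
    qed
    finally have eq: "(LINT x|lebesgue. indicat_real ?S x * (\<psi> x * g x)) = (LINT x|lebesgue. indicat_real ?S x * (\<psi> x * H x))" .
    have i1: "integrable lebesgue (\<lambda>x. indicat_real ?S x * (\<psi> x * g x))"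
      using set_integrable_scaleR_continuous[OF \<psi> g] by (simp add: set_integrable_def)
    have i2: "integrable lebesgue (\<lambda>x. indicat_real ?S x * (\<psi> x * H x))"
      using set_integrable_scaleR_continuous[OF \<psi>, of a b H] HI by (simp add: set_integrable_def)
    have "(LINT x|lebesgue. \<psi> x * (indicat_real ?S x * (g x - H x))) =
        (LINT x|lebesgue. indicat_real ?S x * (\<psi> x * g x) - indicat_real ?S x * (\<psi> x * H x))"
      by (intro Bochner_Integration.integral_cong) (auto simp: algebra_simps)
    also have "\<dots> = 0" using eq by (subst Bochner_Integration.integral_diff[OF i1 i2]) simp
    finally show ?thesis .
  qed
  \<comment> \<open>a bump with integral \<open>J\<close>, supported in the middle third, which
    fixes the constant \<open>c\<close>\<close>
  define p where "p = a + (b - a) / 3"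
  define q where "q = b - (b - a) / 3"
  have pq: "a < p" "p < q" "q < b" using ab by (auto simp: p_def q_def field_simps)
  define bump where "bump x = max 0 (min (x - p) (q - x))" for x :: real
  have bump: "continuous_on UNIV bump" "\<And>x. x \<notin> {p..q} \<Longrightarrow> bump x = 0" "\<And>x. 0 \<le> bump x"
    by (auto simp: bump_def intro!: continuous_intros)
  have [measurable]: "bump \<in> borel_measurable borel" by (rule borel_measurable_continuous_onI[OF bump(1)])
  have bump_int: "integrable lborel bump"
  proof -
    have "integrable lborel (\<lambda>x. indicator {p..q} x *\<^sub>R bump x)"
      by (rule borel_integrable_compact) (auto intro: continuous_on_subset[OF bump(1)])
    also have "(\<lambda>x. indicator {p..q} x *\<^sub>R bump x) = bump" using bump(2) by (auto simp: fun_eq_iff indicator_def)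
    finally show ?thesis .
  qed
  define J where "J = (LINT x|lborel. bump x)"
  have J: "J \<noteq> 0"
  proof
    assume "J = 0"
    then have "AE x in lborel. bump x = 0"
      using integral_nonneg_eq_0_iff_AE[OF bump_int] bump(3) by (simp add: J_def)
    then have "AE x in lborel. x \<notin> {p<..<q}" by eventually_elim (auto simp: bump_def)
    then have "{p<..<q} \<in> null_sets lborel" by (subst AE_iff_null_sets) auto
    then show False using pq by (auto simp: null_sets_def)
  qed
  define c where "c = (LINT x|lebesgue. bump x * (indicat_real ?S x * (g x - H x))) / J"
  define w where "w x = indicat_real ?S x * (g x - H x - c)" for x
  have gH: "integrable lebesgue (\<lambda>x. indicat_real ?S x * (g x - H x))"
    using Bochner_Integration.integrable_diff[OF gI HI] by (simp add: right_diff_distrib)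
  have wI: "integrable lebesgue w"
  proof -
    have "integrable lebesgue (\<lambda>x. indicat_real ?S x * c)" by (intro integrable_mult_left integrable_real_indicator) (auto simp: ab less_imp_le)
    from Bochner_Integration.integrable_diff[OF gH this] show ?thesis
      by (simp add: w_def[abs_def] right_diff_distrib)
  qed
  have mulI: "integrable lebesgue (\<lambda>x. \<psi> x * f x)" if "integrable lebesgue (\<lambda>x. indicat_real ?S x * f x)" "continuous_on UNIV \<psi>" "\<And>x. x \<notin> ?S \<Longrightarrow> f x = 0" for \<psi> f
  proof -
    have "(\<lambda>x. indicat_real ?S x *\<^sub>R \<psi> x *\<^sub>R f x) = (\<lambda>x. \<psi> x * f x)" using that(3) by (auto simp: fun_eq_iff indicator_def)
    then show ?thesis using set_integrable_scaleR_continuous[OF that(2), of a b f] that(1) by (simp add: set_integrable_def)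
  qed
  have orth: "(LINT x|lebesgue. \<psi> x * w x) = 0"
    if \<psi>: "continuous_on UNIV \<psi>" and ce: "a < c'" "e < b" "\<And>x. x \<notin> {c'..e} \<Longrightarrow> \<psi> x = 0" for \<psi> c' e
  proof -
    \<comment> \<open>\<open>\<psi> - k * bump\<close> has mean zero\<close>
    define k where "k = (LINT x|lborel. \<psi> x) / J"
    have [measurable]: "\<psi> \<in> borel_measurable borel" by (rule borel_measurable_continuous_onI[OF \<psi>])
    have "integrable lborel (\<lambda>x. indicator {c'..e} x *\<^sub>R \<psi> x)"
      by (rule borel_integrable_compact) (auto intro: continuous_on_subset[OF \<psi>])
    also have "(\<lambda>x. indicator {c'..e} x *\<^sub>R \<psi> x) = \<psi>" using ce(3) by (auto simp: fun_eq_iff indicator_def)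
    finally have \<psi>_int: "integrable lborel \<psi>" .
    let ?gH = "\<lambda>x. indicat_real ?S x * (g x - H x)"
    have gH_ind: "indicat_real ?S x * ?gH x = ?gH x" for x by (simp add: indicator_def)
    have "(LINT x|lebesgue. (\<psi> x - k * bump x) * ?gH x) = 0"
    proof (rule basic)
      show "continuous_on UNIV (\<lambda>x. \<psi> x - k * bump x)" by (intro continuous_intros \<psi> bump)
      show "a < min c' p" "max e q < b" using ce pq by auto
      show "\<psi> x - k * bump x = 0" if "x \<notin> {min c' p..max e q}" for x
      proof -
        have "x \<notin> {c'..e}" "x \<notin> {p..q}" using that by auto
        then show ?thesis using ce(3)[of x] bump(2)[of x] by simp
      qed
      show "(LINT x|lborel. \<psi> x - k * bump x) = 0"
        using \<psi>_int bump_int J by (simp add: k_def J_def[symmetric])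
    qed
    moreover have i: "integrable lebesgue (\<lambda>x. \<psi> x * ?gH x)" "integrable lebesgue (\<lambda>x. bump x * ?gH x)"
      using mulI[of ?gH \<psi>, OF _ \<psi>] mulI[of ?gH bump, OF _ bump(1)] gH by (simp_all add: gH_ind)
    ultimately have 1: "(LINT x|lebesgue. \<psi> x * ?gH x) = k * (c * J)"
      using J by (simp add: left_diff_distrib mult.assoc c_def)
    have "(LINT x|lebesgue. \<psi> x * w x) = (LINT x|lebesgue. \<psi> x * ?gH x - c * \<psi> x)"
    proof (intro Bochner_Integration.integral_cong refl)
      fix x
      have "\<psi> x = 0" if "x \<notin> ?S" using ce(3)[of x] ce(1,2) that by fastforce
      then show "\<psi> x * w x = \<psi> x * ?gH x - c * \<psi> x"
        by (cases "x \<in> ?S") (auto simp: w_def algebra_simps)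
    qed
    also have "\<dots> = (LINT x|lebesgue. \<psi> x * ?gH x) - c * (LINT x|lborel. \<psi> x)"
      using i \<psi>_int by (simp add: integral_completion integrable_completion)
    also have "\<dots> = 0" unfolding 1 k_def using J by simp
    finally show ?thesis .
  qed
  have w_m: "w \<in> borel_measurable lebesgue" using wI by (rule borel_measurable_integrable)
  have "(\<lambda>x. sgn (w x)) measurable_on UNIV"
  proof (rule lebesgue_measurable_imp_measurable_on)
    show "(\<lambda>x. sgn (w x)) \<in> borel_measurable lebesgue" using w_m by simp
  qed auto
  then obtain N \<gamma> where N: "negligible N" and \<gamma>: "\<And>n::nat. continuous_on UNIV (\<gamma> n)"
    and lim: "\<And>x. x \<notin> N \<Longrightarrow> (\<lambda>n. \<gamma> n x) \<longlonglongrightarrow> sgn (w x)"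
    unfolding measurable_on_def by auto
  \<comment> \<open>the first factor is a cut-off that vanishes within \<open>1/n\<close> of the
    ends; the second truncates \<open>\<gamma> n\<close> to \<open>[-1,1]\<close>, which does
    not affect the limit \<open>sgn w\<close> and makes \<open>|w|\<close> a dominating function\<close>
  define \<psi> where "\<psi> n x = max 0 (min 1 (real n * min (x - a) (b - x) - 1)) * max (-1) (min 1 (\<gamma> n x))" for n :: nat and x
  have \<psi>c: "continuous_on UNIV (\<psi> n)" for n unfolding \<psi>_def by (intro continuous_intros \<gamma>)
  have \<psi>1: "\<bar>\<psi> n x\<bar> \<le> 1" for n x unfolding \<psi>_def abs_mult by (rule mult_le_one) auto
  have \<psi>0: "(LINT x|lebesgue. \<psi> n x * w x) = 0" for n
  proof (cases "n = 0")
    case True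
    then have "\<psi> n x = 0" for x by (simp add: \<psi>_def)
    then show ?thesis by simp
  next
    case False
    show ?thesis
    proof (rule orth[OF \<psi>c, of "a + 1 / real n" "b - 1 / real n"])
      fix x assume "x \<notin> {a + 1 / real n..b - 1 / real n}"
      then have "min (x - a) (b - x) \<le> 1 / real n" by auto
      then have "real n * min (x - a) (b - x) \<le> 1" using False by (simp add: field_simps)
      then show "\<psi> n x = 0" by (simp add: \<psi>_def)
    qed (use False in auto)
  qed
  have \<psi>_lim: "(\<lambda>n. \<psi> n x * w x) \<longlonglongrightarrow> \<bar>w x\<bar>" if "x \<notin> N" for x
  proof (cases "x \<in> ?S")
    case False
    then show ?thesis by (simp add: w_def)
  next
    case True
    define d where "d = min (x - a) (b - x)"
    have d: "0 < d" using True by (auto simp: d_def)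
    obtain n0 :: nat where n0: "2 / d < real n0" using reals_Archimedean2 by blast
    have "eventually (\<lambda>n. max 0 (min 1 (real n * d - 1)) = 1) sequentially"
      unfolding eventually_sequentially
    proof (intro exI[of _ n0] allI impI)
      fix n assume "n0 \<le> n"
      then have "2 / d < real n" using n0 by linarith
      then have "2 < real n * d" using d by (simp add: field_simps)
      then show "max 0 (min 1 (real n * d - 1)) = 1" by simp
    qed
    then have 1: "(\<lambda>n. max 0 (min 1 (real n * d - 1))) \<longlonglongrightarrow> 1" by (rule tendsto_eventually)
    have 2: "(\<lambda>n. max (-1) (min 1 (\<gamma> n x))) \<longlonglongrightarrow> max (-1) (min 1 (sgn (w x)))"
      by (intro tendsto_intros lim that)
    have "max (-1) (min 1 (sgn (w x))) = sgn (w x)" by (auto simp: sgn_if)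
    then have "(\<lambda>n. \<psi> n x) \<longlonglongrightarrow> 1 * sgn (w x)"
      using tendsto_mult[OF 1 2] unfolding \<psi>_def d_def by simp
    then have "(\<lambda>n. \<psi> n x * w x) \<longlonglongrightarrow> 1 * sgn (w x) * w x" by (intro tendsto_intros)
    then show ?thesis by (simp add: abs_sgn mult.commute)
  qed
  have "(\<lambda>n. LINT x|lebesgue. \<psi> n x * w x) \<longlonglongrightarrow> (LINT x|lebesgue. \<bar>w x\<bar>)"
  proof (rule integral_dominated_convergence[where w = "\<lambda>x. \<bar>w x\<bar>"])
    show "AE x in lebesgue. (\<lambda>n. \<psi> n x * w x) \<longlonglongrightarrow> \<bar>w x\<bar>"
      using N \<psi>_lim by (auto simp: negligible_iff_null_sets intro: AE_I')
    show "AE x in lebesgue. norm (\<psi> n x * w x) \<le> \<bar>w x\<bar>" for n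
      using mult_right_mono[OF \<psi>1] by (auto simp: abs_mult intro!: AE_I2) 
    show "(\<lambda>x. \<psi> n x * w x) \<in> borel_measurable lebesgue" for n
      using borel_measurable_continuous_onI[OF \<psi>c[of n]] w_m by (intro borel_measurable_times) (auto simp: measurable_completion)
  qed (use w_m wI in auto)
  then have "(LINT x|lebesgue. \<bar>w x\<bar>) = 0" unfolding \<psi>0 by (simp add: LIMSEQ_const_iff)
  then have "AE x in lebesgue. w x = 0"
    using integral_nonneg_eq_0_iff_AE[OF integrable_abs[OF wI]] by simp
  then have "AE x in lebesgue. x \<in> ?S \<longrightarrow> g x = c + H x"
    by eventually_elim (auto simp: w_def)
  then show ?thesis unfolding H_def by blast
qed

text \<open>
  Values outside the open interval are normalised to zero, so that representatives on adjacent
  intervals can be added.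
\<close>

definition BV_representative :: "real \<Rightarrow> real \<Rightarrow> (real \<Rightarrow> 'a::euclidean_space) \<Rightarrow> (real \<Rightarrow> 'a) \<Rightarrow> bool" where
  "BV_representative a b g w \<longleftrightarrow> w \<in> borel_measurable borel \<and> (\<exists>W. variation_le w W) \<and>
     (\<forall>x. x \<notin> {a<..<b} \<longrightarrow> w x = 0) \<and> (AE x in lebesgue. x \<in> {a<..<b} \<longrightarrow> g x = w x)"

lemma W11_real_BV:
  fixes g :: "real \<Rightarrow> real"
  assumes ab: "a < b" and "W11 a b g"
  shows "\<exists>w. BV_representative a b g w"
proof -
  let ?S = "{a<..<b}"
  obtain h where g: "set_integrable lebesgue ?S g" and h: "set_integrable lebesgue ?S h"
    and weak: "\<And>\<phi> \<phi>'. test_function a b \<phi> \<phi>' \<Longrightarrow>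
       (LINT x:?S|lebesgue. \<phi>' x *\<^sub>R g x) = - (LINT x:?S|lebesgue. \<phi> x *\<^sub>R h x)"
    using assms(2) unfolding W11_def by blast
  have h_int: "integrable lebesgue (\<lambda>x. indicat_real ?S x *\<^sub>R h x)" using h unfolding set_integrable_def .
  obtain h' where h'[measurable]: "h' \<in> borel_measurable lborel" and ae: "AE x in lborel. indicat_real ?S x *\<^sub>R h x = h' x"
    using completion_ex_borel_measurable_real[OF borel_measurable_integrable[OF h_int]] by auto
  define k where "k x = indicat_real ?S x * h' x" for x
  have [measurable]: "k \<in> borel_measurable borel" using h' by (simp add: k_def[abs_def])
  have k_ae: "AE x in lebesgue. indicat_real ?S x *\<^sub>R h x = k x"
    using ae by (rule AE_completion[OF AE_mp]) (auto simp: k_def indicator_def intro!: AE_I2)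
  have k_m: "k \<in> borel_measurable lebesgue" by (simp add: measurable_completion)
  have "integrable lebesgue k"
    using integrable_cong_AE[THEN iffD1, OF borel_measurable_integrable[OF h_int] k_m k_ae h_int] .
  then have k_int: "integrable lborel k" by (simp add: integrable_completion)
  have "\<exists>c. AE x in lebesgue. x \<in> ?S \<longrightarrow> g x = c + (LINT t:{..x}|lborel. k t)"
  proof (rule du_Bois_Reymond[OF ab g _ k_int])
    fix \<phi> \<phi>' assume t: "test_function a b \<phi> \<phi>'"
    have \<phi>: "continuous_on UNIV \<phi>"
      using t unfolding test_function_def by (auto intro!: continuous_at_imp_continuous_on DERIV_isCont)
    then have [measurable]: "\<phi> \<in> borel_measurable borel" by (rule borel_measurable_continuous_onI)
    have "(LINT x:?S|lebesgue. \<phi> x *\<^sub>R h x) = (LINT x|lebesgue. indicat_real ?S x *\<^sub>R (\<phi> x * k x))"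
      unfolding set_lebesgue_integral_def
    proof (rule integral_cong_AE)
      show "(\<lambda>x. indicat_real ?S x *\<^sub>R \<phi> x *\<^sub>R h x) \<in> borel_measurable lebesgue"
        using set_integrable_scaleR_continuous[OF \<phi> h] unfolding set_integrable_def by (rule borel_measurable_integrable)
      show "(\<lambda>x. indicat_real ?S x *\<^sub>R (\<phi> x * k x)) \<in> borel_measurable lebesgue"
        by (rule measurable_completion) simp
      show "AE x in lebesgue. indicat_real ?S x *\<^sub>R \<phi> x *\<^sub>R h x = indicat_real ?S x *\<^sub>R (\<phi> x * k x)"
        using k_ae by eventually_elim (auto simp: indicator_def)
    qed
    also have "\<dots> = (LINT x:?S|lborel. \<phi> x * k x)"
      unfolding set_lebesgue_integral_def by (rule integral_completion) simp
    finally show "(LINT x:?S|lebesgue. \<phi>' x * g x) = - (LINT x:?S|lborel. \<phi> x * k x)"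
      using weak[OF t] by simp
  qed (auto simp: k_def)
  then obtain c where c: "AE x in lebesgue. x \<in> ?S \<longrightarrow> g x = c + (LINT t:{..x}|lborel. k t)" by blast
  note P = integrable_primitive_variation[OF \<open>k \<in> borel_measurable borel\<close> k_int]
  define I where "I = (LINT t|lborel. \<bar>k t\<bar>)"
  define w where "w x = indicat_real ?S x *\<^sub>R (c + (LINT t:{..x}|lborel. k t))" for x
  have "variation_le (\<lambda>x. c + (LINT t:{..x}|lborel. k t)) (0 + I)"
    unfolding I_def by (intro variation_le_add variation_le_const P)
  then have "variation_le w (1 * (0 + I) + 2 * (\<bar>c\<bar> + I))"
    unfolding w_def
    by (rule variation_le_scaleR[OF _ variation_le_indicator_interval(2)])
      (use P(3) in \<open>auto simp: indicator_def I_def intro: order_trans[OF abs_triangle_ineq]\<close>)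
  moreover have "w \<in> borel_measurable borel" unfolding w_def using P(1) by measurable
  moreover have "AE x in lebesgue. x \<in> ?S \<longrightarrow> g x = w x" using c by eventually_elim (auto simp: w_def)
  ultimately have "BV_representative a b g w" unfolding BV_representative_def by (auto simp: w_def)
  then show ?thesis by (intro exI[of _ w])
qed

lemma W11_BV:
  fixes g :: "real \<Rightarrow> (real, 'n::finite) vec"
  assumes ab: "a < b" and W: "W11 a b g"
  shows "\<exists>w. BV_representative a b g w"
proof -
  have "\<forall>k. \<exists>w. BV_representative a b (\<lambda>x. g x $ k) w"
    using W11_real_BV[OF ab W11_component[OF W]] by blast
  then obtain w where w: "\<And>k. BV_representative a b (\<lambda>x. g x $ k) (w k)" by metis
  obtain V where V: "\<And>k. variation_le (w k) (V k)" using w unfolding BV_representative_def by metis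
  have "variation_le (\<lambda>x. \<chi> k. w k x) (\<Sum>k\<in>UNIV. 1 * V k)"
    by (rule variation_le_sum_bound[OF _ V]) (auto intro!: order_trans[OF norm_le_l1_cart])
  moreover have "(\<lambda>x. \<chi> k. w k x) \<in> borel_measurable borel"
    by (rule borel_measurable_vec_lambda) (use w in \<open>auto simp: BV_representative_def\<close>)
  moreover have "AE x in lebesgue. \<forall>k. x \<in> {a<..<b} \<longrightarrow> g x $ k = w k x"
    using w by (intro AE_all_countable[THEN iffD2]) (auto simp: BV_representative_def)
  then have "AE x in lebesgue. x \<in> {a<..<b} \<longrightarrow> g x = (\<chi> k. w k x)"
    by eventually_elim (auto simp: vec_eq_iff)
  ultimately have "BV_representative a b g (\<lambda>x. \<chi> k. w k x)"
    using w unfolding BV_representative_def by (auto simp: vec_eq_iff)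
  then show ?thesis by (intro exI[of _ "\<lambda>x. \<chi> k. w k x"])
qed

lemma piecewise_W11_BV:
  fixes g :: "real \<Rightarrow> (real, 'n::finite) vec"
  assumes "piecewise_on W11 a b g"
  shows "\<exists>w. BV_representative a b g w"
proof -
  obtain K p where p: "p 0 = a" "p K = b" and step: "\<And>i. i < K \<Longrightarrow> p i < p (Suc i) \<and> W11 (p i) (p (Suc i)) g"
    using assms unfolding piecewise_on_def by blast
  have "k \<le> K \<Longrightarrow> p 0 \<le> p k \<and> (\<exists>w. BV_representative (p 0) (p k) g w)" for k
  proof (induction k)
    case 0
    have "BV_representative (p 0) (p 0) g (\<lambda>x. 0)"
      unfolding BV_representative_def using variation_le_const by auto
    then show ?case by blast
  next
    case (Suc k)
    then obtain w where k: "p 0 \<le> p k" "BV_representative (p 0) (p k) g w" by auto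
    have lt: "p k < p (Suc k)" "W11 (p k) (p (Suc k)) g" using step[of k] Suc.prems by auto
    obtain w' where w': "BV_representative (p k) (p (Suc k)) g w'" using W11_BV[OF lt] by (rule exE)
    obtain V V' where V: "variation_le w V" "variation_le w' V'"
      using k(2) w' unfolding BV_representative_def by blast
    have "AE x in lebesgue. x \<in> {p 0<..<p (Suc k)} \<longrightarrow> g x = w x + w' x"
    proof -
      have "AE x in lebesgue. x \<noteq> p k" using AE_completion[OF AE_lborel_singleton[of "p k"]] .
      moreover have "AE x in lebesgue. x \<in> {p 0<..<p k} \<longrightarrow> g x = w x" "AE x in lebesgue. x \<in> {p k<..<p (Suc k)} \<longrightarrow> g x = w' x"
        using k(2) w' unfolding BV_representative_def by auto
      ultimately show ?thesis
      proof eventually_elim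
        case (elim x)
        show ?case
        proof
          assume x: "x \<in> {p 0<..<p (Suc k)}"
          have "w x = 0" if "p k < x" using k(2) that unfolding BV_representative_def by auto
          moreover have "w' x = 0" if "x < p k" using w' that unfolding BV_representative_def by auto
          ultimately show "g x = w x + w' x" using elim x by (cases "x < p k") auto
        qed
      qed
    qed
    then have "BV_representative (p 0) (p (Suc k)) g (\<lambda>x. w x + w' x)"
      using k w' lt variation_le_add[OF V] unfolding BV_representative_def by auto
    then show ?case using k(1) lt by auto
  qed
  from this[of K] show ?thesis using p by simp
qed


section \<open>The boundary value problem in characteristic coordinates\<close>

text \<open>
  Solutions are defined by Lebesgue integrals of functions that are only almost everywhere equal
  to Borel functions; completeness makes such a function measurable.
\<close>

lemma integral_lebesgue_eq_lborel:
  fixes f g :: "real \<Rightarrow> real"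
  assumes g: "g \<in> borel_measurable borel" and ae: "AE x in lborel. f x = g x"
  shows "(LINT x|lebesgue. f x) = (LINT x|lborel. g x)"
proof -
  have gm: "g \<in> borel_measurable lebesgue" using g by (simp add: measurable_completion)
  have ae': "AE x in lebesgue. f x = g x" by (rule AE_completion[OF ae])
  have "f \<in> borel_measurable lebesgue"
  proof (rule measurableI)
    fix A :: "real set" assume A: "A \<in> sets borel"
    have N: "{x. f x \<noteq> g x} \<in> null_sets lebesgue"
      using ae' by (subst (asm) completion.AE_iff_null_sets) auto
    have eq: "f -` A \<inter> space lebesgue = ((g -` A \<inter> space lebesgue) - {x. f x \<noteq> g x}) \<union> (f -` A \<inter> {x. f x \<noteq> g x})" by auto
    have "f -` A \<inter> {x. f x \<noteq> g x} \<in> null_sets lebesgue"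
      by (rule completion.complete2[OF _ N]) auto
    then show "f -` A \<inter> space lebesgue \<in> sets lebesgue"
      unfolding eq by (intro sets.Un sets.Diff measurable_sets[OF gm A] null_setsD2[OF N] null_setsD2)
  qed simp
  then have "(LINT x|lebesgue. f x) = (LINT x|lebesgue. g x)" by (rule integral_cong_AE[OF _ gm ae'])
  also have "\<dots> = (LINT x|lborel. g x)" by (rule integral_completion) (use g in simp)
  finally show ?thesis .
qed

context transport
begin

lemma AE_X_\<theta>:
  assumes "AE x in lborel. P x" shows "AE s in lborel. P (X k (c + \<theta> i s))"
proof -
  obtain N where N: "{x \<in> space lborel. \<not> P x} \<subseteq> N" "emeasure lborel N = 0" "N \<in> sets lborel"
    using AE_E[OF assms] .
  have [measurable]: "N \<in> sets borel" using N(3) by simp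
  have "(\<integral>\<^sup>+s. indicator N (X k (c + \<theta> i s)) \<partial>lborel) \<le> ennreal (\<kappa>\<^sup>2) * (\<integral>\<^sup>+x. indicator N x \<partial>lborel)"
    by (rule X_\<theta>_transport) simp
  also have "\<dots> = 0" using N by simp
  finally have "AE s in lborel. indicator N (X k (c + \<theta> i s)) = (0::ennreal)"
    by (subst (asm) le_zero_eq, subst (asm) nn_integral_0_iff_AE) auto
  then show ?thesis by eventually_elim (use N(1) in \<open>auto simp: indicator_def split: if_splits\<close>)
qed

lemma AE_diff_\<theta>:
  assumes "AE x in lborel. P x" shows "AE s in lborel. P (c - \<theta> i s)"
proof -
  obtain N where N: "{x \<in> space lborel. \<not> P x} \<subseteq> N" "emeasure lborel N = 0" "N \<in> sets lborel"
    using AE_E[OF assms] .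
  have [measurable]: "N \<in> sets borel" using N(3) by simp
  have "(\<integral>\<^sup>+s. indicator N (c - \<theta> i s) \<partial>lborel) \<le> ennreal \<kappa> * (\<integral>\<^sup>+z. indicator N (c - z) \<partial>lborel)"
    by (rule \<theta>_transport[where f = "\<lambda>z. indicator N (c - z)"]) simp
  also have "(\<integral>\<^sup>+z. indicator N (c - z) \<partial>lborel) = (\<integral>\<^sup>+x. indicator N x \<partial>lborel)"
    using nn_integral_real_affine[of "indicator N" "-1" c] by simp
  also have "\<dots> = 0" using N by simp
  finally have "AE s in lborel. indicator N (c - \<theta> i s) = (0::ennreal)"
    by (simp, subst (asm) nn_integral_0_iff_AE) auto
  then show ?thesis by eventually_elim (use N(1) in \<open>auto simp: indicator_def split: if_splits\<close>)
qed

text \<open>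
  A null set of the plane meets almost every characteristic in a null set of times. This allows a
  change of representative of a state under the integrals along characteristics.
\<close>

lemma AE_along_leg:
  assumes "AE p in lborel \<Otimes>\<^sub>M lborel. P p" shows "AE s in lborel. AE t in lborel. P (t, X k (c + \<theta> i s + t))"
proof -
  obtain N where N: "{p \<in> space (lborel \<Otimes>\<^sub>M lborel). \<not> P p} \<subseteq> N" "emeasure (lborel \<Otimes>\<^sub>M lborel) N = 0" "N \<in> sets (lborel \<Otimes>\<^sub>M lborel)"
    using AE_E[OF assms] .
  have [measurable]: "N \<in> sets (borel \<Otimes>\<^sub>M borel)" using N(3) by (simp cong: sets_pair_measure_cong)
  define F :: "real \<Rightarrow> real \<Rightarrow> ennreal" where "F t x = indicator N (t, x)" for t x
  have F: "jointly_borel F" by (rule jointly_borelI) (simp add: F_def)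
  have Fm[measurable]: "(\<lambda>q. F (snd q) (X k (c + \<theta> i (fst q) + snd q))) \<in> borel_measurable (lborel \<Otimes>\<^sub>M lborel)"
    by (rule jointly_borel_compose[OF F]) auto
  have [measurable]: "F t \<in> borel_measurable borel" for t by (rule jointly_borel_space[OF F])
  have "(\<integral>\<^sup>+s. (\<integral>\<^sup>+t. F t (X k (c + \<theta> i s + t)) \<partial>lborel) \<partial>lborel) = (\<integral>\<^sup>+t. (\<integral>\<^sup>+s. F t (X k (c + \<theta> i s + t)) \<partial>lborel) \<partial>lborel)"
    by (rule lborel_pair.Fubini'[symmetric]) (use measurable_compose[OF measurable_pair_swap' Fm] in \<open>simp add: split_beta'\<close>)
  also have "\<dots> \<le> (\<integral>\<^sup>+t. ennreal (\<kappa>\<^sup>2) * (\<integral>\<^sup>+x. F t x \<partial>lborel) \<partial>lborel)"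
  proof (rule nn_integral_mono)
    fix t
    show "(\<integral>\<^sup>+s. F t (X k (c + \<theta> i s + t)) \<partial>lborel) \<le> ennreal (\<kappa>\<^sup>2) * (\<integral>\<^sup>+x. F t x \<partial>lborel)"
      using X_\<theta>_transport[of "F t" k "c + t" i] by (simp add: algebra_simps)
  qed
  also have "\<dots> = 0"
  proof -
    have "(\<integral>\<^sup>+t. (\<integral>\<^sup>+x. F t x \<partial>lborel) \<partial>lborel) = emeasure (lborel \<Otimes>\<^sub>M lborel) N"
      unfolding F_def using lborel.emeasure_pair_measure[OF N(3)] by simp
    then have z: "(\<integral>\<^sup>+t. (\<integral>\<^sup>+x. F t x \<partial>lborel) \<partial>lborel) = 0" using N by simp
    have [measurable]: "(\<lambda>t. \<integral>\<^sup>+x. F t x \<partial>lborel) \<in> borel_measurable lborel"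
      using jointly_borel_compose[OF F, of fst "lborel \<Otimes>\<^sub>M lborel" snd]
      by (intro lborel.borel_measurable_nn_integral) (simp add: split_beta')
    show ?thesis by (subst nn_integral_cmult) (auto simp: z)
  qed
  finally have "(\<integral>\<^sup>+s. (\<integral>\<^sup>+t. F t (X k (c + \<theta> i s + t)) \<partial>lborel) \<partial>lborel) = 0" by simp
  moreover have "(\<lambda>s. \<integral>\<^sup>+t. F t (X k (c + \<theta> i s + t)) \<partial>lborel) \<in> borel_measurable lborel"
    by (intro lborel.borel_measurable_nn_integral) (use Fm in \<open>simp add: split_beta'\<close>)
  ultimately have "AE s in lborel. (\<integral>\<^sup>+t. F t (X k (c + \<theta> i s + t)) \<partial>lborel) = 0"
    by (subst (asm) nn_integral_0_iff_AE) auto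
  then show ?thesis
  proof eventually_elim
    case (elim s)
    have "(\<lambda>t. F t (X k (c + \<theta> i s + t))) \<in> borel_measurable lborel"
      by (rule jointly_borel_compose[OF F]) auto
    then have "AE t in lborel. F t (X k (c + \<theta> i s + t)) = 0"
      using elim by (subst (asm) nn_integral_0_iff_AE) auto
    then show ?case by eventually_elim (use N(1) in \<open>auto simp: F_def indicator_def space_pair_measure split: if_splits\<close>)
  qed
qed

end

text \<open>
  The problem together with the objects obtained from its hypotheses: the characteristic
  coordinates, representatives \<open>y0\<close> and \<open>d'\<close> of the data, and a version
  \<open>h\<close> of the source in which \<open>u\<close> has been replaced by a Lipschitz
  function that agrees with it on \<open>(0,T1)\<close>. No characteristic crosses the domain
  within the time \<open>T1\<close>.
\<close>

locale relaxed_ibvp =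
  fixes L :: real and r :: nat
    and lam :: "'n::{finite,linorder} \<Rightarrow> real \<Rightarrow> real"
    and G :: "'n rmat"
    and d :: "real \<Rightarrow> 'n rvec" and ybar :: "real \<Rightarrow> 'n rvec"
    and f :: "'n rvec \<Rightarrow> 'u::real_normed_vector \<Rightarrow> 'v::real_normed_vector \<Rightarrow> 'n rvec"
    and v :: "'m::finite \<Rightarrow> 'v" and u :: "real \<Rightarrow> 'u"
    and \<theta> X :: "'n \<Rightarrow> real \<Rightarrow> real" and \<Theta> :: "'n \<Rightarrow> real" and \<kappa> :: real
    and d' y0 :: "real \<Rightarrow> 'n rvec"
    and h :: "'m \<Rightarrow> real \<Rightarrow> 'n rvec \<Rightarrow> 'n rvec" and T1 :: real
  assumes L_pos: "0 < L"
    and chars: "\<And>i. characteristic_coordinate L (lam i) (\<theta> i) (X i) (\<Theta> i) \<kappa> (if i \<in> first_indices r then 0 else L)"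
    and T1: "0 < T1" "\<And>i. T1 \<le> \<Theta> i"
    and y0: "BV_representative 0 L ybar y0" and d': "BV_representative 0 T1 d d'"
    and h_eq: "\<And>j t p. t \<in> {0<..<T1} \<Longrightarrow> h j t p = f p (u t) (v j)"
    and h_borel': "\<And>j. (\<lambda>q. h j (fst q) (snd q)) \<in> borel_measurable (borel \<Otimes>\<^sub>M borel)"
    and h_zero': "\<And>j t. h j t 0 = 0"
    and h_local_Lipschitz: "\<And>R. 0 \<le> R \<Longrightarrow> \<exists>K\<ge>0. \<forall>j t t' p p'. norm p \<le> R \<longrightarrow> norm p' \<le> R \<longrightarrow>
          norm (h j t p - h j t' p') \<le> K * (\<bar>t - t'\<bar> + norm (p - p'))"
begin

definition outlet :: "'n \<Rightarrow> real" where "outlet k = (if k \<in> first_indices r then 0 else L)"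

lemma coord: "characteristic_coordinate L (lam i) (\<theta> i) (X i) (\<Theta> i) \<kappa> (outlet i)"
  unfolding outlet_def by (rule chars)

text \<open>
  The datum carried by the characteristic with label \<open>z\<close>: for \<open>z < 0\<close> it
  is created at the inlet at time \<open>- z\<close>, where component \<open>k\<close> brings to
  its outlet the initial value from \<open>X k (\<Theta> k + z)\<close>.
\<close>

definition D :: "'n \<Rightarrow> real \<Rightarrow> real" where
  "D i z = (if z < 0 then d' (- z) $ i + (\<Sum>k\<in>UNIV. G $ i $ k * y0 (X k (\<Theta> k + z)) $ k) else y0 (X i z) $ i)"

sublocale transport L \<kappa> \<theta> X \<Theta> G
proof
  fix i
  interpret characteristic_coordinate L "lam i" "\<theta> i" "X i" "\<Theta> i" \<kappa> "outlet i" by (rule coord)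
  show "0 \<le> L" using L_pos by simp
  show "1 \<le> \<kappa>" by (rule \<kappa>)
  show "\<theta> i \<in> borel_measurable borel" "X i \<in> borel_measurable borel"
    using cont by (auto intro: borel_measurable_continuous_onI)
  show "mono (\<theta> i) \<or> antimono (\<theta> i)" "mono (X i) \<or> antimono (X i)" by (rule monotone)+
  show "(\<integral>\<^sup>+x. f (\<theta> i x) \<partial>lborel) \<le> ennreal \<kappa> * (\<integral>\<^sup>+x. f x \<partial>lborel)"
    "(\<integral>\<^sup>+x. f (X i x) \<partial>lborel) \<le> ennreal \<kappa> * (\<integral>\<^sup>+x. f x \<partial>lborel)"
    if "f \<in> borel_measurable borel" for f using transport_\<theta> transport_X that by auto
qed

lemma y0_borel [measurable]: "y0 \<in> borel_measurable borel" and d'_borel [measurable]: "d' \<in> borel_measurable borel"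
  using y0 d' unfolding BV_representative_def by auto

sublocale semilinear_transport L \<kappa> \<theta> X \<Theta> G h D
proof
  show "D i \<in> borel_measurable borel" for i unfolding D_def[abs_def] by measurable
qed (rule h_borel' h_zero')+

lemma X_in_iff: "X k z \<in> {0..L} \<longleftrightarrow> z \<in> {0..\<Theta> k}"
proof -
  interpret characteristic_coordinate L "lam k" "\<theta> k" "X k" "\<Theta> k" \<kappa> "outlet k" by (rule coord)
  show ?thesis using range[of "X k z"] by (simp add: \<theta>_X)
qed

lemma \<theta>_in: "x \<in> {0..L} \<Longrightarrow> \<theta> k x \<in> {0..\<Theta> k}"
  using characteristic_coordinate.range[OF coord] by blast

lemma \<theta>_outlet: "\<theta> k (outlet k) = \<Theta> k"
  by (rule characteristic_coordinate.outlet[OF coord])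

lemma outlet_in: "outlet k \<in> {0..L}"
  by (rule characteristic_coordinate.outlet_in[OF coord])

definition source_integral :: "(real \<Rightarrow> real ^ 'm) \<Rightarrow> (real \<Rightarrow> real \<Rightarrow> 'n rvec) \<Rightarrow> 'n \<Rightarrow> real \<Rightarrow> real \<Rightarrow> real \<Rightarrow> real" where
  "source_integral \<beta> y k a b \<zeta> = (\<Sum>j\<in>UNIV. LINT t:{a..b}|lebesgue. \<beta> t $ j * f (y t (X k (\<zeta> + t))) (u t) (v j) $ k)"

text \<open>
  The recursion for \<open>\<psi>\<close> after one reflection, with the given data and the given
  representative of \<open>y\<close>; \<open>Psi\<close> is the same expression with Borel
  representatives and sources extended by zero.
\<close>

definition explicit_psi :: "(real \<Rightarrow> real ^ 'm) \<Rightarrow> (real \<Rightarrow> real \<Rightarrow> 'n rvec) \<Rightarrow> real \<Rightarrow> real \<Rightarrow> 'n \<Rightarrow> real" where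
  "explicit_psi \<beta> y \<tau> \<sigma> i = (let z = - \<tau> + \<theta> i \<sigma> in
     if z < 0 then (\<Sum>k\<in>UNIV. G $ i $ k * (ybar (X k (\<Theta> k + z)) $ k + source_integral \<beta> y k 0 (- z) (\<Theta> k + z))) + d (- z) $ i
                     + source_integral \<beta> y i (- z) \<tau> z
     else ybar (X i z) $ i + source_integral \<beta> y i 0 \<tau> z)"

lemma char_leg_eq:
  assumes "\<sigma> \<in> {0..L}" "0 \<le> \<tau>" "ts = exit_time (lam i) L \<tau> \<sigma>"
  shows "(\<Sum>j\<in>UNIV. LINT t:{ts..\<tau>}|lebesgue. \<beta> t $ j * f (y t (char_curve (lam i) L \<tau> \<sigma> t)) (u t) (v j) $ i)
     = source_integral \<beta> y i ts \<tau> (- \<tau> + \<theta> i \<sigma>)"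
  unfolding source_integral_def
  by (intro sum.cong refl set_lebesgue_integral_cong)
    (use characteristic_coordinate.char_curve_eq[OF coord assms(1,2)] assms(3) in auto)

lemma psi_equation_iff:
  assumes T: "T < T1" and \<tau>: "\<tau> \<in> {0..T}" and \<sigma>: "\<sigma> \<in> {0..L}"
  shows "(let ts = exit_time (lam i) L \<tau> \<sigma>;
            s = char_curve (lam i) L \<tau> \<sigma>;
            Y = (if ts > 0
                 then G *v (\<chi> k. if k \<in> first_indices r then psi ts 0 $ k else psi ts L $ k) + d ts
                 else ybar (s ts))
        in psi \<tau> \<sigma> $ i =
             Y $ i + (\<Sum>j\<in>UNIV. LINT t:{ts..\<tau>}|lebesgue. \<beta> t $ j * f (y t (s t)) (u t) (v j) $ i))
     \<longleftrightarrow> psi \<tau> \<sigma> $ i = (if - \<tau> + \<theta> i \<sigma> < 0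
           then (\<Sum>k\<in>UNIV. G $ i $ k * psi (\<tau> - \<theta> i \<sigma>) (outlet k) $ k) + d (\<tau> - \<theta> i \<sigma>) $ i + source_integral \<beta> y i (\<tau> - \<theta> i \<sigma>) \<tau> (- \<tau> + \<theta> i \<sigma>)
           else ybar (X i (- \<tau> + \<theta> i \<sigma>)) $ i + source_integral \<beta> y i 0 \<tau> (- \<tau> + \<theta> i \<sigma>))"
proof -
  have \<tau>0: "0 \<le> \<tau>" using \<tau> by simp
  have ts: "exit_time (lam i) L \<tau> \<sigma> = max 0 (\<tau> - \<theta> i \<sigma>)"
    by (rule characteristic_coordinate.exit_time_eq[OF coord \<sigma> \<tau>0])
  show ?thesis
  proof (cases "- \<tau> + \<theta> i \<sigma> < 0")
    case True
    then have ts': "exit_time (lam i) L \<tau> \<sigma> = \<tau> - \<theta> i \<sigma>" using ts by simp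
    have "(G *v (\<chi> k. if k \<in> first_indices r then psi (\<tau> - \<theta> i \<sigma>) 0 $ k else psi (\<tau> - \<theta> i \<sigma>) L $ k)) $ i
        = (\<Sum>k\<in>UNIV. G $ i $ k * psi (\<tau> - \<theta> i \<sigma>) (outlet k) $ k)"
      unfolding matrix_vector_mult_def by (auto simp: outlet_def intro!: sum.cong)
    then show ?thesis
      using True char_leg_eq[OF \<sigma> \<tau>0 ts'[symmetric], of \<beta> y] unfolding Let_def ts' by simp
  next
    case False
    then have ts': "exit_time (lam i) L \<tau> \<sigma> = 0" using ts by simp
    have "char_curve (lam i) L \<tau> \<sigma> 0 = X i (- \<tau> + \<theta> i \<sigma>)"
      using characteristic_coordinate.char_curve_eq[OF coord \<sigma> \<tau>0, of 0] ts' \<tau>0 by simp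
    then show ?thesis
      using False char_leg_eq[OF \<sigma> \<tau>0 ts'[symmetric], of \<beta> y] unfolding Let_def ts' by simp
  qed
qed

lemma explicit_psi_outlet:
  assumes "T < T1" "ts \<in> {0..T}"
  shows "explicit_psi \<beta> y ts (outlet k) k = ybar (X k (\<Theta> k - ts)) $ k + source_integral \<beta> y k 0 ts (\<Theta> k - ts)"
  using assms T1(2)[of k] by (simp add: explicit_psi_def \<theta>_outlet Let_def)

text \<open>
  At an outlet point the backward characteristic reaches the initial line, since \<open>\<tau> <
  T1 \<le> \<Theta> k\<close>; substituting these values into the boundary condition removes the
  recursion.
\<close>

lemma is_psi_iff_explicit:
  assumes T: "T < T1"
  shows "is_psi L r lam G d ybar f v u \<beta> T y psi \<longleftrightarrow> (\<forall>\<tau>\<in>{0..T}. \<forall>\<sigma>\<in>{0..L}. \<forall>i. psi \<tau> \<sigma> $ i = explicit_psi \<beta> y \<tau> \<sigma> i)"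
proof -
  let ?rhs = "\<lambda>\<tau> \<sigma> i. (if - \<tau> + \<theta> i \<sigma> < 0
           then (\<Sum>k\<in>UNIV. G $ i $ k * psi (\<tau> - \<theta> i \<sigma>) (outlet k) $ k) + d (\<tau> - \<theta> i \<sigma>) $ i + source_integral \<beta> y i (\<tau> - \<theta> i \<sigma>) \<tau> (- \<tau> + \<theta> i \<sigma>)
           else ybar (X i (- \<tau> + \<theta> i \<sigma>)) $ i + source_integral \<beta> y i 0 \<tau> (- \<tau> + \<theta> i \<sigma>))"
  have eq: "is_psi L r lam G d ybar f v u \<beta> T y psi \<longleftrightarrow> (\<forall>\<tau>\<in>{0..T}. \<forall>\<sigma>\<in>{0..L}. \<forall>i. psi \<tau> \<sigma> $ i = ?rhs \<tau> \<sigma> i)"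
    unfolding is_psi_def using psi_equation_iff[OF T, where \<beta> = \<beta> and y = y and psi = psi] by blast
  have out: "?rhs ts (outlet k) k = explicit_psi \<beta> y ts (outlet k) k" if "ts \<in> {0..T}" for ts k
    using that T T1(2)[of k] by (simp add: explicit_psi_def \<theta>_outlet Let_def)
  have rhs_explicit: "?rhs \<tau> \<sigma> i = explicit_psi \<beta> y \<tau> \<sigma> i"
    if \<tau>: "\<tau> \<in> {0..T}" and \<sigma>: "\<sigma> \<in> {0..L}" and o: "\<And>ts k. ts \<in> {0..T} \<Longrightarrow> psi ts (outlet k) $ k = explicit_psi \<beta> y ts (outlet k) k" for \<tau> \<sigma> i
  proof (cases "- \<tau> + \<theta> i \<sigma> < 0")
    case True
    have ts: "\<tau> - \<theta> i \<sigma> \<in> {0..T}" using True \<tau> \<theta>_in[OF \<sigma>, of i] by auto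
    have "psi (\<tau> - \<theta> i \<sigma>) (outlet k) $ k = ybar (X k (\<Theta> k + (- \<tau> + \<theta> i \<sigma>))) $ k + source_integral \<beta> y k 0 (\<tau> - \<theta> i \<sigma>) (\<Theta> k + (- \<tau> + \<theta> i \<sigma>))" for k
      using o[OF ts, of k] explicit_psi_outlet[OF T ts, of \<beta> y k] by (simp add: algebra_simps)
    then show ?thesis using True by (simp add: explicit_psi_def Let_def)
  next
    case False
    then show ?thesis by (simp add: explicit_psi_def Let_def)
  qed
  show ?thesis
    unfolding eq
  proof (intro iffI ballI allI)
    fix \<tau> \<sigma> i assume A: "\<forall>\<tau>\<in>{0..T}. \<forall>\<sigma>\<in>{0..L}. \<forall>i. psi \<tau> \<sigma> $ i = ?rhs \<tau> \<sigma> i" and \<tau>: "\<tau> \<in> {0..T}" and \<sigma>: "\<sigma> \<in> {0..L}"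
    have "psi ts (outlet k) $ k = explicit_psi \<beta> y ts (outlet k) k" if "ts \<in> {0..T}" for ts k
      using A[rule_format, OF that outlet_in[of k], of k] out[OF that, of k] by simp
    from rhs_explicit[OF \<tau> \<sigma> this, of i] A[rule_format, OF \<tau> \<sigma>, of i] show "psi \<tau> \<sigma> $ i = explicit_psi \<beta> y \<tau> \<sigma> i" by simp
  next
    fix \<tau> \<sigma> i assume A: "\<forall>\<tau>\<in>{0..T}. \<forall>\<sigma>\<in>{0..L}. \<forall>i. psi \<tau> \<sigma> $ i = explicit_psi \<beta> y \<tau> \<sigma> i" and \<tau>: "\<tau> \<in> {0..T}" and \<sigma>: "\<sigma> \<in> {0..L}"
    have "psi ts (outlet k) $ k = explicit_psi \<beta> y ts (outlet k) k" if "ts \<in> {0..T}" for ts k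
      using A[rule_format, OF that outlet_in[of k], of k] .
    from rhs_explicit[OF \<tau> \<sigma> this, of i] A[rule_format, OF \<tau> \<sigma>, of i] show "psi \<tau> \<sigma> $ i = ?rhs \<tau> \<sigma> i" by simp
  qed
qed

end

context relaxed_ibvp
begin

definition trunc :: "real \<Rightarrow> (real \<Rightarrow> real ^ 'm) \<Rightarrow> real \<Rightarrow> real ^ 'm" where
  "trunc T \<beta> t = indicat_real {0..T} t *\<^sub>R \<beta> t"

lemma source_Lipschitz_exists:
  assumes "0 \<le> R" shows "\<exists>K. source_Lipschitz R K"
  using h_local_Lipschitz[OF assms] assms unfolding source_Lipschitz_def by blast

lemma state_mono: "state R w \<Longrightarrow> R \<le> R' \<Longrightarrow> state R' w"
  unfolding state_def by (meson order_trans)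

lemma state_nonneg: "state R w \<Longrightarrow> 0 \<le> R"
  using stateD(2) norm_ge_zero order_trans by blast

lemma leg_source_outside:
  assumes w: "state R w" and out: "\<And>t. t \<in> {0..\<tau>} \<Longrightarrow> X k (\<zeta> + t) \<notin> {0..L}"
  shows "leg (source_term b w) k \<tau> \<zeta> = 0"
proof -
  have "(LINT t:{0..\<tau>}|lborel. source_term b w t (X k (\<zeta> + t)) $ k) = (LINT t:{0..\<tau>}|lborel. 0)"
    by (rule set_lebesgue_integral_cong)
      (use stateD(3)[OF w out] in \<open>auto simp: source_term_def h_zero\<close>)
  then show ?thesis unfolding leg_def by (simp add: set_lebesgue_integral_def)
qed

text \<open>
  The interval \<open>[a,b]\<close> is the part of \<open>[0,\<tau>]\<close> during which the
  characteristic lies in the domain; elsewhere the extended source vanishes. The time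
  \<open>0\<close>, where \<open>u\<close> may differ from its Lipschitz version, is negligible.
\<close>

lemma source_integral_eq_leg:
  assumes T: "T < T1" and \<tau>: "\<tau> \<in> {0..T}" and b: "weights T (trunc T \<beta>)" and w: "state R w"
    and ab: "0 \<le> a" "b \<le> \<tau>"
    and inside: "\<And>t. t \<in> {a..b} \<Longrightarrow> X k (\<zeta> + t) \<in> {0..L}"
    and outside: "\<And>t. t \<in> {0..\<tau>} \<Longrightarrow> t \<notin> {a..b} \<Longrightarrow> X k (\<zeta> + t) \<notin> {0..L}"
    and ae: "AE t in lborel. t \<in> {0..T} \<longrightarrow> X k (\<zeta> + t) \<in> {0..L} \<longrightarrow> y t (X k (\<zeta> + t)) = w t (X k (\<zeta> + t))"
  shows "source_integral \<beta> y k a b \<zeta> = leg (source_term (trunc T \<beta>) w) k \<tau> \<zeta>"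
proof -
  obtain K where K: "source_Lipschitz R K" using source_Lipschitz_exists[OF state_nonneg[OF w]] by blast
  have [measurable]: "trunc T \<beta> \<in> borel_measurable borel" using weightsD(1)[OF b] .
  let ?F = "\<lambda>j t x. trunc T \<beta> t $ j *\<^sub>R h j t (w t x)"
  have F: "jointly_borel (?F j)" for j
    using jointly_borel_h[OF stateD(1)[OF w], of j] by (auto simp: jointly_borel_def)
  have Fb: "norm (?F j t x) \<le> 1 * (K * R)" for j t x
    unfolding norm_scaleR
    using weightsD(3)[OF b] order_trans[OF source_LipschitzD(5)[OF K stateD(2)[OF w]] mult_left_mono[OF stateD(2)[OF w] source_LipschitzD(2)[OF K]]]
    by (intro mult_mono) auto
  have "(LINT t:{a..b}|lebesgue. \<beta> t $ j * f (y t (X k (\<zeta> + t))) (u t) (v j) $ k) = leg (?F j) k \<tau> \<zeta>" for j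
    unfolding leg_def set_lebesgue_integral_def
  proof (rule integral_lebesgue_eq_lborel)
    have "(\<lambda>t. ?F j t (X k (\<zeta> + t)) $ k) \<in> borel_measurable borel" by (rule leg_integrand_measurable[OF F])
    then show "(\<lambda>t. indicat_real {0..\<tau>} t *\<^sub>R ?F j t (X k (\<zeta> + t)) $ k) \<in> borel_measurable borel" by measurable
    show "AE t in lborel. indicat_real {a..b} t *\<^sub>R (\<beta> t $ j * f (y t (X k (\<zeta> + t))) (u t) (v j) $ k) =
        indicat_real {0..\<tau>} t *\<^sub>R ?F j t (X k (\<zeta> + t)) $ k"
      using ae AE_lborel_singleton[of 0]
    proof eventually_elim
      case (elim t)
      show ?case
      proof (cases "t \<in> {a..b}")
        case True
        then have t: "t \<in> {0..\<tau>}" "t \<in> {0..T}" "t \<in> {0<..<T1}" using ab \<tau> T elim(2) by auto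
        have "y t (X k (\<zeta> + t)) = w t (X k (\<zeta> + t))" using elim(1) t(2) inside[OF True] by blast
        then show ?thesis using True t h_eq[OF t(3)] by (simp add: trunc_def)
      next
        case False
        show ?thesis
        proof (cases "t \<in> {0..\<tau>}")
          case t: True
          then show ?thesis using False stateD(3)[OF w outside[OF t False], of t] by (simp add: h_zero)
        qed (use False in simp)
      qed
    qed
  qed
  then have "source_integral \<beta> y k a b \<zeta> = (\<Sum>j\<in>UNIV. leg (?F j) k \<tau> \<zeta>)"
    unfolding source_integral_def by simp
  also have "\<dots> = leg (source_term (trunc T \<beta>) w) k \<tau> \<zeta>"
    unfolding source_term_def[abs_def] by (rule leg_sum[OF finite_class.finite_UNIV F Fb, symmetric])
  finally show ?thesis .
qed

text \<open>
  The null sets where the data or the state differ from their representatives, and the single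
  label \<open>z = 0\<close>, are seen by almost no characteristic ending at time
  \<open>\<tau>\<close>.
\<close>

lemma explicit_psi_eq_Psi_AE:
  assumes T: "T < T1" and \<tau>: "\<tau> \<in> {0..T}" and b: "weights T (trunc T \<beta>)" and w: "state R w"
    and ae: "AE p in lborel \<Otimes>\<^sub>M lborel. fst p \<in> {0..T} \<longrightarrow> snd p \<in> {0..L} \<longrightarrow> y (fst p) (snd p) = w (fst p) (snd p)"
  shows "AE \<sigma> in lborel. \<sigma> \<in> {0..L} \<longrightarrow> (\<chi> i. explicit_psi \<beta> y \<tau> \<sigma> i) = Psi (trunc T \<beta>) w \<tau> \<sigma>"
proof -
  let ?F = "source_term (trunc T \<beta>) w"
  have y0_ae: "AE x in lborel. x \<in> {0..L} \<longrightarrow> ybar x = y0 x"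
  proof -
    have "AE x in lborel. x \<in> {0<..<L} \<longrightarrow> ybar x = y0 x"
      using y0 unfolding BV_representative_def AE_completion_iff by blast
    then show ?thesis using AE_lborel_singleton[of 0] AE_lborel_singleton[of L]
      by eventually_elim auto
  qed
  have d_ae: "AE x in lborel. x \<in> {0<..<T1} \<longrightarrow> d x = d' x"
    using d' unfolding BV_representative_def AE_completion_iff by blast
  have "AE \<sigma> in lborel. \<forall>i k. AE t in lborel. t \<in> {0..T} \<longrightarrow> X k (\<Theta> k - \<tau> + \<theta> i \<sigma> + t) \<in> {0..L} \<longrightarrow>
      y t (X k (\<Theta> k - \<tau> + \<theta> i \<sigma> + t)) = w t (X k (\<Theta> k - \<tau> + \<theta> i \<sigma> + t))"
    using AE_along_leg[OF ae] by (simp add: AE_all_countable)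
  moreover have "AE \<sigma> in lborel. \<forall>i. AE t in lborel. t \<in> {0..T} \<longrightarrow> X i (- \<tau> + \<theta> i \<sigma> + t) \<in> {0..L} \<longrightarrow>
      y t (X i (- \<tau> + \<theta> i \<sigma> + t)) = w t (X i (- \<tau> + \<theta> i \<sigma> + t))"
    using AE_along_leg[OF ae, of _ "- \<tau>"] unfolding fst_conv snd_conv AE_all_countable by blast
  moreover have "AE \<sigma> in lborel. \<forall>i k. X k (\<Theta> k - \<tau> + \<theta> i \<sigma>) \<in> {0..L} \<longrightarrow> ybar (X k (\<Theta> k - \<tau> + \<theta> i \<sigma>)) = y0 (X k (\<Theta> k - \<tau> + \<theta> i \<sigma>))"
    using AE_X_\<theta>[OF y0_ae] unfolding AE_all_countable by blast
  moreover have "AE \<sigma> in lborel. \<forall>i. X i (- \<tau> + \<theta> i \<sigma>) \<in> {0..L} \<longrightarrow> ybar (X i (- \<tau> + \<theta> i \<sigma>)) = y0 (X i (- \<tau> + \<theta> i \<sigma>))"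
    using AE_X_\<theta>[OF y0_ae] unfolding AE_all_countable by blast
  moreover have "AE \<sigma> in lborel. \<forall>i. \<tau> - \<theta> i \<sigma> \<in> {0<..<T1} \<longrightarrow> d (\<tau> - \<theta> i \<sigma>) = d' (\<tau> - \<theta> i \<sigma>)"
    using AE_diff_\<theta>[OF d_ae] unfolding AE_all_countable by blast
  moreover have "AE \<sigma> in lborel. \<forall>i. \<tau> - \<theta> i \<sigma> \<noteq> 0"
    using AE_diff_\<theta>[OF AE_lborel_singleton[of 0]] unfolding AE_all_countable by blast
  ultimately show ?thesis
  proof eventually_elim
    case (elim \<sigma>)
    show ?case
    proof
      assume \<sigma>: "\<sigma> \<in> {0..L}"
      have "explicit_psi \<beta> y \<tau> \<sigma> i = D i (- \<tau> + \<theta> i \<sigma>) + (leg ?F i \<tau> (- \<tau> + \<theta> i \<sigma>) + (\<Sum>k\<in>UNIV. G $ i $ k * leg ?F k \<tau> (\<Theta> k - \<tau> + \<theta> i \<sigma>)))" for i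
      proof (cases "- \<tau> + \<theta> i \<sigma> < 0")
        case False
        define z where "z = - \<tau> + \<theta> i \<sigma>"
        have z: "0 < z" "z + \<tau> \<le> \<Theta> i" using False elim(6)[rule_format, of i] \<theta>_in[OF \<sigma>, of i] by (auto simp: z_def)
        have "leg ?F k \<tau> (\<Theta> k - \<tau> + \<theta> i \<sigma>) = 0" for k
          by (rule leg_source_outside[OF w], unfold X_in_iff) (use z in \<open>auto simp: z_def\<close>)
        moreover have "source_integral \<beta> y i 0 \<tau> z = leg ?F i \<tau> z"
          by (rule source_integral_eq_leg[OF T \<tau> b w], unfold X_in_iff)
            (use z \<tau> elim(2)[rule_format, of i, unfolded X_in_iff] in \<open>auto simp: z_def\<close>)
        moreover have "ybar (X i z) = y0 (X i z)"
          using elim(4)[rule_format, of i, unfolded X_in_iff] z \<tau> by (auto simp: z_def)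
        ultimately show ?thesis using z unfolding z_def[symmetric] by (simp add: explicit_psi_def Let_def D_def z_def)
      next
        case True
        define z where "z = - \<tau> + \<theta> i \<sigma>"
        have z: "z < 0" "- z \<le> \<tau>" "z + \<tau> \<le> \<Theta> i" using True \<theta>_in[OF \<sigma>, of i] by (auto simp: z_def)
        have eq: "\<Theta> k - \<tau> + \<theta> i \<sigma> = \<Theta> k + z" for k by (simp add: z_def)
        have T1': "\<tau> < \<Theta> k" for k using \<tau> T T1(2)[of k] by auto
        have 1: "source_integral \<beta> y k 0 (- z) (\<Theta> k + z) = leg ?F k \<tau> (\<Theta> k + z)" for k
          by (rule source_integral_eq_leg[OF T \<tau> b w], unfold X_in_iff)
            (use z T1'[of k] elim(1)[rule_format, of k i, unfolded X_in_iff eq] in auto)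
        have 2: "source_integral \<beta> y i (- z) \<tau> z = leg ?F i \<tau> z"
          by (rule source_integral_eq_leg[OF T \<tau> b w], unfold X_in_iff)
            (use z \<tau> elim(2)[rule_format, of i, unfolded X_in_iff] in \<open>auto simp: z_def\<close>)
        have 3: "ybar (X k (\<Theta> k + z)) = y0 (X k (\<Theta> k + z))" for k
          using elim(3)[rule_format, of k i, unfolded X_in_iff eq] z T1'[of k] by auto
        have 4: "d (- z) = d' (- z)"
          using elim(5)[rule_format, of i] z \<tau> T by (simp add: z_def)
        show ?thesis
          unfolding explicit_psi_def Let_def eq z_def[symmetric] D_def 1 2 3 4 using z(1)
          by (simp add: distrib_left sum.distrib)
      qed
      then show "(\<chi> i. explicit_psi \<beta> y \<tau> \<sigma> i) = Psi (trunc T \<beta>) w \<tau> \<sigma>"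
        using \<sigma> by (simp add: Psi_def base_def propagate_def vec_eq_iff)
    qed
  qed
qed

lemma BV_component:
  fixes w :: "real \<Rightarrow> 'n rvec"
  assumes "BV_representative a b g w"
  shows "\<exists>W. (\<forall>k. variation_le (\<lambda>x. w x $ k) W) \<and> (\<forall>k x. \<bar>w x $ k\<bar> \<le> W)"
proof -
  obtain W where W: "variation_le w W" and z: "\<And>x. x \<notin> {a<..<b} \<Longrightarrow> w x = 0"
    using assms unfolding BV_representative_def by blast
  have "variation_le (\<lambda>x. w x $ k) (1 * W)" for k
    by (rule variation_le_Lipschitz[OF W]) (auto simp: vector_minus_component[symmetric] component_le_norm_cart simp del: vector_minus_component)
  moreover have "\<bar>w x $ k\<bar> \<le> W" for x k
    using variation_le_two_points[OF W, of x a] z[of a] component_le_norm_cart[of "w x" k] by simp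
  ultimately show ?thesis by auto
qed

text \<open>
  \<open>D i\<close> is glued at \<open>z = 0\<close> from compositions of the data with monotone
  maps.
\<close>

lemma D_bounds: "\<exists>B V0. (\<forall>i z. \<bar>D i z\<bar> \<le> B) \<and> (\<forall>i. variation_le (D i) V0)"
proof -
  obtain W where W: "\<And>k. variation_le (\<lambda>x. y0 x $ k) W" "\<And>k x. \<bar>y0 x $ k\<bar> \<le> W" using BV_component[OF y0] by blast
  obtain W' where W': "\<And>k. variation_le (\<lambda>x. d' x $ k) W'" "\<And>k x. \<bar>d' x $ k\<bar> \<le> W'" using BV_component[OF d'] by blast
  have W0: "0 \<le> W" "0 \<le> W'" using W(2)[of 0] W'(2)[of 0] abs_ge_zero order_trans by blast+
  define g where "g = (\<Sum>i\<in>UNIV. \<Sum>k\<in>UNIV. \<bar>G $ i $ k\<bar>)"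
  have g: "(\<Sum>k\<in>UNIV. \<bar>G $ i $ k\<bar>) \<le> g" for i
    unfolding g_def by (rule member_le_sum) (auto intro: sum_nonneg)
  have g0: "0 \<le> g" unfolding g_def by (intro sum_nonneg) auto
  define A where "A i z = d' (- z) $ i + (\<Sum>k\<in>UNIV. G $ i $ k * y0 (X k (\<Theta> k + z)) $ k)" for i z
  define E where "E = W' + g * W"
  have sum_le: "(\<Sum>k\<in>UNIV. \<bar>G $ i $ k\<bar> * W) \<le> g * W" for i
    unfolding sum_distrib_right[symmetric] using g W0 by (intro mult_right_mono) auto
  have Ab: "\<bar>A i z\<bar> \<le> E" for i z
  proof -
    have "\<bar>\<Sum>k\<in>UNIV. G $ i $ k * y0 (X k (\<Theta> k + z)) $ k\<bar> \<le> (\<Sum>k\<in>UNIV. \<bar>G $ i $ k\<bar> * W)"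
      by (rule order_trans[OF sum_abs]) (auto simp: abs_mult intro!: sum_mono mult_left_mono W(2))
    then show ?thesis using W'(2)[of "- z" i] sum_le[of i] unfolding A_def E_def by linarith
  qed
  have Av: "variation_le (A i) E" for i
  proof -
    have "variation_le (\<lambda>z. d' (- z) $ i) W'"
      by (rule variation_le_compose_antimono[OF W'(1)]) (auto simp: antimono_def)
    moreover have "variation_le (\<lambda>z. \<Sum>k\<in>UNIV. G $ i $ k * y0 (X k (\<Theta> k + z)) $ k) (\<Sum>k\<in>UNIV. \<bar>G $ i $ k\<bar> * W)"
    proof (rule variation_le_sum)
      fix k
      have "variation_le (\<lambda>z. y0 (X k (\<Theta> k + z)) $ k) W" by (rule variation_le_shift[OF variation_le_X[OF W(1)]])
      then show "variation_le (\<lambda>z. G $ i $ k * y0 (X k (\<Theta> k + z)) $ k) (\<bar>G $ i $ k\<bar> * W)"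
        by (rule variation_le_Lipschitz) (auto simp: abs_mult right_diff_distrib[symmetric])
    qed simp
    ultimately have "variation_le (A i) (W' + (\<Sum>k\<in>UNIV. \<bar>G $ i $ k\<bar> * W))" unfolding A_def by (rule variation_le_add)
    then show ?thesis using sum_le[of i] by (auto simp: E_def intro: variation_le_weaken)
  qed
  have D_eq: "D i = (\<lambda>z. (1 - indicat_real {0..} z) *\<^sub>R A i z + indicat_real {0..} z *\<^sub>R y0 (X i z) $ i)" for i
    by (auto simp: D_def A_def fun_eq_iff)
  have neg: "variation_le (\<lambda>z. 1 - indicat_real {0..} z) 1"
    using variation_le_Lipschitz[OF variation_le_indicator_atLeast[of 0], of "\<lambda>z. 1 - indicat_real {0..} z" 1] by (simp add: abs_minus_commute)
  have "variation_le (D i) ((1 * E + 1 * E) + (1 * W + 1 * W))" for i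
    unfolding D_eq
  proof (rule variation_le_add)
    show "variation_le (\<lambda>z. (1 - indicat_real {0..} z) *\<^sub>R A i z) (1 * E + 1 * E)"
      by (rule variation_le_scaleR[OF Av neg]) (use Ab in \<open>auto simp: indicator_def\<close>)
    show "variation_le (\<lambda>z. indicat_real {0..} z *\<^sub>R y0 (X i z) $ i) (1 * W + 1 * W)"
      by (rule variation_le_scaleR[OF variation_le_X[OF W(1)] variation_le_indicator_atLeast]) (use W(2) in \<open>auto simp: indicator_def\<close>)
  qed
  moreover have "\<bar>D i z\<bar> \<le> max E W" for i z
    using Ab[of i z] W(2)[of "X i z" i] unfolding D_def A_def by auto
  ultimately show ?thesis by blast
qed

end


section \<open>Solutions are the fixed points of the explicit operator\<close>

lemma L1_norm_le:
  fixes g :: "real \<Rightarrow> (real, 'n::finite) vec"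
  assumes g [measurable]: "g \<in> borel_measurable borel" and c: "(\<integral>\<^sup>+x. ennreal (norm (g x)) \<partial>lborel) \<le> ennreal c" "0 \<le> c"
  shows "L1_norm L g \<le> real CARD('n) * c" "0 \<le> L1_norm L g"
proof -
  have "(LINT x:{0..L}|lebesgue. \<bar>g x $ i\<bar>) \<le> c" for i
  proof -
    have "(LINT x:{0..L}|lebesgue. \<bar>g x $ i\<bar>) = (LINT x|lborel. indicat_real {0..L} x *\<^sub>R \<bar>g x $ i\<bar>)"
      unfolding set_lebesgue_integral_def by (rule integral_lebesgue_eq_lborel) auto
    also have "\<dots> = enn2real (\<integral>\<^sup>+x. ennreal (indicat_real {0..L} x *\<^sub>R \<bar>g x $ i\<bar>) \<partial>lborel)"
      by (rule integral_eq_nn_integral) auto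
    also have "\<dots> \<le> c"
    proof (rule enn2real_leI[OF c(2)])
      have "(\<integral>\<^sup>+x. ennreal (indicat_real {0..L} x *\<^sub>R \<bar>g x $ i\<bar>) \<partial>lborel) \<le> (\<integral>\<^sup>+x. ennreal (norm (g x)) \<partial>lborel)"
        by (intro nn_integral_mono ennreal_leI) (auto simp: indicator_def component_le_norm_cart)
      then show "(\<integral>\<^sup>+x. ennreal (indicat_real {0..L} x *\<^sub>R \<bar>g x $ i\<bar>) \<partial>lborel) \<le> ennreal c"
        using c(1) by (rule order_trans)
    qed
    finally show ?thesis .
  qed
  then have "L1_norm L g \<le> (\<Sum>i\<in>(UNIV::'n set). c)" unfolding L1_norm_def by (rule sum_mono)
  then show "L1_norm L g \<le> real CARD('n) * c" by simp
  show "0 \<le> L1_norm L g"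
    unfolding L1_norm_def set_lebesgue_integral_def by (intro sum_nonneg integral_nonneg_AE) auto
qed

context relaxed_ibvp
begin

lemma Psi_state_exists:
  assumes b: "weights T b" and y: "state R y" and T: "0 \<le> T"
  shows "\<exists>R'. state R' (Psi b y)"
proof -
  obtain K where K: "source_Lipschitz R K" using source_Lipschitz_exists[OF state_nonneg[OF y]] by blast
  obtain B where B: "\<And>i z. \<bar>D i z\<bar> \<le> B" using D_bounds by blast
  have base: "norm (base \<tau> x) \<le> real CARD('n) * B" for \<tau> x
  proof -
    have "(\<Sum>i\<in>UNIV. \<bar>base \<tau> x $ i\<bar>) \<le> (\<Sum>i\<in>(UNIV::'n set). B)" unfolding base_def by (intro sum_mono) (simp add: B)
    then show ?thesis using norm_le_l1_cart[of "base \<tau> x"] by simp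
  qed
  have F: "jointly_borel (source_term b y)" by (rule jointly_borel_source[OF stateD(1)[OF y] weightsD(1)[OF b]])
  have p: "norm (propagate (source_term b y) \<tau> x) \<le> \<Gamma> * (T * (real CARD('m) * K * R))" for \<tau> x
    by (rule propagate_sup_le[OF F source_norm_le'[OF K b stateD(2)[OF y]] T])
  have "norm (Psi b y \<tau> x) \<le> real CARD('n) * B + \<Gamma> * (T * (real CARD('m) * K * R))" for \<tau> x
  proof -
    have "norm (Psi b y \<tau> x) \<le> norm (base \<tau> x + propagate (source_term b y) \<tau> x)"
      by (simp add: Psi_def indicator_def)
    then show ?thesis using norm_triangle_ineq[of "base \<tau> x" "propagate (source_term b y) \<tau> x"] base[of \<tau> x] p[of \<tau> x] by linarith
  qed
  then have "state (real CARD('n) * B + \<Gamma> * (T * (real CARD('m) * K * R))) (Psi b y)"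
    unfolding state_def using jointly_borel_Psi[OF stateD(1)[OF y] weightsD(1)[OF b]] by (auto simp: Psi_def)
  then show ?thesis by blast
qed

lemma essentially_bounded_Borel_version:
  assumes z: "in_CL1 T L z" and bd: "ess_bounded T L z"
  shows "\<exists>R w. state R w \<and> (AE p in lborel \<Otimes>\<^sub>M lborel. fst p \<in> {0..T} \<longrightarrow> snd p \<in> {0..L} \<longrightarrow> z (fst p) (snd p) = w (fst p) (snd p))"
proof -
  let ?R = "{0..T} \<times> {0..L}"
  have R: "?R \<in> sets borel" by (intro borel_closed closed_Times) auto
  have m: "(\<lambda>(t, x). z t x) \<in> borel_measurable (lebesgue_on ?R)" using z unfolding in_CL1_def by simp
  have comp: "\<exists>g\<in>borel_measurable lborel. AE p in lborel. indicat_real ?R p * z (fst p) (snd p) $ k = g p" for k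
  proof (rule completion_ex_borel_measurable_real)
    have "(\<lambda>p. (case p of (t, x) \<Rightarrow> z t x) $ k) \<in> borel_measurable (lebesgue_on ?R)"
      using m by (rule borel_measurable_vec_nth)
    then show "(\<lambda>p. indicat_real ?R p * z (fst p) (snd p) $ k) \<in> borel_measurable lebesgue"
      using R by (subst (asm) borel_measurable_restrict_space_iff) (auto simp: split_beta' mult.commute)
  qed
  then have "\<forall>k. \<exists>g. g \<in> borel_measurable lborel \<and> (AE p in lborel. indicat_real ?R p * z (fst p) (snd p) $ k = g p)"
    by blast
  from choice[OF this] obtain g where g: "\<And>k. g k \<in> borel_measurable lborel"
    "\<And>k. AE p in lborel. indicat_real ?R p * z (fst p) (snd p) $ k = g k p" by blast
  obtain B where "AE (t, x) in lebesgue_on ?R. norm (z t x) \<le> B" using bd unfolding ess_bounded_def by blast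
  then have "AE p in lebesgue. p \<in> ?R \<longrightarrow> norm (z (fst p) (snd p)) \<le> B"
    using R by (subst (asm) AE_restrict_space_iff) (auto simp: split_beta')
  then have B: "AE p in lborel. p \<in> ?R \<longrightarrow> norm (z (fst p) (snd p)) \<le> B" by (simp add: AE_completion_iff)
  define W where "W p = (\<chi> k. g k p)" for p
  have [measurable]: "W \<in> borel_measurable (borel \<Otimes>\<^sub>M borel)"
    unfolding W_def[abs_def] using g(1) by (intro borel_measurable_vec_lambda) (simp add: borel_prod)
  define w where "w t x = (if t \<in> {0..T} \<and> x \<in> {0..L} \<and> norm (W (t, x)) \<le> B then W (t, x) else 0)" for t x
  have "state (max B 0) w"
    unfolding state_def
  proof (intro conjI allI impI jointly_borelI)
    show "(\<lambda>p. w (fst p) (snd p)) \<in> borel_measurable (borel \<Otimes>\<^sub>M borel)"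
      unfolding w_def prod.collapse by measurable
  qed (auto simp: w_def)
  moreover have "AE p in lborel. \<forall>k. indicat_real ?R p * z (fst p) (snd p) $ k = g k p"
    using g(2) by (simp add: AE_all_countable)
  then have "AE p in lborel. fst p \<in> {0..T} \<longrightarrow> snd p \<in> {0..L} \<longrightarrow> z (fst p) (snd p) = w (fst p) (snd p)"
    using B
  proof eventually_elim
    case (elim p)
    show ?case
    proof (intro impI)
      assume p: "fst p \<in> {0..T}" "snd p \<in> {0..L}"
      then have "p \<in> ?R" by (cases p) auto
      then have "z (fst p) (snd p) = W p" using elim(1) by (simp add: W_def vec_eq_iff)
      then show "z (fst p) (snd p) = w (fst p) (snd p)" using elim(2) \<open>p \<in> ?R\<close> p by (simp add: w_def)
    qed
  qed
  ultimately show ?thesis unfolding lborel_prod by blast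
qed

text \<open>
  Start from any bounded Borel function equal to \<open>z\<close> almost everywhere in space-time
  and apply \<open>Psi\<close> once. The result equals \<open>z\<close> at every time, for almost
  every \<open>x\<close>, so it may be used as the representative of \<open>z\<close> under the
  integrals, and is therefore a fixed point of \<open>Psi\<close>.
\<close>

lemma fixed_point_Borel_version:
  assumes T: "0 \<le> T" "T < T1" and b: "weights T (trunc T \<beta>)"
    and fp: "is_fixed_point L r lam G d ybar f v u \<beta> T z"
  shows "\<exists>R w. state R w \<and> (\<forall>\<tau>\<in>{0..T}. AE x in lborel. w \<tau> x = Psi (trunc T \<beta>) w \<tau> x) \<and>
     (\<forall>\<tau>\<in>{0..T}. AE x in lborel. x \<in> {0..L} \<longrightarrow> z \<tau> x = w \<tau> x)"
proof -
  obtain psi where z: "in_CL1 T L z" "ess_bounded T L z" and psi: "is_psi L r lam G d ybar f v u \<beta> T z psi" and eq: "CL1_eq T L z psi"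
    using fp unfolding is_fixed_point_def by blast
  have explicit_psi: "psi \<tau> \<sigma> = (\<chi> i. explicit_psi \<beta> z \<tau> \<sigma> i)" if "\<tau> \<in> {0..T}" "\<sigma> \<in> {0..L}" for \<tau> \<sigma>
    using psi that unfolding is_psi_iff_explicit[OF T(2)] by (simp add: vec_eq_iff)
  have z_explicit: "AE x in lborel. x \<in> {0..L} \<longrightarrow> z \<tau> x = (\<chi> i. explicit_psi \<beta> z \<tau> x i)" if \<tau>: "\<tau> \<in> {0..T}" for \<tau>
  proof -
    have "AE x in lebesgue_on {0..L}. z \<tau> x = psi \<tau> x" using eq \<tau> unfolding CL1_eq_def by blast
    then have "AE x in lborel. x \<in> {0..L} \<longrightarrow> z \<tau> x = psi \<tau> x"
      by (simp add: AE_restrict_space_iff AE_completion_iff)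
    then show ?thesis by eventually_elim (use explicit_psi[OF \<tau>] in auto)
  qed
  obtain R w1 where w1: "state R w1" and ae1: "AE p in lborel \<Otimes>\<^sub>M lborel. fst p \<in> {0..T} \<longrightarrow> snd p \<in> {0..L} \<longrightarrow> z (fst p) (snd p) = w1 (fst p) (snd p)"
    using essentially_bounded_Borel_version[OF z] by blast
  define w where "w = Psi (trunc T \<beta>) w1"
  obtain R' where w: "state R' w" using Psi_state_exists[OF b w1 T(1)] unfolding w_def by blast
  have z_w: "AE x in lborel. x \<in> {0..L} \<longrightarrow> z \<tau> x = w \<tau> x" if \<tau>: "\<tau> \<in> {0..T}" for \<tau>
    using explicit_psi_eq_Psi_AE[OF T(2) \<tau> b w1 ae1] z_explicit[OF \<tau>] unfolding w_def by eventually_elim auto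
  have "AE t in lborel. AE x in lborel. fst (t, x) \<in> {0..T} \<longrightarrow> snd (t, x) \<in> {0..L} \<longrightarrow> z (fst (t, x)) (snd (t, x)) = w1 (fst (t, x)) (snd (t, x))"
    by (rule lborel_pair.AE_pair[OF ae1])
  then have ae_iter: "AE t in lborel. AE x in lborel. t \<in> {0..T} \<longrightarrow> x \<in> {0..L} \<longrightarrow> w1 t x = w t x"
  proof eventually_elim
    case (elim t)
    show ?case
    proof (cases "t \<in> {0..T}")
      case True
      from elim z_w[OF True] show ?thesis by eventually_elim auto
    qed auto
  qed
  \<comment> \<open>measurability is needed to pass from iterated to joint null sets; it holds
    because both functions are Borel, which \<open>z\<close> need not be\<close>
  have set_meas: "{p \<in> space (lborel \<Otimes>\<^sub>M lborel). fst p \<in> {0..T} \<longrightarrow> snd p \<in> {0..L} \<longrightarrow> w1 (fst p) (snd p) = w (fst p) (snd p)} \<in> sets (lborel \<Otimes>\<^sub>M lborel)"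
  proof -
    have [measurable]: "(\<lambda>p. w1 (fst p) (snd p)) \<in> borel_measurable (lborel \<Otimes>\<^sub>M lborel)" "(\<lambda>p. w (fst p) (snd p)) \<in> borel_measurable (lborel \<Otimes>\<^sub>M lborel)"
      by (rule jointly_borel_compose[OF stateD(1)[OF w1]] jointly_borel_compose[OF stateD(1)[OF w]]; simp)+
    show ?thesis by measurable
  qed
  have "AE p in lborel \<Otimes>\<^sub>M lborel. fst p \<in> {0..T} \<longrightarrow> snd p \<in> {0..L} \<longrightarrow> w1 (fst p) (snd p) = w (fst p) (snd p)"
    by (rule lborel_pair.AE_pair_measure[OF set_meas]) (use ae_iter in simp)
  then have ae: "AE p in lborel \<Otimes>\<^sub>M lborel. fst p \<in> {0..T} \<longrightarrow> snd p \<in> {0..L} \<longrightarrow> z (fst p) (snd p) = w (fst p) (snd p)"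
    using ae1 by eventually_elim auto
  have "AE x in lborel. w \<tau> x = Psi (trunc T \<beta>) w \<tau> x" if \<tau>: "\<tau> \<in> {0..T}" for \<tau>
    using explicit_psi_eq_Psi_AE[OF T(2) \<tau> b w ae] z_explicit[OF \<tau>] z_w[OF \<tau>]
  proof eventually_elim
    case (elim x)
    then show ?case using stateD(3)[OF w, of x \<tau>] by (cases "x \<in> {0..L}") (auto simp: Psi_def)
  qed
  then show ?thesis using w z_w by blast
qed

lemma Psi_fixed_point_is_fixed_point:
  assumes T: "0 \<le> T" "T < T1" and b: "weights T (trunc T \<beta>)" and y: "state R y"
    and fp: "\<And>\<tau> x. y \<tau> x = Psi (trunc T \<beta>) y \<tau> x"
    and C: "0 \<le> C" "\<And>\<tau> \<tau>'. \<tau> \<in> {0..T} \<Longrightarrow> \<tau>' \<in> {0..T} \<Longrightarrow>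
      (\<integral>\<^sup>+x. ennreal (norm (y \<tau> x - y \<tau>' x)) \<partial>lborel) \<le> ennreal (C * \<bar>\<tau> - \<tau>'\<bar>)"
  shows "is_fixed_point L r lam G d ybar f v u \<beta> T y"
  unfolding is_fixed_point_def
proof (intro conjI exI[of _ "\<lambda>\<tau> \<sigma>. \<chi> i. explicit_psi \<beta> y \<tau> \<sigma> i"])
  have ym: "y t \<in> borel_measurable borel" for t by (rule jointly_borel_space[OF stateD(1)[OF y]])
  show "in_CL1 T L y"
    unfolding in_CL1_def
  proof (intro conjI ballI)
    have "(\<lambda>(t, x). y t x) \<in> borel_measurable borel"
      using stateD(1)[OF y] by (simp add: jointly_borel_def borel_prod split_beta')
    then show "(\<lambda>(t, x). y t x) \<in> borel_measurable (lebesgue_on ({0..T} \<times> {0..L}))"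
      by (intro measurable_restrict_space1 measurable_completion) simp
    fix t assume t: "t \<in> {0..T}"
    have "set_integrable lborel {0..L} (y t)"
      by (rule set_integrable_bounded_interval[OF ym]) (rule stateD(2)[OF y])
    then show "set_integrable lebesgue {0..L} (y t)"
      unfolding set_integrable_def using ym[of t] by (subst integrable_completion) auto
    show "((\<lambda>t'. L1_norm L (\<lambda>x. y t' x - y t x)) \<longlongrightarrow> 0) (at t within {0..T})"
    proof (rule Lim_null_comparison)
      show "\<forall>\<^sub>F t' in at t within {0..T}. norm (L1_norm L (\<lambda>x. y t' x - y t x)) \<le> real CARD('n) * (C * \<bar>t' - t\<bar>)"
      proof (subst eventually_at_filter, rule always_eventually, intro allI impI)
        fix t' assume "t' \<in> {0..T}"
        then have "(\<integral>\<^sup>+x. ennreal (norm (y t' x - y t x)) \<partial>lborel) \<le> ennreal (C * \<bar>t' - t\<bar>)" using C(2) t by blast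
        from L1_norm_le[OF _ this, of L] show "norm (L1_norm L (\<lambda>x. y t' x - y t x)) \<le> real CARD('n) * (C * \<bar>t' - t\<bar>)"
          using C(1) ym by simp
      qed
      have "((\<lambda>t'. real CARD('n) * (C * \<bar>t' - t\<bar>)) \<longlongrightarrow> real CARD('n) * (C * \<bar>t - t\<bar>)) (at t within {0..T})"
        by (intro tendsto_intros)
      then show "((\<lambda>t'. real CARD('n) * (C * \<bar>t' - t\<bar>)) \<longlongrightarrow> 0) (at t within {0..T})" by simp
    qed
  qed
  show "ess_bounded T L y"
    unfolding ess_bounded_def using stateD(2)[OF y] by (intro exI[of _ R]) auto
  show "is_psi L r lam G d ybar f v u \<beta> T y (\<lambda>\<tau> \<sigma>. \<chi> i. explicit_psi \<beta> y \<tau> \<sigma> i)"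
    unfolding is_psi_iff_explicit[OF T(2)] by simp
  show "CL1_eq T L y (\<lambda>\<tau> \<sigma>. \<chi> i. explicit_psi \<beta> y \<tau> \<sigma> i)"
    unfolding CL1_eq_def
  proof
    fix \<tau> assume \<tau>: "\<tau> \<in> {0..T}"
    have "AE \<sigma> in lborel. \<sigma> \<in> {0..L} \<longrightarrow> (\<chi> i. explicit_psi \<beta> y \<tau> \<sigma> i) = Psi (trunc T \<beta>) y \<tau> \<sigma>"
      by (rule explicit_psi_eq_Psi_AE[OF T(2) \<tau> b y]) auto
    then have "AE \<sigma> in lborel. \<sigma> \<in> {0..L} \<longrightarrow> y \<tau> \<sigma> = (\<chi> i. explicit_psi \<beta> y \<tau> \<sigma> i)"
      by eventually_elim (subst fp, auto)
    then show "AE x in lebesgue_on {0..L}. y \<tau> x = (\<chi> i. explicit_psi \<beta> y \<tau> x i)"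
      by (simp add: AE_restrict_space_iff AE_completion_iff)
  qed
qed

theorem Psi_fixed_point_is_L1_solution:
  assumes T: "0 \<le> T" "T < T1" and b: "weights T (trunc T \<beta>)" and y: "state R y"
    and fp: "\<And>\<tau> x. y \<tau> x = Psi (trunc T \<beta>) y \<tau> x"
    and C: "0 \<le> C" "\<And>\<tau> \<tau>'. \<tau> \<in> {0..T} \<Longrightarrow> \<tau>' \<in> {0..T} \<Longrightarrow>
      (\<integral>\<^sup>+x. ennreal (norm (y \<tau> x - y \<tau>' x)) \<partial>lborel) \<le> ennreal (C * \<bar>\<tau> - \<tau>'\<bar>)"
  shows "is_L1_solution L r lam G d ybar f v u \<beta> T y"
  unfolding is_L1_solution_def
proof (intro conjI allI impI)
  show "is_fixed_point L r lam G d ybar f v u \<beta> T y" by (rule Psi_fixed_point_is_fixed_point[OF assms])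
  fix z assume "is_fixed_point L r lam G d ybar f v u \<beta> T z"
  from fixed_point_Borel_version[OF T b this] obtain R' w where w: "state R' w"
    and w_fp: "\<And>\<tau>. \<tau> \<in> {0..T} \<Longrightarrow> AE x in lborel. w \<tau> x = Psi (trunc T \<beta>) w \<tau> x"
    and z_w: "\<And>\<tau>. \<tau> \<in> {0..T} \<Longrightarrow> AE x in lborel. x \<in> {0..L} \<longrightarrow> z \<tau> x = w \<tau> x" by blast
  have st: "state (max R R') w" "state (max R R') y" using state_mono[OF w] state_mono[OF y] by auto
  obtain K where K: "source_Lipschitz (max R R') K" using source_Lipschitz_exists[OF state_nonneg[OF st(1)]] by blast
  show "CL1_eq T L z y"
    unfolding CL1_eq_def
  proof
    fix \<tau> assume \<tau>: "\<tau> \<in> {0..T}"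
    have "AE x in lborel. y \<tau> x = Psi (trunc T \<beta>) y \<tau> x" for \<tau> using fp by auto
    then have "AE x in lborel. w \<tau> x = y \<tau> x"
      by (intro fixed_point_unique[OF K b st w_fp _ \<tau>])
    then have "AE x in lborel. x \<in> {0..L} \<longrightarrow> z \<tau> x = y \<tau> x" using z_w[OF \<tau>] by eventually_elim auto
    then show "AE x in lebesgue_on {0..L}. z \<tau> x = y \<tau> x"
      by (simp add: AE_restrict_space_iff AE_completion_iff)
  qed
qed

end


section \<open>The stability estimate\<close>

context relaxed_ibvp
begin

text \<open>
  \<open>R\<close>, \<open>K\<close> and \<open>T0\<close> are chosen from the data alone; both
  solutions are the fixed points in the ball of radius \<open>R\<close>.
\<close>

theorem relaxed_stability:
  "\<exists>T0>0. \<exists>C>0. \<forall>T \<beta> \<beta>' \<epsilon>. 0 < T \<longrightarrow> T \<le> T0 \<longrightarrow> 0 \<le> \<epsilon> \<longrightarrow>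
     weights T (trunc T \<beta>) \<longrightarrow> weights T (trunc T \<beta>') \<longrightarrow> (\<forall>t j. 0 \<le> trunc T \<beta> t $ j \<and> 0 \<le> trunc T \<beta>' t $ j) \<longrightarrow>
     (\<forall>t\<in>{0..T}. \<forall>j. \<bar>LINT s:{0..t}|lborel. trunc T \<beta> s $ j - trunc T \<beta>' s $ j\<bar> \<le> \<epsilon>) \<longrightarrow>
     (\<exists>y y'. is_L1_solution L r lam G d ybar f v u \<beta> T y \<and> is_L1_solution L r lam G d ybar f v u \<beta>' T y' \<and>
        CL1_norm T L (\<lambda>t x. y t x - y' t x) \<le> C * \<epsilon>)"
proof -
  obtain B V0 where B: "\<And>i z. \<bar>D i z\<bar> \<le> B" and V0: "\<And>i. variation_le (D i) V0" using D_bounds by blast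
  define R where "R = 2 * (real CARD('n) * B)"
  have "0 \<le> B" using B abs_ge_zero order_trans by blast
  then have R0: "0 \<le> R" by (simp add: R_def)
  have DR: "real CARD('n) * \<bar>D i z\<bar> \<le> R / 2" for i z
    unfolding R_def using mult_left_mono[OF B[of i z], of "real CARD('n)"] by simp
  obtain K where K: "source_Lipschitz R K" using source_Lipschitz_exists[OF R0] by blast
  define c where "c = \<Gamma> * \<kappa>\<^sup>2 * (real CARD('m) * K)"
  have c0: "0 \<le> c" unfolding c_def using \<Gamma>_nonneg source_LipschitzD(2)[OF K] by simp
  \<comment> \<open>the last term enforces \<open>2 c T \<le> 1\<close>, also when \<open>c =
    0\<close>\<close>
  define T0 where "T0 = min (T1 / 2) (min 1 (1 / (2 * c + 1)))"
  have T0: "0 < T0" using T1(1) c0 by (simp add: T0_def)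
  have local: "small_time_transport L \<kappa> \<theta> X G h D T R K V0" if "0 \<le> T" "T \<le> T0" for T
  proof (intro small_time_transport.intro small_time_transport_axioms.intro semilinear_transport_axioms)
    show "0 \<le> T" "T \<le> 1" using that by (auto simp: T0_def)
    have "T * (2 * c) \<le> (1 / (2 * c + 1)) * (2 * c)"
      using that c0 by (intro mult_right_mono) (auto simp: T0_def)
    also have "\<dots> \<le> 1" using c0 by (simp add: field_simps)
    finally show "2 * T * (\<Gamma> * \<kappa>\<^sup>2 * (real CARD('m) * K)) \<le> 1" by (simp add: c_def mult_ac)
  qed (use K DR V0 in auto)
  \<comment> \<open>the stability constant does not depend on \<open>T\<close>, so it is taken
    from the instance with \<open>T = 0\<close>\<close>
  interpret S0: small_time_transport L \<kappa> \<theta> X \<Theta> G h D 0 R K V0 by (rule local) (use T0 in auto)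
  define C where "C = real CARD('n) * S0.C_stab + 1"
  have C: "0 < C" "real CARD('n) * S0.C_stab \<le> C"
    using mult_nonneg_nonneg[OF of_nat_0_le_iff S0.C_stab_nonneg] by (simp_all add: C_def add_nonneg_pos)
  show ?thesis
  proof (rule exI[of _ T0], rule conjI[OF T0], rule exI[of _ C], rule conjI[OF C(1)], intro allI impI)
    fix T \<epsilon> :: real and \<beta> \<beta>' :: "real \<Rightarrow> real ^ 'm"
    assume T: "0 < T" "T \<le> T0" and \<epsilon>: "0 \<le> \<epsilon>" and b: "weights T (trunc T \<beta>)" "weights T (trunc T \<beta>')"
      and pos: "\<forall>t j. 0 \<le> trunc T \<beta> t $ j \<and> 0 \<le> trunc T \<beta>' t $ j"
      and prim: "\<forall>t\<in>{0..T}. \<forall>j. \<bar>LINT s:{0..t}|lborel. trunc T \<beta> s $ j - trunc T \<beta>' s $ j\<bar> \<le> \<epsilon>"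
    have T': "0 \<le> T" "T < T1" using T T1(1) by (auto simp: T0_def)
    interpret S: small_time_transport L \<kappa> \<theta> X \<Theta> G h D T R K V0 by (rule local) (use T in auto)
    obtain y where y: "state R y" "\<And>t. variation_le (y t) S.V" "\<And>\<tau> x. y \<tau> x = Psi (trunc T \<beta>) y \<tau> x"
      using S.fixed_point_exists[OF b(1)] by blast
    obtain y' where y': "state R y'" "\<And>t. variation_le (y' t) S.V" "\<And>\<tau> x. y' \<tau> x = Psi (trunc T \<beta>') y' \<tau> x"
      using S.fixed_point_exists[OF b(2)] by blast
    have sol: "is_L1_solution L r lam G d ybar f v u \<beta> T y"
      by (rule Psi_fixed_point_is_L1_solution[OF T' b(1) y(1,3) S.C_time_nonneg S.fixed_point_time_L1[OF b(1) y]])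
    have sol': "is_L1_solution L r lam G d ybar f v u \<beta>' T y'"
      by (rule Psi_fixed_point_is_L1_solution[OF T' b(2) y'(1,3) S.C_time_nonneg S.fixed_point_time_L1[OF b(2) y']])
    have "CL1_norm T L (\<lambda>t x. y t x - y' t x) \<le> real CARD('n) * (S0.C_stab * \<epsilon>)"
      unfolding CL1_norm_def
    proof (rule cSUP_least)
      fix t assume t: "t \<in> {0..T}"
      show "L1_norm L (\<lambda>x. y t x - y' t x) \<le> real CARD('n) * (S0.C_stab * \<epsilon>)"
      proof (rule L1_norm_le(1))
        show "(\<lambda>x. y t x - y' t x) \<in> borel_measurable borel"
          using jointly_borel_space[OF stateD(1)[OF y(1)]] jointly_borel_space[OF stateD(1)[OF y'(1)]] by simp
        show "(\<integral>\<^sup>+x. ennreal (norm (y t x - y' t x)) \<partial>lborel) \<le> ennreal (S0.C_stab * \<epsilon>)"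
          by (rule S.stability[OF b(1) _ b(2) _ y y'(1,3) _ \<epsilon> t]) (use pos prim in auto)
        show "0 \<le> S0.C_stab * \<epsilon>" using S0.C_stab_nonneg \<epsilon> by simp
      qed
    qed (use T in auto)
    also have "\<dots> \<le> C * \<epsilon>" using mult_right_mono[OF C(2) \<epsilon>] by (simp add: mult.assoc)
    finally show "\<exists>y y'. is_L1_solution L r lam G d ybar f v u \<beta> T y \<and> is_L1_solution L r lam G d ybar f v u \<beta>' T y' \<and>
        CL1_norm T L (\<lambda>t x. y t x - y' t x) \<le> C * \<epsilon>"
      using sol sol' by blast
  qed
qed

end


section \<open>Consequences of the regularity hypotheses\<close>

lemma piecewise_interior:
  fixes p :: "nat \<Rightarrow> real"
  assumes "\<And>i. i < K \<Longrightarrow> p i < p (Suc i)" "t \<in> {p 0<..<p K}" "t \<notin> p ` {..K}"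
  shows "\<exists>i<K. t \<in> {p i<..<p (Suc i)}"
  using assms
proof (induction K)
  case (Suc K)
  consider "t < p K" | "t = p K" | "p K < t" by linarith
  then show ?case
  proof cases
    case 1
    then have "\<exists>i<K. t \<in> {p i<..<p (Suc i)}" using Suc by (intro Suc.IH) auto
    then show ?thesis using less_SucI by blast
  qed (use Suc.prems in auto)
qed auto

lemma smooth_upto_endpoints_continuous:
  assumes "smooth_upto_endpoints a b g" shows "continuous_on {a<..<b} g"
proof -
  obtain D where D: "\<forall>t\<in>{a<..<b}. D 0 t = g t" "\<forall>k. \<forall>t\<in>{a..b}. (D k has_vector_derivative D (Suc k) t) (at t within {a..b})"
    using assms unfolding smooth_upto_endpoints_def by blast
  have "continuous_on {a..b} (D 0)"
    using D(2) by (auto simp: continuous_on_eq_continuous_within intro: has_vector_derivative_continuous)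
  then have "continuous_on {a<..<b} (D 0)" by (rule continuous_on_subset) auto
  then show ?thesis by (rule continuous_on_eq) (use D(1) in auto)
qed

lemma piecewise_smooth_Borel:
  fixes g :: "real \<Rightarrow> 'a::real_normed_vector"
  assumes g: "piecewise_smooth g" and T: "0 < T"
  shows "(\<lambda>t. indicat_real {0..T} t *\<^sub>R g t) \<in> borel_measurable borel"
proof -
  obtain K p where p: "p 0 = 0" "p K = T" and step: "\<And>i. i < K \<Longrightarrow> p i < p (Suc i)"
    and smooth: "\<And>i. i < K \<Longrightarrow> smooth_upto_endpoints (p i) (p (Suc i)) g"
    using g T unfolding piecewise_smooth_def piecewise_on_def by (meson order_refl)
  let ?X = "p ` {..K}" and ?f = "\<lambda>t. indicat_real {0..T} t *\<^sub>R g t"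
  have "isCont ?f t" if t: "t \<in> - ?X" for t
  proof -
    have ne: "t \<noteq> 0" "t \<noteq> T" using t p by (metis ComplD atMost_iff image_eqI le0 order_refl)+
    consider "t < 0 \<or> T < t" | "t \<in> {0<..<T}" using ne by fastforce
    then show ?thesis
    proof cases
      case 1
      have "eventually (\<lambda>s. ?f s = 0) (nhds t)"
      proof (rule eventually_mono[OF eventually_nhds_in_open[of "- {0..T}" t]])
        show "open (- {0..T})" by (simp add: open_Compl)
      qed (use 1 in auto)
      then show ?thesis using isCont_cong[of ?f "\<lambda>_. 0" t] by simp
    next
      case 2
      obtain i where i: "i < K" "t \<in> {p i<..<p (Suc i)}"
        using piecewise_interior[of K p t, OF step] 2 p t by auto
      have sub: "{p i<..<p (Suc i)} \<inter> {0<..<T} \<subseteq> {0..T}" by auto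
      have "isCont g t"
        using smooth_upto_endpoints_continuous[OF smooth[OF i(1)]] i(2)
        by (simp add: continuous_on_eq_continuous_at)
      moreover have "eventually (\<lambda>s. ?f s = g s) (nhds t)"
        by (rule eventually_mono[OF eventually_nhds_in_open[of "{0<..<T}" t]]) (use 2 in auto)
      ultimately show ?thesis using isCont_cong[of ?f g t] by simp
    qed
  qed
  then have "continuous_on (- ?X) ?f" by (intro continuous_at_imp_continuous_on) auto
  then show ?thesis
    by (intro borel_measurable_continuous_countable_exceptions[of ?X]) (auto intro: countable_finite)
qed

text \<open>
  Up to its first break point the control is represented by a Lipschitz function on a closed
  interval; solutions are sought on this interval only.
\<close>

lemma piecewise_smooth_initial_Lipschitz:
  fixes u :: "real \<Rightarrow> 'a::real_normed_vector"
  assumes "piecewise_smooth u"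
  shows "\<exists>t1 w C. 0 < t1 \<and> (\<forall>t\<in>{0<..<t1}. w t = u t) \<and> C-lipschitz_on {0..t1} w"
proof -
  obtain K p where p: "p 0 = 0" "p K = (1::real)" and step: "\<And>i. i < K \<Longrightarrow> p i < p (Suc i)"
    and smooth: "\<And>i. i < K \<Longrightarrow> smooth_upto_endpoints (p i) (p (Suc i)) u"
    using assms unfolding piecewise_smooth_def piecewise_on_def by (meson order_refl zero_less_one)
  have "0 < K" using p by (cases K) auto
  define t1 where "t1 = p (Suc 0)"
  have t1: "0 < t1" using step[OF \<open>0 < K\<close>] p by (simp add: t1_def)
  have "smooth_upto_endpoints 0 t1 u" using smooth[OF \<open>0 < K\<close>] p by (simp add: t1_def)
  then obtain D where D0: "\<forall>t\<in>{0<..<t1}. D 0 t = u t"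
    and D: "\<And>k t. t \<in> {0..t1} \<Longrightarrow> (D k has_vector_derivative D (Suc k) t) (at t within {0..t1})"
    unfolding smooth_upto_endpoints_def by blast
  have "continuous_on {0..t1} (D (Suc 0))"
    unfolding continuous_on_eq_continuous_within using has_vector_derivative_continuous[OF D[of _ "Suc 0"]] by blast
  then have "bounded (D (Suc 0) ` {0..t1})"
    by (intro compact_imp_bounded compact_continuous_image) simp_all
  then obtain C where C: "\<And>t. t \<in> {0..t1} \<Longrightarrow> norm (D (Suc 0) t) \<le> C"
    unfolding bounded_iff by blast
  have "norm (D (Suc 0) 0) \<le> C" using t1 by (intro C) simp
  then have C0: "0 \<le> C" by (rule order_trans[OF norm_ge_zero])
  have "C-lipschitz_on {0..t1} (D 0)"
  proof (rule bounded_derivative_imp_lipschitz)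
    fix t assume t: "t \<in> {0..t1}"
    show "(D 0 has_derivative (\<lambda>h. h *\<^sub>R D (Suc 0) t)) (at t within {0..t1})"
      using D[OF t, of 0] unfolding has_vector_derivative_def .
    show "onorm (\<lambda>h. h *\<^sub>R D (Suc 0) t) \<le> C"
    proof (rule onorm_le)
      fix h :: real
      show "norm (h *\<^sub>R D (Suc 0) t) \<le> C * norm h"
        using mult_left_mono[OF C[OF t], of "\<bar>h\<bar>"] by (simp add: mult.commute)
    qed
  qed (use C0 in auto)
  then show ?thesis using t1 D0 by blast
qed

text \<open>
  Each of the two local conditions becomes uniform over the compact set through which the other
  variable ranges.
\<close>

lemma local_Lipschitz_joint:
  fixes F :: "'a::euclidean_space \<Rightarrow> 'b::real_normed_vector \<Rightarrow> 'c::real_normed_vector"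
  assumes Fy: "local_lipschitz UNIV UNIV (\<lambda>w y. F y w)" and Fw: "local_lipschitz UNIV UNIV (\<lambda>y w. F y w)"
    and Q: "compact Q"
  shows "\<exists>K\<ge>0. \<forall>w\<in>Q. \<forall>w'\<in>Q. \<forall>y y'. norm y \<le> R \<longrightarrow> norm y' \<le> R \<longrightarrow>
      norm (F y w - F y' w') \<le> K * (norm (w - w') + norm (y - y'))"
proof -
  have cy: "continuous_on A (F y)" for A and y :: 'a
    using continuous_on_subset[OF local_lipschitz_continuous_on[OF Fw UNIV_I, of y]] by auto
  have cw: "continuous_on A (\<lambda>y. F y w)" for A and w :: 'b
    using continuous_on_subset[OF local_lipschitz_continuous_on[OF Fy UNIV_I, of w]] by auto
  obtain K1 where K1: "\<And>w. w \<in> Q \<Longrightarrow> K1-lipschitz_on (cball 0 R) (\<lambda>y. F y w)"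
    using local_lipschitz_compact_implies_lipschitz[OF _ compact_cball Q, where f = "\<lambda>w y. F y w"]
      local_lipschitz_subset[OF Fy] cy by (metis subset_UNIV)
  obtain K2 where K2: "\<And>y. y \<in> cball 0 R \<Longrightarrow> K2-lipschitz_on Q (F y)"
    using local_lipschitz_compact_implies_lipschitz[OF _ Q compact_cball, where f = F]
      local_lipschitz_subset[OF Fw] cw by (metis subset_UNIV)
  define K where "K = max 0 (max K1 K2)"
  show ?thesis
  proof (intro exI[of _ K] conjI ballI allI impI)
    show "0 \<le> K" by (simp add: K_def)
    fix w w' :: 'b and y y' :: 'a
    assume a: "w \<in> Q" "w' \<in> Q" "norm y \<le> R" "norm y' \<le> R"
    have "norm (F y w - F y' w') \<le> norm (F y w - F y w') + norm (F y w' - F y' w')"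
      using norm_triangle_ineq[of "F y w - F y w'" "F y w' - F y' w'"] by simp
    also have "\<dots> \<le> K2 * norm (w - w') + K1 * norm (y - y')"
      using lipschitz_on_normD[OF K2 a(1,2), of y] lipschitz_on_normD[OF K1[OF a(2)], of y y'] a
      by (intro add_mono) auto
    also have "\<dots> \<le> K * norm (w - w') + K * norm (y - y')"
      by (intro add_mono mult_right_mono) (auto simp: K_def)
    finally show "norm (F y w - F y' w') \<le> K * (norm (w - w') + norm (y - y'))" by (simp add: distrib_left)
  qed
qed

text \<open>
  Lipschitz continuity on bounded sets gives continuity of \<open>h\<close> as a function of the
  pair.
\<close>

lemma Lipschitz_on_bounded_sets_borel:
  fixes h :: "real \<Rightarrow> 'a::euclidean_space \<Rightarrow> 'b::real_normed_vector"
  assumes K: "\<And>R. 0 \<le> R \<Longrightarrow> \<exists>K\<ge>0. \<forall>t t' p p'. norm p \<le> R \<longrightarrow> norm p' \<le> R \<longrightarrow>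
      norm (h t p - h t' p') \<le> K * (\<bar>t - t'\<bar> + norm (p - p'))"
  shows "(\<lambda>q. h (fst q) (snd q)) \<in> borel_measurable (borel \<Otimes>\<^sub>M borel)"
proof -
  have "isCont (\<lambda>q. h (fst q) (snd q)) q0" for q0
  proof -
    obtain K where K0: "0 \<le> K" and K: "\<And>t t' p p'. norm p \<le> norm (snd q0) + 1 \<Longrightarrow> norm p' \<le> norm (snd q0) + 1 \<Longrightarrow>
      norm (h t p - h t' p') \<le> K * (\<bar>t - t'\<bar> + norm (p - p'))"
      using assms[of "norm (snd q0) + 1"] by auto
    have "((\<lambda>q. h (fst q) (snd q) - h (fst q0) (snd q0)) \<longlongrightarrow> 0) (at q0)"
    proof (rule Lim_null_comparison)
      have "eventually (\<lambda>q. dist q q0 < 1) (at q0)" unfolding eventually_at by (intro exI[of _ 1]) auto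
      then show "\<forall>\<^sub>F q in at q0. norm (h (fst q) (snd q) - h (fst q0) (snd q0)) \<le> K * (\<bar>fst q - fst q0\<bar> + norm (snd q - snd q0))"
      proof eventually_elim
        case (elim q)
        have "norm (snd q - snd q0) \<le> dist q q0" using dist_snd_le[of q q0] by (simp add: dist_norm)
        then have "norm (snd q) \<le> norm (snd q0) + 1" using elim norm_triangle_sub[of "snd q" "snd q0"] by linarith
        then show ?case by (intro K) auto
      qed
      have "((\<lambda>q. K * (\<bar>fst q - fst q0\<bar> + norm (snd q - snd q0))) \<longlongrightarrow> K * (\<bar>fst q0 - fst q0\<bar> + norm (snd q0 - snd q0))) (at q0)"
        by (intro tendsto_intros)
      then show "((\<lambda>q. K * (\<bar>fst q - fst q0\<bar> + norm (snd q - snd q0))) \<longlongrightarrow> 0) (at q0)" by simp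
    qed
    then show ?thesis unfolding isCont_def by (rule LIM_zero_cancel)
  qed
  then have "(\<lambda>q. h (fst q) (snd q)) \<in> borel_measurable borel"
    by (intro borel_measurable_continuous_onI continuous_at_imp_continuous_on) auto
  then show ?thesis by (simp add: borel_prod)
qed

lemma characteristic_coordinate_weaken:
  assumes "characteristic_coordinate L lam \<theta> X \<Theta> \<kappa> out" "\<kappa> \<le> \<kappa>'"
  shows "characteristic_coordinate L lam \<theta> X \<Theta> \<kappa>' out"
proof -
  interpret characteristic_coordinate L lam \<theta> X \<Theta> \<kappa> out by fact
  have le: "ennreal \<kappa> * I \<le> ennreal \<kappa>' * I" for I using assms(2) by (intro mult_right_mono ennreal_leI) auto
  show ?thesis
    by unfold_locales
      (use \<theta>_X X_\<theta> range \<Theta>_pos outlet lam_nz \<theta>_deriv X_deriv cont monotone \<kappa> assms(2)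
        order_trans[OF transport_\<theta> le] order_trans[OF transport_X le] in auto)
qed

text \<open>
  Extracts the bound for a single component and a single time from the maximum of suprema, which
  are finite as the integrands are bounded.
\<close>

lemma admissible_primitive_le:
  fixes \<beta> \<beta>' :: "real \<Rightarrow> real ^ 'm::finite"
  assumes \<beta>: "admissible_beta \<beta>" "admissible_beta \<beta>'" and T: "0 < T"
    and le: "(MAX j. SUP t\<in>{0..T}. \<bar>LINT s:{0..t}|lebesgue. \<beta> s $ j - \<beta>' s $ j\<bar>) \<le> \<epsilon>"
    and t: "t \<in> {0..T}"
  shows "\<bar>LINT s:{0..t}|lborel. (indicat_real {0..T} s *\<^sub>R \<beta> s) $ j - (indicat_real {0..T} s *\<^sub>R \<beta>' s) $ j\<bar> \<le> \<epsilon>"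
proof -
  let ?b = "\<lambda>s. indicat_real {0..T} s *\<^sub>R \<beta> s" and ?b' = "\<lambda>s. indicat_real {0..T} s *\<^sub>R \<beta>' s"
  have [measurable]: "?b \<in> borel_measurable borel" "?b' \<in> borel_measurable borel"
    using piecewise_smooth_Borel[OF _ T] \<beta> unfolding admissible_beta_def by auto
  have m: "(\<lambda>s. ?b s $ j - ?b' s $ j) \<in> borel_measurable borel" for j by measurable
  have bd: "\<bar>?b s $ j - ?b' s $ j\<bar> \<le> 1" for s j
  proof (cases "s \<in> {0..T}")
    case True
    then have "\<beta> s $ j \<in> {0..1}" "\<beta>' s $ j \<in> {0..1}" using \<beta> unfolding admissible_beta_def by auto
    then show ?thesis using True by auto
  qed simp
  have eq: "(LINT s:{0..t}|lebesgue. \<beta> s $ j - \<beta>' s $ j) = (LINT s:{0..t}|lborel. ?b s $ j - ?b' s $ j)" if t: "t \<in> {0..T}" for t j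
    unfolding set_lebesgue_integral_def
  proof (rule integral_lebesgue_eq_lborel)
    show "(\<lambda>s. indicat_real {0..t} s *\<^sub>R (?b s $ j - ?b' s $ j)) \<in> borel_measurable borel" using m by measurable
    show "AE s in lborel. indicat_real {0..t} s *\<^sub>R (\<beta> s $ j - \<beta>' s $ j) = indicat_real {0..t} s *\<^sub>R (?b s $ j - ?b' s $ j)"
      using t by (intro AE_I2) (auto simp: indicator_def)
  qed
  let ?I = "\<lambda>j t. \<bar>LINT s:{0..t}|lebesgue. \<beta> s $ j - \<beta>' s $ j\<bar>"
  have "?I j t \<le> (SUP t\<in>{0..T}. ?I j t)"
  proof (rule cSUP_upper[OF t])
    show "bdd_above ((\<lambda>t. ?I j t) ` {0..T})"
    proof (rule bdd_aboveI2)
      fix s assume s: "s \<in> {0..T}"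
      have "?I j s \<le> 1 * (s - 0)" unfolding eq[OF s] by (rule set_integral_bound_Icc[OF m bd]) (use s in auto)
      then show "?I j s \<le> T" using s by simp
    qed
  qed
  also have "\<dots> \<le> (MAX j. SUP t\<in>{0..T}. ?I j t)" by (rule Max_ge) auto
  finally show ?thesis using le unfolding eq[OF t] by linarith
qed

theorem theorem7:
  fixes L :: real and r :: nat
    and lam :: "'n::{finite,linorder} \<Rightarrow> real \<Rightarrow> real"
    and G :: "'n rmat"
    and d :: "real \<Rightarrow> 'n rvec" and ybar :: "real \<Rightarrow> 'n rvec"
    and f :: "'n rvec \<Rightarrow> 'u::real_normed_vector \<Rightarrow> 'v::real_normed_vector \<Rightarrow> 'n rvec"
    and v :: "'m::finite \<Rightarrow> 'v"
    and Uad :: "'u set"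
    and u :: "real \<Rightarrow> 'u" and \<beta> :: "real \<Rightarrow> real ^ 'm"
  assumes L_pos: "L > 0"
    and r_range: "r \<in> {1..CARD('n)}"
    and lam_neg: "\<And>i x. i \<in> first_indices r \<Longrightarrow> x \<in> {0..L} \<Longrightarrow> lam i x < 0"
    and lam_pos: "\<And>i x. i \<notin> first_indices r \<Longrightarrow> x \<in> {0..L} \<Longrightarrow> lam i x > 0"
    and lam_lipschitz: "\<And>i. \<exists>C. C-lipschitz_on {0..L} (lam i)"
    and f_smooth: "\<And>j w. smooth_map (\<lambda>y. f y w (v j))"
    and f_zero: "\<And>j w. f 0 w (v j) = 0"
    and f_lipschitz_u: "\<And>j. local_lipschitz UNIV UNIV (\<lambda>y w. f y w (v j))"
    and f_lipschitz_y: "\<And>j. local_lipschitz UNIV UNIV (\<lambda>w y. f y w (v j))"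
    and ybar_W11: "piecewise_on W11 0 L ybar"
    and d_W11: "\<And>T. T > 0 \<Longrightarrow> piecewise_on W11 0 T d"
    and Uad_closed: "closed Uad"
    and u_smooth: "piecewise_smooth u"
    and u_admissible: "AE t in lebesgue_on {0..}. u t \<in> Uad"
    and \<beta>_admissible: "admissible_beta \<beta>"
  shows "\<exists>T0>0. \<exists>C>0. \<forall>\<beta>'. admissible_beta \<beta>' \<longrightarrow>
           (\<forall>T \<epsilon>. 0 < T \<longrightarrow> T \<le> T0 \<longrightarrow> \<epsilon> > 0 \<longrightarrow>
              (MAX j. SUP t\<in>{0..T}. \<bar>LINT s:{0..t}|lebesgue. \<beta> s $ j - \<beta>' s $ j\<bar>) \<le> \<epsilon> \<longrightarrow>
              (\<exists>y y'. is_L1_solution L r lam G d ybar f v u \<beta> T y \<and>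
                      is_L1_solution L r lam G d ybar f v u \<beta>' T y' \<and>
                      CL1_norm T L (\<lambda>t x. y t x - y' t x) \<le> C * \<epsilon>))"
proof -
  let ?out = "\<lambda>i. if i \<in> first_indices r then 0 else L"
  have "\<exists>\<theta> X \<Theta> \<kappa>. characteristic_coordinate L (lam i) \<theta> X \<Theta> \<kappa> (?out i)" for i
  proof -
    obtain C where "C-lipschitz_on {0..L} (lam i)" using lam_lipschitz by blast
    then have "continuous_on {0..L} (lam i)" by (rule lipschitz_on_continuous_on)
    moreover have "(i \<notin> first_indices r \<and> (\<forall>x\<in>{0..L}. 0 < lam i x)) \<or> (\<not> i \<notin> first_indices r \<and> (\<forall>x\<in>{0..L}. lam i x < 0))"
      using lam_neg[of i] lam_pos[of i] by blast
    ultimately have "\<exists>\<theta> X \<Theta> \<kappa>. characteristic_coordinate L (lam i) \<theta> X \<Theta> \<kappa> (if i \<notin> first_indices r then L else 0)"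
      by (rule characteristic_coordinate_exists[OF L_pos])
    moreover have "(if i \<notin> first_indices r then L else 0) = ?out i" by simp
    ultimately show ?thesis by (simp only:)
  qed
  then obtain \<theta> X \<Theta> \<kappa>0 where cc: "\<And>i. characteristic_coordinate L (lam i) (\<theta> i) (X i) (\<Theta> i) (\<kappa>0 i) (?out i)" by metis
  \<comment> \<open>the sum of numbers that are at least \<open>1\<close> bounds each of them\<close>
  define \<kappa> where "\<kappa> = (\<Sum>i\<in>UNIV. \<kappa>0 i)"
  have \<kappa>1: "1 \<le> \<kappa>0 i" for i using characteristic_coordinate.\<kappa>[OF cc] .
  have "\<kappa>0 i \<le> \<kappa>" for i
    unfolding \<kappa>_def by (rule member_le_sum) (use \<kappa>1 order_trans[OF zero_le_one] in auto)
  then have chars: "characteristic_coordinate L (lam i) (\<theta> i) (X i) (\<Theta> i) \<kappa> (?out i)" for i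
    by (rule characteristic_coordinate_weaken[OF cc])
  obtain t1 w Cw where t1: "0 < t1" and w_eq: "\<And>t. t \<in> {0<..<t1} \<Longrightarrow> w t = u t" and w: "Cw-lipschitz_on {0..t1} w"
    using piecewise_smooth_initial_Lipschitz[OF u_smooth] by blast
  define T1 where "T1 = Min (insert t1 (range \<Theta>))"
  have T1: "0 < T1" "T1 \<le> t1" "T1 \<le> \<Theta> i" for i
  proof -
    show "0 < T1"
      unfolding T1_def using t1 characteristic_coordinate.\<Theta>_pos[OF cc] by (subst Min_gr_iff) auto
    show "T1 \<le> t1" "T1 \<le> \<Theta> i" unfolding T1_def by (rule Min_le; simp)+
  qed
  obtain y0 where y0: "BV_representative 0 L ybar y0" using piecewise_W11_BV[OF ybar_W11] by blast
  obtain d' where d': "BV_representative 0 T1 d d'" using piecewise_W11_BV[OF d_W11[OF T1(1)]] by blast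
  \<comment> \<open>clamping the time to \<open>[0,t1]\<close> extends \<open>w\<close> to a
    Lipschitz function on the whole line\<close>
  define cl where "cl t = max 0 (min t1 t)" for t :: real
  have cl: "cl t \<in> {0..t1}" "\<bar>cl t - cl t'\<bar> \<le> \<bar>t - t'\<bar>" for t t' using t1 by (auto simp: cl_def)
  define h where "h j t p = f p (w (cl t)) (v j)" for j t p
  have Q: "compact (w ` {0..t1})"
    by (rule compact_continuous_image[OF lipschitz_on_continuous_on[OF w]]) simp
  have h_Lip: "\<exists>K\<ge>0. \<forall>j t t' p p'. norm p \<le> R \<longrightarrow> norm p' \<le> R \<longrightarrow> norm (h j t p - h j t' p') \<le> K * (\<bar>t - t'\<bar> + norm (p - p'))" for R
  proof -
    have "\<exists>K\<ge>0. \<forall>w1\<in>w ` {0..t1}. \<forall>w2\<in>w ` {0..t1}. \<forall>p p'. norm p \<le> R \<longrightarrow> norm p' \<le> R \<longrightarrow>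
        norm (f p w1 (v j) - f p' w2 (v j)) \<le> K * (norm (w1 - w2) + norm (p - p'))" for j
      by (rule local_Lipschitz_joint[OF f_lipschitz_y f_lipschitz_u Q])
    then obtain K0 where K0: "\<And>j. 0 \<le> K0 j" and K: "\<And>j w1 w2 p p'. w1 \<in> w ` {0..t1} \<Longrightarrow> w2 \<in> w ` {0..t1} \<Longrightarrow> norm p \<le> R \<Longrightarrow> norm p' \<le> R \<Longrightarrow>
        norm (f p w1 (v j) - f p' w2 (v j)) \<le> K0 j * (norm (w1 - w2) + norm (p - p'))" by metis
    define K where "K = (\<Sum>j\<in>UNIV. K0 j) * max 1 Cw"
    have S: "K0 j \<le> (\<Sum>j\<in>UNIV. K0 j)" "0 \<le> (\<Sum>j\<in>UNIV. K0 j)" for j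
      by (rule member_le_sum; use K0 in auto) (use K0 in \<open>auto intro: sum_nonneg\<close>)
    show ?thesis
    proof (intro exI[of _ K] conjI allI impI)
      show "0 \<le> K" unfolding K_def using S by simp
      fix j t t' and p p' :: "'n rvec" assume p: "norm p \<le> R" "norm p' \<le> R"
      have "norm (w (cl t) - w (cl t')) \<le> Cw * \<bar>cl t - cl t'\<bar>"
        using lipschitz_on_normD[OF w cl(1) cl(1), of t t'] by simp
      also have "\<dots> \<le> Cw * \<bar>t - t'\<bar>" using cl(2) lipschitz_on_nonneg[OF w] by (rule mult_left_mono)
      also have "\<dots> \<le> max 1 Cw * \<bar>t - t'\<bar>" by (intro mult_right_mono) auto
      finally have 1: "norm (w (cl t) - w (cl t')) \<le> max 1 Cw * \<bar>t - t'\<bar>" .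
      have 2: "1 * norm (p - p') \<le> max 1 Cw * norm (p - p')" by (intro mult_right_mono) auto
      have "norm (h j t p - h j t' p') \<le> K0 j * (norm (w (cl t) - w (cl t')) + norm (p - p'))"
        unfolding h_def by (rule K) (use cl(1) p in auto)
      also have "\<dots> \<le> (\<Sum>j\<in>UNIV. K0 j) * (max 1 Cw * \<bar>t - t'\<bar> + max 1 Cw * norm (p - p'))"
        using 1 2 S by (intro mult_mono add_mono) auto
      finally show "norm (h j t p - h j t' p') \<le> K * (\<bar>t - t'\<bar> + norm (p - p'))"
        by (simp add: K_def distrib_left mult.assoc)
    qed
  qed
  interpret relaxed_ibvp L r lam G d ybar f v u \<theta> X \<Theta> \<kappa> d' y0 h T1
  proof (rule relaxed_ibvp.intro)
    show "h j t p = f p (u t) (v j)" if "t \<in> {0<..<T1}" for j t p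
      using that T1(2) w_eq[of t] by (simp add: h_def cl_def)
    show "(\<lambda>q. h j (fst q) (snd q)) \<in> borel_measurable (borel \<Otimes>\<^sub>M borel)" for j
      by (rule Lipschitz_on_bounded_sets_borel) (use h_Lip in blast)
    show "h j t 0 = 0" for j t unfolding h_def by (rule f_zero)
  qed (rule L_pos chars T1 y0 d' h_Lip)+
  obtain T0 C where T0: "0 < T0" and C: "0 < C"
    and est: "\<And>T \<beta> \<beta>' \<epsilon>. 0 < T \<Longrightarrow> T \<le> T0 \<Longrightarrow> 0 \<le> \<epsilon> \<Longrightarrow>
     weights T (trunc T \<beta>) \<Longrightarrow> weights T (trunc T \<beta>') \<Longrightarrow> \<forall>t j. 0 \<le> trunc T \<beta> t $ j \<and> 0 \<le> trunc T \<beta>' t $ j \<Longrightarrow>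
     \<forall>t\<in>{0..T}. \<forall>j. \<bar>LINT s:{0..t}|lborel. trunc T \<beta> s $ j - trunc T \<beta>' s $ j\<bar> \<le> \<epsilon> \<Longrightarrow>
     \<exists>y y'. is_L1_solution L r lam G d ybar f v u \<beta> T y \<and> is_L1_solution L r lam G d ybar f v u \<beta>' T y' \<and>
        CL1_norm T L (\<lambda>t x. y t x - y' t x) \<le> C * \<epsilon>"
    using relaxed_stability by blast
  have adm: "weights T (trunc T b)" "0 \<le> trunc T b t $ j" if "admissible_beta b" "0 < T" for T b t j
  proof -
    have b: "b t $ j \<in> {0..1}" if "0 \<le> t" for t j using \<open>admissible_beta b\<close> that unfolding admissible_beta_def by blast
    show "weights T (trunc T b)"
      unfolding weights_def
    proof (intro conjI allI)
      show "trunc T b \<in> borel_measurable borel"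
        unfolding trunc_def using that piecewise_smooth_Borel unfolding admissible_beta_def by blast
      show "\<bar>trunc T b t $ j\<bar> \<le> indicat_real {0..T} t" for t j
        using b[of t j] by (auto simp: trunc_def indicator_def)
    qed
    show "0 \<le> trunc T b t $ j" using b[of t j] by (auto simp: trunc_def indicator_def)
  qed
  show ?thesis
  proof (rule exI[of _ T0], rule conjI[OF T0], rule exI[of _ C], rule conjI[OF C], intro allI impI)
    fix \<beta>' :: "real \<Rightarrow> real ^ 'm" and T \<epsilon> :: real
    assume \<beta>': "admissible_beta \<beta>'" and T: "0 < T" "T \<le> T0" and \<epsilon>: "\<epsilon> > 0"
      and le: "(MAX j. SUP t\<in>{0..T}. \<bar>LINT s:{0..t}|lebesgue. \<beta> s $ j - \<beta>' s $ j\<bar>) \<le> \<epsilon>"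
    show "\<exists>y y'. is_L1_solution L r lam G d ybar f v u \<beta> T y \<and> is_L1_solution L r lam G d ybar f v u \<beta>' T y' \<and>
        CL1_norm T L (\<lambda>t x. y t x - y' t x) \<le> C * \<epsilon>"
      by (rule est[OF T less_imp_le[OF \<epsilon>]])
        (use adm[OF \<beta>_admissible T(1)] adm[OF \<beta>' T(1)] admissible_primitive_le[OF \<beta>_admissible \<beta>' T(1) le] in \<open>auto simp: trunc_def\<close>)
  qed
qed

end
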